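(* Let $(B,g_B)$ and $(F,g_F)$ be Riemannian manifolds of dimensions $n_1=\dim B$ and $n_2=\dim F$, let $n=n_1+n_2$, let $f$ be a positive differentiable function on $B$, let $M=B\times_f F$ be the warped product manifold with metric $g=g_B+f^2g_F$, and let $(\overline{M},\overline{g})$ be a Riemannian manifold. Let $\phi:(M,g)\to(\overline{M},\overline{g})$ be an isometric immersion. Then, at every point of $M$, $$\frac{\triangle f}{f}\ge \frac{n_1n^2}{2(n-1)}H^2-\frac{n_1}{2}\|h\|^2+n_1\inf\overline{K}.$$
   Context: Manifolds have positive dimension and "differentiable" means smooth. The warped product $M=B\times_f F$ is $B\times F$ with the metric $g$ given by $\|X\|^2=\|d\pi_1X\|^2+f^2(\pi_1(x))\|d\pi_2X\|^2$ for $X\in T_xM$, where $\pi_1:B\times F\to B$ and $\pi_2:B\times F\to F$ are the projections; functions on $B$ are regarded as functions on $M$ via $\pi_1$. $\mathcal{D}_1$ is the distribution on $M$ of vectors tangent to the lifts of $B$. Laplacian: $\triangle f=\sum_{i=1}^{n_1}\big((\nabla_{e_i}e_i)f-e_i^2f\big)$, where $e_1,\dots,e_{n_1}$ is a local orthonormal frame of $\mathcal{D}_1$ consisting of lifts of a local orthonormal frame of $B$ and $\nabla$ is the Levi-Civita connection of $(M,g)$; equivalently, $\triangle f=-\mathrm{div}(\mathrm{grad}\,f)$ computed on $(B,g_B)$ (note the sign). Identify $T_pM$ with $d\phi(T_pM)$. Let $h$ be the second fundamental form of $\phi$. For a local orthonormal frame $e_1,\dots,e_n$ of $TM$: $\overrightarrow{H}=\frac1n\sum_{i=1}^n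 h(e_i,e_i)$ is the mean curvature vector, $H^2=\langle\overrightarrow{H},\overrightarrow{H}\rangle$, and $\|h\|^2=\sum_{i,j=1}^n\langle h(e_i,e_j),h(e_i,e_j)\rangle$. $\overline{K}(\pi)$ is the sectional curvature in $\overline{M}$ of a plane $\pi$, and $\inf\overline{K}$ is the function on $M$ given by $(\inf\overline{K})(p)=\inf\{\overline{K}(\pi)\mid \pi\subset T_pM,\ \dim\pi=2\}$. *)

theory Defs
  imports "HOL-Analysis.Analysis"
begin

section \<open>Smooth functions on open subsets of Euclidean spaces\<close>

primrec Ck_on :: "nat \<Rightarrow> ('a::euclidean_space \<Rightarrow> 'b::real_normed_vector) \<Rightarrow> 'a set \<Rightarrow> bool" where
  "Ck_on 0 f S \<longleftrightarrow> continuous_on S f"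
| "Ck_on (Suc k) f S \<longleftrightarrow>
     (\<forall>x\<in>S. f differentiable (at x)) \<and> (\<forall>v. Ck_on k (\<lambda>x. frechet_derivative f (at x) v) S)"

definition smooth_on :: "'a set \<Rightarrow> ('a::euclidean_space \<Rightarrow> 'b::real_normed_vector) \<Rightarrow> bool" where
  "smooth_on S f \<longleftrightarrow> open S \<and> (\<forall>k. Ck_on k f S)"


section \<open>Manifolds, tangent vectors, differentials\<close>

text \<open>
  The points of a manifold are the elements of a type \<open>'m\<close>; the smooth structure is given by an
  atlas (not necessarily maximal) with values in a Euclidean space \<open>'e\<close>, so the dimension
  is \<open>DIM('e) \<ge> 1\<close>. A chart is a pair of its domain and its coordinate map; the coordinate map
  is irrelevant outside the domain.
\<close>

type_synonym ('m, 'e) chart = "'m set \<times> ('m \<Rightarrow> 'e)"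
type_synonym ('m, 'e) atlas = "('m, 'e) chart set"

definition chart_image :: "('m, 'e) chart \<Rightarrow> 'e set" where
  "chart_image c = snd c ` fst c"

definition chart_inv :: "('m, 'e) chart \<Rightarrow> 'e \<Rightarrow> 'm" where
  "chart_inv c = inv_into (fst c) (snd c)"

definition is_chart :: "('m::topological_space, 'e::euclidean_space) chart \<Rightarrow> bool" where
  "is_chart c \<longleftrightarrow> open (fst c) \<and> open (chart_image c) \<and>
     homeomorphism (fst c) (chart_image c) (snd c) (chart_inv c)"

definition smooth_manifold ::
    "('m::{t2_space, second_countable_topology}, 'e::euclidean_space) atlas \<Rightarrow> bool" where
  "smooth_manifold A \<longleftrightarrow>
     (\<forall>c\<in>A. is_chart c) \<and> (\<Union>c\<in>A. fst c) = UNIV \<and>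
     (\<forall>c\<in>A. \<forall>d\<in>A. smooth_on (snd c ` (fst c \<inter> fst d)) (snd d \<circ> chart_inv c))"

text \<open>
  Each point gets a preferred chart. A tangent vector at \<open>p\<close> is represented by its components in
  the preferred chart at \<open>p\<close>, so that every \<open>T\<^sub>p M\<close> is the model space \<open>'e\<close>. Vector fields are
  maps \<open>'m \<Rightarrow> 'e\<close> and metrics are maps \<open>'m \<Rightarrow> 'e \<Rightarrow> 'e \<Rightarrow> real\<close> in this sense. As the preferred
  chart jumps from point to point, smoothness and derivatives are always taken after passing
  to the components in one fixed chart (\<open>field_in\<close>, \<open>metric_in\<close> below).
\<close>

definition chart_at :: "('m, 'e) atlas \<Rightarrow> 'm \<Rightarrow> ('m, 'e) chart" where
  "chart_at A p = (SOME c. c \<in> A \<and> p \<in> fst c)"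

definition smooth_fun :: "('m::topological_space, 'e::euclidean_space) atlas \<Rightarrow> ('m \<Rightarrow> real) \<Rightarrow> bool" where
  "smooth_fun A f \<longleftrightarrow> (\<forall>c\<in>A. smooth_on (chart_image c) (f \<circ> chart_inv c))"

definition smooth_map :: "('m::topological_space, 'e::euclidean_space) atlas \<Rightarrow>
    ('n::topological_space, 'd::euclidean_space) atlas \<Rightarrow> ('m \<Rightarrow> 'n) \<Rightarrow> bool" where
  "smooth_map A A' \<phi> \<longleftrightarrow> continuous_on UNIV \<phi> \<and>
     (\<forall>c\<in>A. \<forall>d\<in>A'. smooth_on (snd c ` (fst c \<inter> \<phi> -` fst d)) (snd d \<circ> \<phi> \<circ> chart_inv c))"

definition differential :: "('m, 'e::euclidean_space) atlas \<Rightarrow> ('n, 'd::euclidean_space) atlas \<Rightarrow>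
    ('m \<Rightarrow> 'n) \<Rightarrow> 'm \<Rightarrow> 'e \<Rightarrow> 'd" where
  "differential A A' \<phi> p =
     (let c = chart_at A p; d = chart_at A' (\<phi> p)
      in frechet_derivative (snd d \<circ> \<phi> \<circ> chart_inv c) (at (snd c p)))"

text \<open>The derivative \<open>X\<psi>\<close> of a function in the direction of a vector field.\<close>

definition vf_apply :: "('m, 'e::euclidean_space) atlas \<Rightarrow> ('m \<Rightarrow> 'e) \<Rightarrow> ('m \<Rightarrow> real) \<Rightarrow> 'm \<Rightarrow> real" where
  "vf_apply A X \<psi> p =
     (let c = chart_at A p in frechet_derivative (\<psi> \<circ> chart_inv c) (at (snd c p)) (X p))"

text \<open>Derivative at \<open>y\<close> of the change of coordinates from the chart \<open>c\<close> to the chart \<open>d\<close>.\<close>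

definition chart_change :: "('m, 'e::euclidean_space) chart \<Rightarrow> ('m, 'e) chart \<Rightarrow> 'e \<Rightarrow> 'e \<Rightarrow> 'e" where
  "chart_change c d y = frechet_derivative (snd d \<circ> chart_inv c) (at y)"

definition field_in :: "('m, 'e::euclidean_space) atlas \<Rightarrow> ('m, 'e) chart \<Rightarrow> ('m \<Rightarrow> 'e) \<Rightarrow> 'e \<Rightarrow> 'e" where
  "field_in A c X y =
     (let p = chart_inv c y; d = chart_at A p in chart_change d c (snd d p) (X p))"

definition metric_in :: "('m, 'e::euclidean_space) atlas \<Rightarrow> ('m \<Rightarrow> 'e \<Rightarrow> 'e \<Rightarrow> real) \<Rightarrow>
    ('m, 'e) chart \<Rightarrow> 'e \<Rightarrow> 'e \<Rightarrow> 'e \<Rightarrow> real" where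
  "metric_in A g c y u v =
     (let p = chart_inv c y; d = chart_at A p
      in g p (chart_change c d y u) (chart_change c d y v))"

definition riemannian_manifold ::
    "('m::{t2_space, second_countable_topology}, 'e::euclidean_space) atlas \<Rightarrow>
     ('m \<Rightarrow> 'e \<Rightarrow> 'e \<Rightarrow> real) \<Rightarrow> bool" where
  "riemannian_manifold A g \<longleftrightarrow> smooth_manifold A \<and>
     (\<forall>p. bilinear (g p) \<and> (\<forall>u v. g p u v = g p v u) \<and> (\<forall>u. u \<noteq> 0 \<longrightarrow> g p u u > 0)) \<and>
     (\<forall>c\<in>A. \<forall>u v. smooth_on (chart_image c) (\<lambda>y. metric_in A g c y u v))"

text \<open>Smooth \<open>g\<close>-orthonormal fields \<open>e 0, \<dots>, e (n - 1)\<close> on the open set \<open>U\<close>, with \<open>n\<close> the dimension.\<close>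

definition orthonormal_frame_on :: "('m::topological_space, 'e::euclidean_space) atlas \<Rightarrow>
    ('m \<Rightarrow> 'e \<Rightarrow> 'e \<Rightarrow> real) \<Rightarrow> 'm set \<Rightarrow> (nat \<Rightarrow> 'm \<Rightarrow> 'e) \<Rightarrow> bool" where
  "orthonormal_frame_on A g U e \<longleftrightarrow> open U \<and>
     (\<forall>i<DIM('e). \<forall>c\<in>A. smooth_on (snd c ` (fst c \<inter> U)) (field_in A c (e i))) \<and>
     (\<forall>p\<in>U. \<forall>i<DIM('e). \<forall>j<DIM('e). g p (e i p) (e j p) = (if i = j then 1 else 0))"

definition local_frame :: "('m::topological_space, 'e::euclidean_space) atlas \<Rightarrow>
    ('m \<Rightarrow> 'e \<Rightarrow> 'e \<Rightarrow> real) \<Rightarrow> 'm \<Rightarrow> nat \<Rightarrow> 'm \<Rightarrow> 'e" where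
  "local_frame A g p = (SOME e. \<exists>U. p \<in> U \<and> orthonormal_frame_on A g U e)"


section \<open>Levi-Civita connection and curvature\<close>

text \<open>
  First in one chart: \<open>G\<close> is a metric on an open subset of \<open>'e\<close> and vector fields are maps
  \<open>'e \<Rightarrow> 'e\<close>. The bilinear map \<open>christoffel G y\<close> is \<open>(u, v) \<mapsto> \<Gamma>\<^sup>k\<^sub>i\<^sub>j(y) u\<^sup>i v\<^sup>j\<close>, characterised by
  the Koszul formula for the (commuting) constant fields \<open>u\<close>, \<open>v\<close>, \<open>w\<close>.
\<close>

definition christoffel :: "('e::euclidean_space \<Rightarrow> 'e \<Rightarrow> 'e \<Rightarrow> real) \<Rightarrow> 'e \<Rightarrow> 'e \<Rightarrow> 'e \<Rightarrow> 'e" where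
  "christoffel G y u v = (THE z. \<forall>w. 2 * G y z w =
       frechet_derivative (\<lambda>x. G x v w) (at y) u
     + frechet_derivative (\<lambda>x. G x u w) (at y) v
     - frechet_derivative (\<lambda>x. G x u v) (at y) w)"

definition cov_deriv :: "('e::euclidean_space \<Rightarrow> 'e \<Rightarrow> 'e \<Rightarrow> real) \<Rightarrow> ('e \<Rightarrow> 'e) \<Rightarrow> ('e \<Rightarrow> 'e) \<Rightarrow> 'e \<Rightarrow> 'e" where
  "cov_deriv G X Y y = frechet_derivative Y (at y) (X y) + christoffel G y (X y) (Y y)"

definition lie_bracket :: "('e::euclidean_space \<Rightarrow> 'e) \<Rightarrow> ('e \<Rightarrow> 'e) \<Rightarrow> 'e \<Rightarrow> 'e" where
  "lie_bracket X Y y = frechet_derivative Y (at y) (X y) - frechet_derivative X (at y) (Y y)"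

definition curv :: "('e::euclidean_space \<Rightarrow> 'e \<Rightarrow> 'e \<Rightarrow> real) \<Rightarrow>
    ('e \<Rightarrow> 'e) \<Rightarrow> ('e \<Rightarrow> 'e) \<Rightarrow> ('e \<Rightarrow> 'e) \<Rightarrow> 'e \<Rightarrow> 'e" where
  "curv G X Y Z y = cov_deriv G X (cov_deriv G Y Z) y - cov_deriv G Y (cov_deriv G X Z) y
     - cov_deriv G (lie_bracket X Y) Z y"

text \<open>
  Covariant derivative, in the direction of the constant field \<open>u\<close>, of a vector field \<open>V\<close> along a
  map \<open>\<Phi>\<close> into the domain of the metric \<open>G\<close>.
\<close>

definition cov_deriv_along :: "('d::euclidean_space \<Rightarrow> 'd \<Rightarrow> 'd \<Rightarrow> real) \<Rightarrow>
    ('e::euclidean_space \<Rightarrow> 'd) \<Rightarrow> 'e \<Rightarrow> ('e \<Rightarrow> 'd) \<Rightarrow> 'e \<Rightarrow> 'd" where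
  "cov_deriv_along G \<Phi> u V y = frechet_derivative V (at y) u
     + christoffel G (\<Phi> y) (frechet_derivative \<Phi> (at y) u) (V y)"

text \<open>The Levi-Civita connection \<open>\<nabla>\<^sub>X Y\<close> of a Riemannian manifold.\<close>

definition nabla :: "('m, 'e::euclidean_space) atlas \<Rightarrow> ('m \<Rightarrow> 'e \<Rightarrow> 'e \<Rightarrow> real) \<Rightarrow>
    ('m \<Rightarrow> 'e) \<Rightarrow> ('m \<Rightarrow> 'e) \<Rightarrow> 'm \<Rightarrow> 'e" where
  "nabla A g X Y p =
     (let c = chart_at A p
      in cov_deriv (metric_in A g c) (field_in A c X) (field_in A c Y) (snd c p))"

text \<open>
  \<open>R(u,v)w\<close> at \<open>p\<close>, the tangent vectors being extended to fields with constant components in the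
  preferred chart; \<open>R\<close> is a tensor, so the extension does not matter.
\<close>

definition curvature_tensor :: "('m, 'e::euclidean_space) atlas \<Rightarrow> ('m \<Rightarrow> 'e \<Rightarrow> 'e \<Rightarrow> real) \<Rightarrow>
    'm \<Rightarrow> 'e \<Rightarrow> 'e \<Rightarrow> 'e \<Rightarrow> 'e" where
  "curvature_tensor A g p u v w =
     (let c = chart_at A p in curv (metric_in A g c) (\<lambda>_. u) (\<lambda>_. v) (\<lambda>_. w) (snd c p))"

text \<open>Sectional curvature of a plane (2-dimensional subspace) \<open>P\<close> of \<open>T\<^sub>p M\<close>, by any basis of \<open>P\<close>.\<close>

definition sectional_curvature :: "('m, 'e::euclidean_space) atlas \<Rightarrow> ('m \<Rightarrow> 'e \<Rightarrow> 'e \<Rightarrow> real) \<Rightarrow>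
    'm \<Rightarrow> 'e set \<Rightarrow> real" where
  "sectional_curvature A g p P =
     (let (u, v) = (SOME (u, v). u \<noteq> v \<and> independent {u, v} \<and> span {u, v} = P)
      in g p (curvature_tensor A g p u v v) u / (g p u u * g p v v - (g p u v)\<^sup>2))"


section \<open>Isometric immersions\<close>

definition isometric_immersion ::
    "('m::topological_space, 'e::euclidean_space) atlas \<Rightarrow> ('m \<Rightarrow> 'e \<Rightarrow> 'e \<Rightarrow> real) \<Rightarrow>
     ('n::topological_space, 'd::euclidean_space) atlas \<Rightarrow> ('n \<Rightarrow> 'd \<Rightarrow> 'd \<Rightarrow> real) \<Rightarrow> ('m \<Rightarrow> 'n) \<Rightarrow> bool" where
  "isometric_immersion A g A' g' \<phi> \<longleftrightarrow> smooth_map A A' \<phi> \<and>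
     (\<forall>p. inj (differential A A' \<phi> p) \<and>
       (\<forall>u v. g' (\<phi> p) (differential A A' \<phi> p u) (differential A A' \<phi> p v) = g p u v))"

text \<open>
  Gauss formula \<open>h(u,v) = \<nabla>'\<^sub>u(d\<phi> v) - d\<phi>(\<nabla>\<^sub>u v)\<close>, with \<open>u\<close>, \<open>v\<close> extended to fields with constant
  components in the preferred chart at \<open>p\<close>; \<open>h\<close> is a tensor, so the extension does not matter.
\<close>

definition second_fundamental_form ::
    "('m, 'e::euclidean_space) atlas \<Rightarrow> ('m \<Rightarrow> 'e \<Rightarrow> 'e \<Rightarrow> real) \<Rightarrow>
     ('n, 'd::euclidean_space) atlas \<Rightarrow> ('n \<Rightarrow> 'd \<Rightarrow> 'd \<Rightarrow> real) \<Rightarrow> ('m \<Rightarrow> 'n) \<Rightarrow> 'm \<Rightarrow> 'e \<Rightarrow> 'e \<Rightarrow> 'd" where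
  "second_fundamental_form A g A' g' \<phi> p u v =
     (let c = chart_at A p; d = chart_at A' (\<phi> p); y = snd c p; \<Phi> = snd d \<circ> \<phi> \<circ> chart_inv c
      in cov_deriv_along (metric_in A' g' d) \<Phi> u (\<lambda>x. frechet_derivative \<Phi> (at x) v) y
         - frechet_derivative \<Phi> (at y) (cov_deriv (metric_in A g c) (\<lambda>_. u) (\<lambda>_. v) y))"

definition mean_curvature_vector ::
    "('m::topological_space, 'e::euclidean_space) atlas \<Rightarrow> ('m \<Rightarrow> 'e \<Rightarrow> 'e \<Rightarrow> real) \<Rightarrow>
     ('n, 'd::euclidean_space) atlas \<Rightarrow> ('n \<Rightarrow> 'd \<Rightarrow> 'd \<Rightarrow> real) \<Rightarrow> ('m \<Rightarrow> 'n) \<Rightarrow> 'm \<Rightarrow> 'd" where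
  "mean_curvature_vector A g A' g' \<phi> p =
     (let e = local_frame A g p
      in (1 / real DIM('e)) *\<^sub>R
         (\<Sum>i<DIM('e). second_fundamental_form A g A' g' \<phi> p (e i p) (e i p)))"

definition squared_mean_curvature ::
    "('m::topological_space, 'e::euclidean_space) atlas \<Rightarrow> ('m \<Rightarrow> 'e \<Rightarrow> 'e \<Rightarrow> real) \<Rightarrow>
     ('n, 'd::euclidean_space) atlas \<Rightarrow> ('n \<Rightarrow> 'd \<Rightarrow> 'd \<Rightarrow> real) \<Rightarrow> ('m \<Rightarrow> 'n) \<Rightarrow> 'm \<Rightarrow> real" where
  "squared_mean_curvature A g A' g' \<phi> p =
     g' (\<phi> p) (mean_curvature_vector A g A' g' \<phi> p) (mean_curvature_vector A g A' g' \<phi> p)"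

definition squared_norm_sff ::
    "('m::topological_space, 'e::euclidean_space) atlas \<Rightarrow> ('m \<Rightarrow> 'e \<Rightarrow> 'e \<Rightarrow> real) \<Rightarrow>
     ('n, 'd::euclidean_space) atlas \<Rightarrow> ('n \<Rightarrow> 'd \<Rightarrow> 'd \<Rightarrow> real) \<Rightarrow> ('m \<Rightarrow> 'n) \<Rightarrow> 'm \<Rightarrow> real" where
  "squared_norm_sff A g A' g' \<phi> p =
     (let e = local_frame A g p; h = second_fundamental_form A g A' g' \<phi> p
      in \<Sum>i<DIM('e). \<Sum>j<DIM('e). g' (\<phi> p) (h (e i p) (e j p)) (h (e i p) (e j p)))"

text \<open>The planes \<open>P \<subseteq> T\<^sub>p M\<close> are the planes of the ambient tangent space inside \<open>d\<phi>(T\<^sub>p M)\<close>.\<close>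

definition inf_sectional :: "('m, 'e::euclidean_space) atlas \<Rightarrow>
    ('n, 'd::euclidean_space) atlas \<Rightarrow> ('n \<Rightarrow> 'd \<Rightarrow> 'd \<Rightarrow> real) \<Rightarrow> ('m \<Rightarrow> 'n) \<Rightarrow> 'm \<Rightarrow> real" where
  "inf_sectional A A' g' \<phi> p =
     Inf {sectional_curvature A' g' (\<phi> p) P | P.
            subspace P \<and> dim P = 2 \<and> P \<subseteq> range (differential A A' \<phi> p)}"


section \<open>Warped products\<close>

definition product_atlas :: "('b, 'e) atlas \<Rightarrow> ('f, 'd) atlas \<Rightarrow> ('b \<times> 'f, 'e \<times> 'd) atlas" where
  "product_atlas A\<^sub>B A\<^sub>F = {(fst c \<times> fst d, map_prod (snd c) (snd d)) | c d. c \<in> A\<^sub>B \<and> d \<in> A\<^sub>F}"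

definition warped_metric ::
    "('b, 'e::euclidean_space) atlas \<Rightarrow> ('b \<Rightarrow> 'e \<Rightarrow> 'e \<Rightarrow> real) \<Rightarrow> ('b \<Rightarrow> real) \<Rightarrow>
     ('f, 'd::euclidean_space) atlas \<Rightarrow> ('f \<Rightarrow> 'd \<Rightarrow> 'd \<Rightarrow> real) \<Rightarrow>
     'b \<times> 'f \<Rightarrow> 'e \<times> 'd \<Rightarrow> 'e \<times> 'd \<Rightarrow> real" where
  "warped_metric A\<^sub>B g\<^sub>B f A\<^sub>F g\<^sub>F x u v =
     (let A = product_atlas A\<^sub>B A\<^sub>F; d1 = differential A A\<^sub>B fst x; d2 = differential A A\<^sub>F snd x
      in g\<^sub>B (fst x) (d1 u) (d1 v) + (f (fst x))\<^sup>2 * g\<^sub>F (snd x) (d2 u) (d2 v))"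

text \<open>
  The lift of a vector field \<open>X\<close> on \<open>B\<close> to the product: at \<open>(b, q)\<close> it is the image of \<open>X b\<close> under
  the differential of the inclusion of the leaf \<open>B \<times> {q}\<close>.
\<close>

definition lift_field :: "('b, 'e::euclidean_space) atlas \<Rightarrow> ('f, 'd::euclidean_space) atlas \<Rightarrow>
    ('b \<Rightarrow> 'e) \<Rightarrow> 'b \<times> 'f \<Rightarrow> 'e \<times> 'd" where
  "lift_field A\<^sub>B A\<^sub>F X x =
     differential A\<^sub>B (product_atlas A\<^sub>B A\<^sub>F) (\<lambda>b. (b, snd x)) (fst x) (X (fst x))"

text \<open>
  The Laplacian at a point \<open>x\<close> of the warped product of the function \<open>\<psi>\<close> on \<open>B\<close>, with the sign
  convention \<open>\<Sum>\<^sub>i ((\<nabla>\<^sub>e\<^sub>i e\<^sub>i) \<psi> - e\<^sub>i e\<^sub>i \<psi>)\<close>; here \<open>E i\<close> is the lift of the \<open>i\<close>-th field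
  of a local orthonormal frame of \<open>B\<close>.
\<close>

definition warped_laplacian ::
    "('b::topological_space, 'e::euclidean_space) atlas \<Rightarrow> ('b \<Rightarrow> 'e \<Rightarrow> 'e \<Rightarrow> real) \<Rightarrow> ('b \<Rightarrow> real) \<Rightarrow>
     ('f, 'd::euclidean_space) atlas \<Rightarrow> ('f \<Rightarrow> 'd \<Rightarrow> 'd \<Rightarrow> real) \<Rightarrow>
     ('b \<Rightarrow> real) \<Rightarrow> 'b \<times> 'f \<Rightarrow> real" where
  "warped_laplacian A\<^sub>B g\<^sub>B f A\<^sub>F g\<^sub>F \<psi> x =
     (let A = product_atlas A\<^sub>B A\<^sub>F; g = warped_metric A\<^sub>B g\<^sub>B f A\<^sub>F g\<^sub>F;
          E = (\<lambda>i. lift_field A\<^sub>B A\<^sub>F (local_frame A\<^sub>B g\<^sub>B (fst x) i)); \<psi>' = \<psi> \<circ> fst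
      in \<Sum>i<DIM('e). vf_apply A (nabla A g (E i) (E i)) \<psi>' x
                      - vf_apply A (E i) (vf_apply A (E i) \<psi>') x)"

end

(*
For vectors e_j tangent to B and e_s tangent to F, both of unit length, the sectional curvature of the
warped product on their plane is -Hess f(e_j, e_j) / f, so for a fixed e_s the sum over an orthonormal
frame e_1, ..., e_{n_1} of D_1 is (Laplacian f) / f. By the Gauss equation each of these curvatures is
at least inf K + <h_jj, h_ss> - |h_js|^2. Applying the Cauchy-Schwarz inequality to the n - 1 vectors
h_jj + h_ss and h_ii (i distinct from j, s), whose sum is n H, gives
  2 <h_jj, h_ss> - 2 |h_js|^2 >= n^2 H^2 / (n - 1) - |h|^2,
and summing over j yields the theorem. Symmetry of second derivatives gives the symmetries of the
curvature tensor that make K well defined on planes and bounded below at each point, so that inf K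
is a genuine infimum.
*)
theory Submission
  imports Defs
begin

section \<open>Smooth functions\<close>

text \<open>The definitions pick frames, charts and bases of planes by Hilbert choice, so each
  quantity must first be freed from the choice: traces by expanding one orthonormal basis in
  another, derivatives and metrics by the chain rule for changes of chart, sectional curvature by
  the effect of a change of basis. After that all geometry takes place in one chart, where
  \<open>christoffel\<close> carries the connection. Two facts keep the argument pointwise. In the
  expression for the Laplacian the derivatives of the frame fields cancel, so it sees only the
  values of the frame at the point. And the mean curvature and the squared norm of h are traces of
  bilinear maps, so they may be evaluated in a basis adapted to the product that is orthonormal
  merely at that point. The vector e_s exists because the fibre has positive dimension, and one
  choice of it serves for all j since the mixed curvature depends on the base vector alone.\<close>

abbreviation dd :: "('a::real_normed_vector \<Rightarrow> 'b::real_normed_vector) \<Rightarrow> 'a \<Rightarrow> 'a \<Rightarrow> 'b" where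
  "dd f v x \<equiv> frechet_derivative f (at x) v"

lemma dd_eq: "(f has_derivative f') (at x) \<Longrightarrow> dd f v x = f' v"
  by (metis frechet_derivative_at)

lemma has_derivative_dd: "f differentiable (at x) \<Longrightarrow> (f has_derivative (\<lambda>v. dd f v x)) (at x)"
  by (simp add: frechet_derivative_works)

lemma differentiable_cong_open:
  assumes "open S" "x \<in> S" "\<And>y. y \<in> S \<Longrightarrow> f y = g y" "f differentiable (at x)"
  shows "g differentiable (at x)"
  using assms has_derivative_transform_within_open unfolding differentiable_def by blast

text \<open>No differentiability is assumed: \<open>frechet_derivative\<close> is a choice among the
  derivatives at the point, and functions that agree on an open set have the same ones.\<close>

lemma dd_cong_open:
  assumes "open S" "x \<in> S" "\<And>y. y \<in> S \<Longrightarrow> f y = g y"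
  shows "dd f v x = dd g v x"
proof -
  have "(f has_derivative F) (at x) \<longleftrightarrow> (g has_derivative F) (at x)" for F
    using assms by (metis has_derivative_transform_within_open)
  then show ?thesis unfolding frechet_derivative_def by simp
qed

lemma linear_dd: "f differentiable (at x) \<Longrightarrow> linear (\<lambda>v. dd f v x)"
  by (rule linear_frechet_derivative)

lemma dd_compose:
  assumes "f differentiable (at x)" "g differentiable (at (f x))"
  shows "dd (\<lambda>x. g (f x)) v x = dd g (dd f v x) (f x)"
  using frechet_derivative_compose[OF assms] by (simp add: o_def)

section \<open>Functions with finitely many continuous derivatives\<close>

lemma Ck_on_cong:
  assumes "open S" "\<And>x. x \<in> S \<Longrightarrow> f x = g x"
  shows "Ck_on k f S \<longleftrightarrow> Ck_on k g S"
  using assms(2)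
proof (induction k arbitrary: f g)
  case 0
  then show ?case by (simp cong: continuous_on_cong)
next
  case (Suc k)
  have "f differentiable (at x) \<longleftrightarrow> g differentiable (at x)" if "x \<in> S" for x
    using differentiable_cong_open[OF assms(1) that] Suc.prems by metis
  moreover have "Ck_on k (dd f v) S \<longleftrightarrow> Ck_on k (dd g v) S" for v
    by (rule Suc.IH) (use dd_cong_open[OF assms(1)] Suc.prems in blast)
  ultimately show ?case by simp
qed

lemma Ck_on_lower: "Ck_on (Suc k) f S \<Longrightarrow> Ck_on k f S"
proof (induction k arbitrary: f)
  case 0
  then show ?case
    by (simp add: continuous_at_imp_continuous_on differentiable_imp_continuous_within)
next
  case (Suc k)
  then show ?case by (metis Ck_on.simps(2))
qed

lemma Ck_on_subset: "Ck_on k f S \<Longrightarrow> T \<subseteq> S \<Longrightarrow> Ck_on k f T"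
  by (induction k arbitrary: f) (auto intro: continuous_on_subset)

text \<open>Lets the closure properties below work with an explicit candidate \<open>f'\<close>; it
  agrees with \<open>dd f\<close> on the open set \<open>S\<close>, so class \<open>k\<close> passes
  from one to the other.\<close>

lemma Ck_on_SucI:
  assumes "open S" and der: "\<And>x. x \<in> S \<Longrightarrow> (f has_derivative (\<lambda>v. f' v x)) (at x)"
    and "\<And>v. Ck_on k (f' v) S"
  shows "Ck_on (Suc k) f S"
proof -
  have "Ck_on k (dd f v) S" for v
    using Ck_on_cong[OF assms(1), of "dd f v" "f' v"] dd_eq[OF der] assms(3) by simp
  then show ?thesis using der by (auto simp: differentiable_def)
qed

lemma Ck_on_const: "Ck_on k (\<lambda>_. c) S"
  by (induction k arbitrary: c) auto

lemma Ck_on_bounded_linear: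
  assumes L: "bounded_linear L"
  shows "Ck_on k L S"
proof (cases k)
  case (Suc m)
  have "dd L v = (\<lambda>_. L v)" for v
    using dd_eq[OF bounded_linear_imp_has_derivative[OF L]] by auto
  then show ?thesis
    using L Suc by (simp add: Ck_on_const bounded_linear_imp_differentiable)
qed (use L in \<open>simp add: linear_continuous_on\<close>)

lemma Ck_on_add: "Ck_on k f S \<Longrightarrow> Ck_on k g S \<Longrightarrow> open S \<Longrightarrow> Ck_on k (\<lambda>x. f x + g x) S"
proof (induction k arbitrary: f g)
  case (Suc k)
  then show ?case
    by (intro Ck_on_SucI[where f'="\<lambda>v x. dd f v x + dd g v x"] has_derivative_add has_derivative_dd)
      auto
qed (simp add: continuous_on_add)

text \<open>One induction by the product rule serves scalar multiplication, products of reals and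
  every other bounded bilinear operation. The derivative contains \<open>f\<close> and
  \<open>g\<close> undifferentiated, hence the appeals to \<open>Ck_on_lower\<close>.\<close>

lemma (in bounded_bilinear) Ck_on:
  fixes f :: "'e::euclidean_space \<Rightarrow> 'a" and g :: "'e \<Rightarrow> 'b"
  shows "Ck_on k f S \<Longrightarrow> Ck_on k g S \<Longrightarrow> open S \<Longrightarrow> Ck_on k (\<lambda>x. prod (f x) (g x)) S"
proof (induction k arbitrary: f g)
  case 0
  then show ?case by (simp add: continuous_on)
next
  case (Suc k)
  show ?case
  proof (rule Ck_on_SucI[where f'="\<lambda>v x. prod (f x) (dd g v x) + prod (dd f v x) (g x)"])
    show "((\<lambda>x. prod (f x) (g x)) has_derivative
        (\<lambda>v. prod (f x) (dd g v x) + prod (dd f v x) (g x))) (at x)" if "x \<in> S" for x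
      using Suc.prems that by (intro FDERIV has_derivative_dd) auto
    show "Ck_on k (\<lambda>x. prod (f x) (dd g v x) + prod (dd f v x) (g x)) S" for v
      using Suc.prems Ck_on_lower[OF Suc.prems(1)] Ck_on_lower[OF Suc.prems(2)]
      by (intro Ck_on_add Suc.IH) auto
  qed fact
qed

lemma Ck_on_linear_comp:
  assumes L: "bounded_linear L"
  shows "Ck_on k f S \<Longrightarrow> open S \<Longrightarrow> Ck_on k (\<lambda>x. L (f x)) S"
proof (induction k arbitrary: f)
  case 0
  then show ?case using L by (simp add: bounded_linear.continuous_on)
next
  case (Suc k)
  then show ?case
    by (intro Ck_on_SucI[where f'="\<lambda>v x. L (dd f v x)"] bounded_linear.has_derivative[OF L]
        has_derivative_dd) auto
qed

lemma Ck_on_sum: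
  assumes "\<And>i. i \<in> I \<Longrightarrow> Ck_on k (f i) S" "open S"
  shows "Ck_on k (\<lambda>x. \<Sum>i\<in>I. f i x) S"
  using assms by (induction I rule: infinite_finite_induct) (auto intro: Ck_on_const Ck_on_add)

lemma linear_expand:
  fixes L :: "'a::euclidean_space \<Rightarrow> 'b::real_vector"
  assumes "linear L"
  shows "L v = (\<Sum>i\<in>Basis. (v \<bullet> i) *\<^sub>R L i)"
proof -
  have "L v = L (\<Sum>i\<in>Basis. (v \<bullet> i) *\<^sub>R i)" by (simp add: euclidean_representation)
  then show ?thesis by (simp add: linear_sum[OF assms] linear_cmul[OF assms])
qed

text \<open>The chain rule differentiates \<open>g\<close> in a direction that moves with
  \<open>x\<close>, while \<open>Ck_on\<close> speaks of fixed directions. Expanding the direction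
  in \<open>Basis\<close> separates the two dependencies.\<close>

lemma Ck_on_compose:
  fixes f :: "'a::euclidean_space \<Rightarrow> 'b::euclidean_space" and g :: "'b \<Rightarrow> 'c::real_normed_vector"
  shows "Ck_on k g T \<Longrightarrow> Ck_on k f S \<Longrightarrow> open S \<Longrightarrow> f ` S \<subseteq> T \<Longrightarrow> Ck_on k (\<lambda>x. g (f x)) S"
proof (induction k arbitrary: g)
  case 0
  then show ?case by (auto intro: continuous_on_compose2)
next
  case (Suc k)
  show ?case
  proof (rule Ck_on_SucI[where f'="\<lambda>v x. \<Sum>i\<in>Basis. (dd f v x \<bullet> i) *\<^sub>R dd g i (f x)"])
    fix x assume "x \<in> S"
    then have diff: "f differentiable (at x)" "g differentiable (at (f x))"
      using Suc.prems by auto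
    have "((\<lambda>x. g (f x)) has_derivative (\<lambda>v. dd g (dd f v x) (f x))) (at x)"
      using has_derivative_compose[OF diff[THEN has_derivative_dd]] .
    then show "((\<lambda>x. g (f x)) has_derivative
        (\<lambda>v. \<Sum>i\<in>Basis. (dd f v x \<bullet> i) *\<^sub>R dd g i (f x))) (at x)"
      unfolding linear_expand[OF linear_dd[OF diff(2)], of "dd f _ x"] .
  next
    fix v
    show "Ck_on k (\<lambda>x. \<Sum>i\<in>Basis. (dd f v x \<bullet> i) *\<^sub>R dd g i (f x)) S"
    proof (intro Ck_on_sum bounded_bilinear.Ck_on[OF bounded_bilinear_scaleR])
      fix i :: 'b
      show "Ck_on k (\<lambda>x. dd f v x \<bullet> i) S"
        using Suc.prems by (intro Ck_on_linear_comp[OF bounded_linear_inner_left]) auto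
      show "Ck_on k (\<lambda>x. dd g i (f x)) S"
        using Suc.prems Ck_on_lower[OF Suc.prems(2)] by (intro Suc.IH) auto
    qed (use Suc.prems in auto)
  qed fact
qed

text \<open>The exponent varies in the induction because differentiation lowers it by one. The
  exponent \<open>-1/2\<close> will normalise vectors in the Gram-Schmidt process.\<close>

lemma Ck_on_powr:
  fixes f :: "'a::euclidean_space \<Rightarrow> real"
  shows "Ck_on k f S \<Longrightarrow> open S \<Longrightarrow> (\<And>x. x \<in> S \<Longrightarrow> f x > 0) \<Longrightarrow> Ck_on k (\<lambda>x. f x powr a) S"
proof (induction k arbitrary: a)
  case 0
  then show ?case by (fastforce intro!: continuous_intros)
next
  case (Suc k)
  show ?case
  proof (rule Ck_on_SucI[where f'="\<lambda>v x. (a * f x powr (a - 1)) *\<^sub>R dd f v x"])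
    fix x assume x: "x \<in> S"
    then have "((\<lambda>y. y powr a) has_real_derivative a * f x powr (a - 1)) (at (f x))"
      using Suc.prems by (intro has_real_derivative_powr) auto
    then have d: "((\<lambda>y. y powr a) has_derivative (*) (a * f x powr (a - 1))) (at (f x))"
      by (simp add: has_field_derivative_def)
    have "f differentiable (at x)" using Suc.prems x by auto
    from has_derivative_compose[OF has_derivative_dd[OF this] d]
    show "((\<lambda>x. f x powr a) has_derivative (\<lambda>v. (a * f x powr (a - 1)) *\<^sub>R dd f v x)) (at x)"
      by simp
  next
    fix v
    show "Ck_on k (\<lambda>x. (a * f x powr (a - 1)) *\<^sub>R dd f v x) S"
      using Suc.prems Ck_on_lower[OF Suc.prems(1)]
      by (intro bounded_bilinear.Ck_on[OF bounded_bilinear_scaleR]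
          bounded_bilinear.Ck_on[OF bounded_bilinear_mult] Ck_on_const Suc.IH) auto
  qed fact
qed

section \<open>Closure properties of smooth functions\<close>

lemma smooth_on_open: "smooth_on S f \<Longrightarrow> open S"
  by (simp add: smooth_on_def)

lemma smooth_on_differentiable: "smooth_on S f \<Longrightarrow> x \<in> S \<Longrightarrow> f differentiable (at x)"
  by (metis Ck_on.simps(2) smooth_on_def)

lemma smooth_on_continuous: "smooth_on S f \<Longrightarrow> continuous_on S f"
  by (metis Ck_on.simps(1) smooth_on_def)

lemma smooth_on_dd: "smooth_on S f \<Longrightarrow> smooth_on S (dd f v)"
  by (metis Ck_on.simps(2) smooth_on_def)

lemma smooth_on_cong: "smooth_on S f \<Longrightarrow> (\<And>x. x \<in> S \<Longrightarrow> f x = g x) \<Longrightarrow> smooth_on S g"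
  by (metis Ck_on_cong smooth_on_def)

lemma smooth_on_subset: "smooth_on S f \<Longrightarrow> open T \<Longrightarrow> T \<subseteq> S \<Longrightarrow> smooth_on T f"
  by (metis Ck_on_subset smooth_on_def)

lemma smooth_on_const: "open S \<Longrightarrow> smooth_on S (\<lambda>_. c)"
  by (simp add: smooth_on_def Ck_on_const)

lemma smooth_on_bounded_linear: "bounded_linear L \<Longrightarrow> open S \<Longrightarrow> smooth_on S L"
  by (simp add: smooth_on_def Ck_on_bounded_linear)

lemma smooth_on_add: "smooth_on S f \<Longrightarrow> smooth_on S g \<Longrightarrow> smooth_on S (\<lambda>x. f x + g x)"
  by (simp add: smooth_on_def Ck_on_add)

lemma smooth_on_sum:
  "open S \<Longrightarrow> (\<And>i. i \<in> I \<Longrightarrow> smooth_on S (f i)) \<Longrightarrow> smooth_on S (\<lambda>x. \<Sum>i\<in>I. f i x)"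
  by (simp add: smooth_on_def Ck_on_sum)

lemma smooth_on_linear_comp: "bounded_linear L \<Longrightarrow> smooth_on S f \<Longrightarrow> smooth_on S (\<lambda>x. L (f x))"
  by (simp add: smooth_on_def Ck_on_linear_comp)

lemma smooth_on_minus: "smooth_on S f \<Longrightarrow> smooth_on S (\<lambda>x. - f x)"
  by (rule smooth_on_linear_comp[OF bounded_linear_minus[OF bounded_linear_ident]])

lemma smooth_on_diff: "smooth_on S f \<Longrightarrow> smooth_on S g \<Longrightarrow> smooth_on S (\<lambda>x. f x - g x)"
  using smooth_on_add[OF _ smooth_on_minus] by fastforce

lemma (in bounded_bilinear) smooth_on:
  "smooth_on S f \<Longrightarrow> smooth_on S g \<Longrightarrow> smooth_on S (\<lambda>x. prod (f x) (g x))"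
  by (simp add: smooth_on_def Ck_on)

lemmas smooth_on_scaleR = bounded_bilinear.smooth_on[OF bounded_bilinear_scaleR]
lemmas smooth_on_mult = bounded_bilinear.smooth_on[OF bounded_bilinear_mult]
lemmas smooth_on_inner_left = smooth_on_linear_comp[OF bounded_linear_inner_left]

lemma smooth_on_compose:
  fixes f :: "'a::euclidean_space \<Rightarrow> 'b::euclidean_space"
  shows "smooth_on T g \<Longrightarrow> smooth_on S f \<Longrightarrow> f ` S \<subseteq> T \<Longrightarrow> smooth_on S (\<lambda>x. g (f x))"
  unfolding smooth_on_def by (blast intro: Ck_on_compose)

lemma smooth_on_powr:
  fixes f :: "'a::euclidean_space \<Rightarrow> real"
  shows "smooth_on S f \<Longrightarrow> (\<And>x. x \<in> S \<Longrightarrow> f x > 0) \<Longrightarrow> smooth_on S (\<lambda>x. f x powr a)"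
  by (simp add: smooth_on_def Ck_on_powr)

text \<open>A pair is the sum of the images of its components under the two linear
  embeddings.\<close>

lemma smooth_on_Pair:
  assumes "smooth_on S f" "smooth_on S g"
  shows "smooth_on S (\<lambda>x. (f x, g x))"
proof -
  have "smooth_on S (\<lambda>x. (f x, 0) + (0, g x))"
    using assms by (intro smooth_on_add smooth_on_linear_comp[where L="\<lambda>x. (x, 0)"]
        smooth_on_linear_comp[where L="\<lambda>x. (0, x)"] bounded_linear_Pair
        bounded_linear_ident bounded_linear_zero) auto
  then show ?thesis by simp
qed

lemma smooth_on_dd_field:
  fixes f :: "'a::euclidean_space \<Rightarrow> 'b::real_normed_vector"
  assumes "smooth_on S f" "smooth_on S V"
  shows "smooth_on S (\<lambda>x. dd f (V x) x)"
proof (rule smooth_on_cong)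
  show "smooth_on S (\<lambda>x. \<Sum>i\<in>Basis. (V x \<bullet> i) *\<^sub>R dd f i x)"
    using assms by (intro smooth_on_sum smooth_on_scaleR smooth_on_inner_left smooth_on_dd
        smooth_on_open) auto
  show "(\<Sum>i\<in>Basis. (V x \<bullet> i) *\<^sub>R dd f i x) = dd f (V x) x" if "x \<in> S" for x
    by (rule linear_expand[OF linear_dd[OF smooth_on_differentiable[OF assms(1) that]], symmetric])
qed

text \<open>Both mixed partial derivatives are limits of the same second difference quotient.\<close>

lemma second_difference_mvt:
  fixes f :: "'a::euclidean_space \<Rightarrow> real"
  assumes f: "smooth_on S f" and h: "h > 0"
    and S: "\<And>s t. 0 \<le> s \<Longrightarrow> s \<le> h \<Longrightarrow> 0 \<le> t \<Longrightarrow> t \<le> h \<Longrightarrow> a + s *\<^sub>R u + t *\<^sub>R v \<in> S"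
  shows "\<exists>s t. 0 < s \<and> s < h \<and> 0 < t \<and> t < h \<and>
    f (a + h *\<^sub>R u + h *\<^sub>R v) - f (a + h *\<^sub>R u) - f (a + h *\<^sub>R v) + f a
      = h * h * dd (dd f u) v (a + s *\<^sub>R u + t *\<^sub>R v)"
proof -
  \<comment> \<open>The increment of this function over the interval from 0 to \<open>h\<close> is
    the second difference. The term \<open>0 *\<^sub>R v\<close> gives both parts the shape that the
    second mean value theorem, in direction \<open>v\<close>, expects.\<close>
  let ?\<phi> = "\<lambda>s. f (a + s *\<^sub>R u + h *\<^sub>R v) - f (a + s *\<^sub>R u + 0 *\<^sub>R v)"
  have line: "((\<lambda>s. g (b + s *\<^sub>R w)) has_real_derivative dd g w (b + s *\<^sub>R w)) (at s)"
    if "g differentiable (at (b + s *\<^sub>R w))" for g :: "'a \<Rightarrow> real" and b w s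
  proof -
    have "((\<lambda>s. b + s *\<^sub>R w) has_derivative (\<lambda>r. r *\<^sub>R w)) (at s)"
      by (auto intro!: derivative_eq_intros)
    from has_derivative_compose[OF this has_derivative_dd[OF that]]
    have "((\<lambda>s. g (b + s *\<^sub>R w)) has_derivative (\<lambda>r. dd g (r *\<^sub>R w) (b + s *\<^sub>R w))) (at s)" .
    then show ?thesis
      unfolding has_field_derivative_def
      using linear_cmul[OF linear_dd[OF that]] by (simp add: mult.commute[of _ "dd g w (b + s *\<^sub>R w)"])
  qed
  have "\<exists>s>0. s < h \<and> ?\<phi> h - ?\<phi> 0 = (h - 0) *
      (dd f u (a + s *\<^sub>R u + h *\<^sub>R v) - dd f u (a + s *\<^sub>R u + 0 *\<^sub>R v))"
  proof (rule MVT2[OF h])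
    fix s assume s: "0 \<le> s" "s \<le> h"
    have d: "((\<lambda>s. f (a + s *\<^sub>R u + t *\<^sub>R v)) has_real_derivative dd f u (a + s *\<^sub>R u + t *\<^sub>R v)) (at s)"
      if "0 \<le> t" "t \<le> h" for t
      using line[of f "a + t *\<^sub>R v" s u] smooth_on_differentiable[OF f S[OF s that]]
      by (simp add: algebra_simps)
    from DERIV_diff[OF d[of h] d[of 0]] h
    show "(?\<phi> has_real_derivative dd f u (a + s *\<^sub>R u + h *\<^sub>R v)
        - dd f u (a + s *\<^sub>R u + 0 *\<^sub>R v)) (at s)" by simp
  qed
  then obtain s where s: "0 < s" "s < h" and
    e1: "?\<phi> h - ?\<phi> 0 = h * (dd f u (a + s *\<^sub>R u + h *\<^sub>R v) - dd f u (a + s *\<^sub>R u + 0 *\<^sub>R v))"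
    by auto
  have "\<exists>t>0. t < h \<and> dd f u (a + s *\<^sub>R u + h *\<^sub>R v) - dd f u (a + s *\<^sub>R u + 0 *\<^sub>R v)
      = (h - 0) * dd (dd f u) v (a + s *\<^sub>R u + t *\<^sub>R v)"
  proof (rule MVT2[OF h])
    fix t assume t: "0 \<le> t" "t \<le> h"
    show "((\<lambda>t. dd f u (a + s *\<^sub>R u + t *\<^sub>R v)) has_real_derivative
        dd (dd f u) v (a + s *\<^sub>R u + t *\<^sub>R v)) (at t)"
      using s t by (intro line smooth_on_differentiable[OF smooth_on_dd[OF f]] S) auto
  qed
  then obtain t where t: "0 < t" "t < h" and
    e2: "dd f u (a + s *\<^sub>R u + h *\<^sub>R v) - dd f u (a + s *\<^sub>R u + 0 *\<^sub>R v)
      = h * dd (dd f u) v (a + s *\<^sub>R u + t *\<^sub>R v)"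
    by auto
  show ?thesis using s t e1 e2 by (intro exI[of _ s] exI[of _ t]) (simp add: algebra_simps)
qed

lemma dd_commute_real:
  fixes f :: "'a::euclidean_space \<Rightarrow> real"
  assumes f: "smooth_on S f" and a: "a \<in> S"
  shows "dd (dd f u) v a = dd (dd f v) u a"
proof (rule ccontr)
  assume ne: "dd (dd f u) v a \<noteq> dd (dd f v) u a"
  \<comment> \<open>Half the gap: two numbers closer than \<open>\<epsilon>\<close> to the two
    derivatives cannot coincide.\<close>
  define \<epsilon> where "\<epsilon> = \<bar>dd (dd f u) v a - dd (dd f v) u a\<bar> / 2"
  have \<epsilon>: "\<epsilon> > 0" using ne by (simp add: \<epsilon>_def)
  have cont: "\<exists>\<delta>>0. \<forall>y. dist y a < \<delta> \<longrightarrow> dist (dd (dd f u) v y) (dd (dd f u) v a) < \<epsilon>" for u v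
    using differentiable_imp_continuous_within[OF
        smooth_on_differentiable[OF smooth_on_dd[OF smooth_on_dd[OF f]] a]] \<epsilon>
    by (simp add: continuous_at_eps_delta)
  obtain d1 where d1: "d1 > 0" "\<And>y. dist y a < d1 \<Longrightarrow> dist (dd (dd f u) v y) (dd (dd f u) v a) < \<epsilon>"
    using cont by metis
  obtain d2 where d2: "d2 > 0" "\<And>y. dist y a < d2 \<Longrightarrow> dist (dd (dd f v) u y) (dd (dd f v) u a) < \<epsilon>"
    using cont by metis
  obtain d3 where d3: "d3 > 0" "ball a d3 \<subseteq> S"
    using smooth_on_open[OF f] a open_contains_ball by blast
  define d where "d = min d1 (min d2 d3)"
  \<comment> \<open>The summand 1 keeps \<open>N\<close> positive when \<open>u\<close> and
    \<open>v\<close> vanish; the factor 2 in \<open>h\<close> turns the estimate of the distance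
    from \<open>a\<close> into a strict one.\<close>
  define N where "N = norm u + norm v + 1"
  define h where "h = d / (2 * N)"
  have d: "d > 0" using d1 d2 d3 by (simp add: d_def)
  have N: "N > 0" unfolding N_def by (smt (verit) norm_ge_zero)
  then have h: "h > 0" using d by (simp add: h_def)
  have close: "dist (a + s *\<^sub>R u + t *\<^sub>R v) a < d" if "0 \<le> s" "s \<le> h" "0 \<le> t" "t \<le> h" for s t
  proof -
    have "dist (a + s *\<^sub>R u + t *\<^sub>R v) a = norm (s *\<^sub>R u + t *\<^sub>R v)"
      by (simp add: dist_norm algebra_simps)
    also have "\<dots> \<le> s * norm u + t * norm v"
      using norm_triangle_ineq[of "s *\<^sub>R u" "t *\<^sub>R v"] that by simp
    also have "\<dots> \<le> h * norm u + h * norm v"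
      using that by (intro add_mono mult_right_mono) auto
    also have "\<dots> \<le> h * N" using h by (simp add: N_def algebra_simps)
    also have "\<dots> = d / 2" using N by (simp add: h_def)
    also have "\<dots> < d" using d by simp
    finally show ?thesis .
  qed
  have S: "a + s *\<^sub>R u + t *\<^sub>R v \<in> S" if "0 \<le> s" "s \<le> h" "0 \<le> t" "t \<le> h" for s t
    using close[OF that] d3 by (auto simp: d_def dist_commute)
  obtain s t where st: "0 < s" "s < h" "0 < t" "t < h" and
    e: "f (a + h *\<^sub>R u + h *\<^sub>R v) - f (a + h *\<^sub>R u) - f (a + h *\<^sub>R v) + f a
      = h * h * dd (dd f u) v (a + s *\<^sub>R u + t *\<^sub>R v)"
    using second_difference_mvt[OF f h, of a u v] S by blast
  have S': "a + s *\<^sub>R v + t *\<^sub>R u \<in> S" if "0 \<le> s" "s \<le> h" "0 \<le> t" "t \<le> h" for s t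
    using S[of t s] that by (simp add: algebra_simps)
  obtain s' t' where st': "0 < s'" "s' < h" "0 < t'" "t' < h" and
    e': "f (a + h *\<^sub>R v + h *\<^sub>R u) - f (a + h *\<^sub>R v) - f (a + h *\<^sub>R u) + f a
      = h * h * dd (dd f v) u (a + s' *\<^sub>R v + t' *\<^sub>R u)"
    using second_difference_mvt[OF f h, of a v u] S' by blast
  \<comment> \<open>Both second differences are the same number, so the two mixed derivatives agree
    at two points near \<open>a\<close>.\<close>
  have "h * h * dd (dd f u) v (a + s *\<^sub>R u + t *\<^sub>R v) = h * h * dd (dd f v) u (a + t' *\<^sub>R u + s' *\<^sub>R v)"
    using e e' by (simp add: algebra_simps)
  then have eq: "dd (dd f u) v (a + s *\<^sub>R u + t *\<^sub>R v) = dd (dd f v) u (a + t' *\<^sub>R u + s' *\<^sub>R v)"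
    using h by simp
  have "dist (dd (dd f u) v (a + s *\<^sub>R u + t *\<^sub>R v)) (dd (dd f u) v a) < \<epsilon>"
    using close[of s t] st by (intro d1) (auto simp: d_def)
  moreover have "dist (dd (dd f v) u (a + t' *\<^sub>R u + s' *\<^sub>R v)) (dd (dd f v) u a) < \<epsilon>"
    using close[of t' s'] st' by (intro d2) (auto simp: d_def)
  ultimately show False using eq \<epsilon> unfolding \<epsilon>_def dist_real_def by (smt (verit) field_sum_of_halves)
qed

lemma dd_linear_comp:
  assumes "bounded_linear L" "f differentiable (at x)"
  shows "dd (\<lambda>x. L (f x)) v x = L (dd f v x)"
  using bounded_linear.has_derivative[OF assms(1) has_derivative_dd[OF assms(2)]] by (rule dd_eq)

lemma dd_commute:
  fixes f :: "'a::euclidean_space \<Rightarrow> 'b::euclidean_space"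
  assumes f: "smooth_on S f" and a: "a \<in> S"
  shows "dd (dd f u) v a = dd (dd f v) u a"
proof (rule euclidean_eqI)
  fix i :: 'b
  note inner_i = bounded_linear_inner_left[of i]
  have "dd (dd f u) v a \<bullet> i = dd (dd (\<lambda>x. f x \<bullet> i) u) v a" for u v
  proof -
    have "dd (dd (\<lambda>x. f x \<bullet> i) u) v a = dd (\<lambda>x. dd f u x \<bullet> i) v a"
      using smooth_on_open[OF f] a
    proof (rule dd_cong_open)
      show "dd (\<lambda>x. f x \<bullet> i) u x = dd f u x \<bullet> i" if "x \<in> S" for x
        using dd_linear_comp[OF inner_i smooth_on_differentiable[OF f that]] .
    qed
    then show ?thesis
      using dd_linear_comp[OF inner_i smooth_on_differentiable[OF smooth_on_dd[OF f] a]] by simp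
  qed
  then show "dd (dd f u) v a \<bullet> i = dd (dd f v) u a \<bullet> i"
    using dd_commute_real[OF smooth_on_inner_left[OF f] a] by simp
qed

lemma dd_add:
  assumes "f differentiable (at x)" "g differentiable (at x)"
  shows "dd (\<lambda>x. f x + g x) v x = dd f v x + dd g v x"
  using has_derivative_add[OF assms[THEN has_derivative_dd]] by (rule dd_eq)

section \<open>Orthonormal bases of a scalar product\<close>

text \<open>The metric at a point is a form on the model space, unrelated to the built-in
  \<open>inner\<close>. The locale develops orthonormality for such a form, at points of manifolds
  as well as in charts.\<close>

locale scalar_product =
  fixes B :: "'e::euclidean_space \<Rightarrow> 'e \<Rightarrow> real"
  assumes bilinear: "bilinear B" and sym: "B u v = B v u" and pos: "u \<noteq> 0 \<Longrightarrow> B u u > 0"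
begin

lemmas bilin_simps = bilinear_ladd[OF bilinear] bilinear_radd[OF bilinear]
  bilinear_lmul[OF bilinear] bilinear_rmul[OF bilinear] bilinear_lzero[OF bilinear]
  bilinear_rzero[OF bilinear] bilinear_lsub[OF bilinear] bilinear_rsub[OF bilinear]
  bilinear_lneg[OF bilinear] bilinear_rneg[OF bilinear]

lemma sum_left: "B (\<Sum>i\<in>I. f i) v = (\<Sum>i\<in>I. B (f i) v)"
  using bilinear by (simp add: bilinear_def linear_sum[of "\<lambda>u. B u v"])

lemma sum_right: "B u (\<Sum>i\<in>I. f i) = (\<Sum>i\<in>I. B u (f i))"
  using bilinear by (simp add: bilinear_def linear_sum)

lemma nonneg: "B u u \<ge> 0"
  using pos[of u] by (cases "u = 0") (auto simp: bilin_simps)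

lemma eqI: "(\<And>w. B u w = B v w) \<Longrightarrow> u = v"
  using pos[of "u - v"] by (force simp: bilin_simps)

definition orthonormal :: "nat \<Rightarrow> (nat \<Rightarrow> 'e) \<Rightarrow> bool" where
  "orthonormal k e \<longleftrightarrow> (\<forall>i<k. \<forall>j<k. B (e i) (e j) = (if i = j then 1 else 0))"

lemma orthonormal_coeff:
  assumes "orthonormal k e" "j < k"
  shows "B (\<Sum>i<k. c i *\<^sub>R e i) (e j) = c j"
proof -
  have "B (\<Sum>i<k. c i *\<^sub>R e i) (e j) = (\<Sum>i<k. if i = j then c i else 0)"
    unfolding sum_left using assms
    by (intro sum.cong refl) (auto simp: bilin_simps orthonormal_def)
  then show ?thesis using assms by simp
qed

lemma orthonormal_inj: "orthonormal k e \<Longrightarrow> inj_on e {..<k}"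
  unfolding orthonormal_def by (intro inj_onI) (metis lessThan_iff zero_neq_one)

lemma orthonormal_independent:
  assumes e: "orthonormal k e"
  shows "independent (e ` {..<k})"
proof (rule real_vector.independent_if_scalars_zero)
  fix c x assume "(\<Sum>x\<in>e ` {..<k}. c x *\<^sub>R x) = 0" and x: "x \<in> e ` {..<k}"
  then have "(\<Sum>i<k. c (e i) *\<^sub>R e i) = 0"
    by (simp add: sum.reindex[OF orthonormal_inj[OF e]])
  with x show "c x = 0"
    using orthonormal_coeff[OF e, of _ "\<lambda>i. c (e i)"] by (auto simp: bilin_simps)
qed simp

lemma orthonormal_expand:
  assumes e: "orthonormal DIM('e) e"
  shows "w = (\<Sum>k<DIM('e). B w (e k) *\<^sub>R e k)"
proof -
  have "UNIV \<subseteq> span (e ` {..<DIM('e)})"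
    using orthonormal_inj[OF e]
    by (intro card_ge_dim_independent orthonormal_independent e) (auto simp: card_image)
  then have "w \<in> span (e ` {..<DIM('e)})" by auto
  then obtain c where "w = (\<Sum>x\<in>e ` {..<DIM('e)}. c x *\<^sub>R x)"
    by (auto simp: span_finite)
  then have w: "w = (\<Sum>i<DIM('e). c (e i) *\<^sub>R e i)"
    by (simp add: sum.reindex[OF orthonormal_inj[OF e]])
  have "B w (e j) = c (e j)" if "j < DIM('e)" for j
    unfolding w using orthonormal_coeff[OF e that, of "\<lambda>i. c (e i)"] .
  then show ?thesis by (subst w) simp
qed

lemma parseval:
  assumes e: "orthonormal DIM('e) e"
  shows "B u v = (\<Sum>k<DIM('e). B u (e k) * B v (e k))"
proof -
  have "B u v = B (\<Sum>k<DIM('e). B u (e k) *\<^sub>R e k) v"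
    by (simp only: orthonormal_expand[OF e, symmetric])
  also have "\<dots> = (\<Sum>k<DIM('e). B u (e k) * B v (e k))"
    by (simp add: sum_left bilin_simps sym[of v])
  finally show ?thesis .
qed

text \<open>Expanding each \<open>e' k\<close> in the basis \<open>e\<close> produces products of
  coefficients whose sum over \<open>k\<close> is the Kronecker delta, by Parseval for
  \<open>e'\<close>. The values of \<open>\<beta>\<close> may lie in any real vector space because
  the mean curvature is a vector-valued trace.\<close>

lemma trace_frame_independent:
  fixes \<beta> :: "'e \<Rightarrow> 'e \<Rightarrow> 'b::real_vector"
  assumes e: "orthonormal DIM('e) e" and e': "orthonormal DIM('e) e'"
    and \<beta>: "bilinear \<beta>"
  shows "(\<Sum>k<DIM('e). \<beta> (e k) (e k)) = (\<Sum>k<DIM('e). \<beta> (e' k) (e' k))"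
proof -
  let ?n = "DIM('e)"
  have lin: "linear (\<lambda>u. \<beta> u v)" "linear (\<beta> v)" for v
    using \<beta> by (auto simp: bilinear_def)
  have "\<beta> u u = (\<Sum>i<?n. \<Sum>j<?n. (B u (e i) * B u (e j)) *\<^sub>R \<beta> (e i) (e j))" for u
  proof -
    have "\<beta> u u = \<beta> (\<Sum>i<?n. B u (e i) *\<^sub>R e i) (\<Sum>j<?n. B u (e j) *\<^sub>R e j)"
      by (simp only: orthonormal_expand[OF e, symmetric])
    also have "\<dots> = (\<Sum>i<?n. \<Sum>j<?n. (B u (e i) * B u (e j)) *\<^sub>R \<beta> (e i) (e j))"
      by (simp only: linear_sum[OF lin(1)] linear_cmul[OF lin(1)])
        (simp add: linear_sum[OF lin(2)] linear_cmul[OF lin(2)] scaleR_sum_right)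
    finally show ?thesis .
  qed
  then have "(\<Sum>k<?n. \<beta> (e' k) (e' k))
      = (\<Sum>k<?n. \<Sum>i<?n. \<Sum>j<?n. (B (e' k) (e i) * B (e' k) (e j)) *\<^sub>R \<beta> (e i) (e j))"
    by simp
  also have "\<dots> = (\<Sum>i<?n. \<Sum>j<?n. \<Sum>k<?n. (B (e' k) (e i) * B (e' k) (e j)) *\<^sub>R \<beta> (e i) (e j))"
    by (rule trans[OF sum.swap], rule sum.cong[OF refl], rule sum.swap)
  also have "\<dots> = (\<Sum>i<?n. \<Sum>j<?n. B (e i) (e j) *\<^sub>R \<beta> (e i) (e j))"
    by (simp add: parseval[OF e', of "e _" "e _"] sym[of _ "e' _"] scaleR_sum_left)
  also have "\<dots> = (\<Sum>i<?n. \<Sum>j<?n. if j = i then \<beta> (e i) (e j) else 0)"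
    using e by (intro sum.cong refl) (auto simp: orthonormal_def)
  also have "\<dots> = (\<Sum>i<?n. \<beta> (e i) (e i))"
    by (intro sum.cong refl) (simp add: sum.delta)
  finally show ?thesis ..
qed

end


section \<open>Fields of bilinear maps\<close>

lemma bilinear_expand:
  fixes T :: "'a::euclidean_space \<Rightarrow> 'b::euclidean_space \<Rightarrow> 'c::real_vector"
  assumes "bilinear T"
  shows "T u v = (\<Sum>i\<in>Basis. \<Sum>j\<in>Basis. ((u \<bullet> i) * (v \<bullet> j)) *\<^sub>R T i j)"
proof -
  have lin: "linear (\<lambda>u. T u v)" "linear (T u)" for u v
    using assms by (auto simp: bilinear_def)
  have "T u v = (\<Sum>i\<in>Basis. (u \<bullet> i) *\<^sub>R T i v)"
    using linear_expand[OF lin(1)] .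
  also have "\<dots> = (\<Sum>i\<in>Basis. (u \<bullet> i) *\<^sub>R (\<Sum>j\<in>Basis. (v \<bullet> j) *\<^sub>R T i j))"
    using linear_expand[OF lin(2)] by (intro sum.cong refl arg_cong2[where f=scaleR])
  finally show ?thesis by (simp add: scaleR_sum_right)
qed

text \<open>Smoothness of \<open>T\<close> is given for constant arguments; the expansion over
  \<open>Basis\<close> lets the base point and both arguments move. It serves metrics and
  Christoffel symbols alike.\<close>

lemma smooth_on_bilinear_field:
  fixes T :: "'a::euclidean_space \<Rightarrow> 'b::euclidean_space \<Rightarrow> 'c::euclidean_space \<Rightarrow> 'd::real_normed_vector"
    and \<Phi> :: "'e::euclidean_space \<Rightarrow> 'a"
  assumes T: "\<And>y. y \<in> S \<Longrightarrow> bilinear (T y)" "\<And>u v. smooth_on S (\<lambda>y. T y u v)"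
    and \<Phi>: "smooth_on W \<Phi>" "\<Phi> ` W \<subseteq> S" and V: "smooth_on W V" and Z: "smooth_on W Z"
  shows "smooth_on W (\<lambda>x. T (\<Phi> x) (V x) (Z x))"
proof (rule smooth_on_cong)
  show "smooth_on W (\<lambda>x. \<Sum>i\<in>Basis. \<Sum>j\<in>Basis. ((V x \<bullet> i) * (Z x \<bullet> j)) *\<^sub>R T (\<Phi> x) i j)"
    using smooth_on_open[OF \<Phi>(1)]
    by (intro smooth_on_sum smooth_on_scaleR smooth_on_mult smooth_on_inner_left V Z
        smooth_on_compose[OF T(2) \<Phi>])
  show "(\<Sum>i\<in>Basis. \<Sum>j\<in>Basis. ((V x \<bullet> i) * (Z x \<bullet> j)) *\<^sub>R T (\<Phi> x) i j) = T (\<Phi> x) (V x) (Z x)"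
    if "x \<in> W" for x
    using \<Phi>(2) that by (intro bilinear_expand[OF T(1), symmetric]) auto
qed

text \<open>The product rule with three moving ingredients: the base point and the two arguments.
  Metric compatibility and the formula for curvature along a map rest on it.\<close>

lemma dd_bilinear_field:
  fixes T :: "'a::euclidean_space \<Rightarrow> 'b::euclidean_space \<Rightarrow> 'c::euclidean_space \<Rightarrow> 'd::real_normed_vector"
    and \<Phi> :: "'e::euclidean_space \<Rightarrow> 'a"
  assumes T: "\<And>y. y \<in> S \<Longrightarrow> bilinear (T y)" "\<And>u v. smooth_on S (\<lambda>y. T y u v)"
    and \<Phi>: "smooth_on W \<Phi>" "\<Phi> ` W \<subseteq> S" and V: "smooth_on W V" and Z: "smooth_on W Z"
    and x: "x \<in> W"
  shows "dd (\<lambda>x. T (\<Phi> x) (V x) (Z x)) u x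
    = dd (\<lambda>y. T y (V x) (Z x)) (dd \<Phi> u x) (\<Phi> x) + T (\<Phi> x) (dd V u x) (Z x) + T (\<Phi> x) (V x) (dd Z u x)"
proof -
  note open_W = smooth_on_open[OF \<Phi>(1)]
  have px: "\<Phi> x \<in> S" using \<Phi>(2) x by auto
  have open_S: "open S" using smooth_on_open[OF T(2)] .
  have dT: "((\<lambda>y. T y i j) has_derivative (\<lambda>v. dd (\<lambda>y. T y i j) v (\<Phi> x))) (at (\<Phi> x))" for i j
    using has_derivative_dd[OF smooth_on_differentiable[OF T(2) px]] .
  note d\<Phi> = has_derivative_dd[OF smooth_on_differentiable[OF \<Phi>(1) x]]
  note dV = has_derivative_inner_left[OF has_derivative_dd[OF smooth_on_differentiable[OF V x]]]
  note dZ = has_derivative_inner_left[OF has_derivative_dd[OF smooth_on_differentiable[OF Z x]]]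
  have "dd (\<lambda>x. T (\<Phi> x) (V x) (Z x)) u x
      = dd (\<lambda>x. \<Sum>i\<in>Basis. \<Sum>j\<in>Basis. ((V x \<bullet> i) * (Z x \<bullet> j)) *\<^sub>R T (\<Phi> x) i j) u x"
    using open_W x
  proof (rule dd_cong_open)
    show "T (\<Phi> y) (V y) (Z y) = (\<Sum>i\<in>Basis. \<Sum>j\<in>Basis. ((V y \<bullet> i) * (Z y \<bullet> j)) *\<^sub>R T (\<Phi> y) i j)"
      if "y \<in> W" for y
      using \<Phi>(2) that by (intro bilinear_expand[OF T(1)]) auto
  qed
  also have "\<dots> = (\<Sum>i\<in>Basis. \<Sum>j\<in>Basis. ((V x \<bullet> i) * (Z x \<bullet> j)) *\<^sub>R dd (\<lambda>y. T y i j) (dd \<Phi> u x) (\<Phi> x)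
      + ((V x \<bullet> i) * (dd Z u x \<bullet> j) + (dd V u x \<bullet> i) * (Z x \<bullet> j)) *\<^sub>R T (\<Phi> x) i j)"
    by (rule dd_eq) (intro has_derivative_sum has_derivative_scaleR has_derivative_mult dV dZ
        has_derivative_compose[OF d\<Phi> dT])
  also have "\<dots> = (\<Sum>i\<in>Basis. \<Sum>j\<in>Basis. ((V x \<bullet> i) * (Z x \<bullet> j)) *\<^sub>R dd (\<lambda>y. T y i j) (dd \<Phi> u x) (\<Phi> x))
      + (\<Sum>i\<in>Basis. \<Sum>j\<in>Basis. ((dd V u x \<bullet> i) * (Z x \<bullet> j)) *\<^sub>R T (\<Phi> x) i j)
      + (\<Sum>i\<in>Basis. \<Sum>j\<in>Basis. ((V x \<bullet> i) * (dd Z u x \<bullet> j)) *\<^sub>R T (\<Phi> x) i j)"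
    by (simp add: sum.distrib scaleR_add_left)
  \<comment> \<open>With the components of \<open>V x\<close> and \<open>Z x\<close> frozen, this
    sum is again the derivative of a single function of the base point.\<close>
  also have "(\<Sum>i\<in>Basis. \<Sum>j\<in>Basis. ((V x \<bullet> i) * (Z x \<bullet> j)) *\<^sub>R dd (\<lambda>y. T y i j) (dd \<Phi> u x) (\<Phi> x))
      = dd (\<lambda>y. \<Sum>i\<in>Basis. \<Sum>j\<in>Basis. ((V x \<bullet> i) * (Z x \<bullet> j)) *\<^sub>R T y i j) (dd \<Phi> u x) (\<Phi> x)"
    by (rule dd_eq[symmetric]) (intro has_derivative_sum has_derivative_scaleR_right dT)
  also have "\<dots> = dd (\<lambda>y. T y (V x) (Z x)) (dd \<Phi> u x) (\<Phi> x)"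
    by (rule dd_cong_open[OF open_S px]) (rule bilinear_expand[OF T(1), symmetric])
  finally show ?thesis
    unfolding bilinear_expand[OF T(1)[OF px], of "dd V u x"]
      bilinear_expand[OF T(1)[OF px], of _ "dd Z u x"] .
qed

text \<open>Smooth orthonormal frames, and formulas in terms of them, are available only near each
  point.\<close>

lemma smooth_on_local:
  assumes "open S" "\<And>x. x \<in> S \<Longrightarrow> \<exists>U. x \<in> U \<and> smooth_on U f"
  shows "smooth_on S f"
proof -
  have "Ck_on k f S" if "\<And>x. x \<in> S \<Longrightarrow> \<exists>U. x \<in> U \<and> open U \<and> Ck_on k f U" for k f
    using that
  proof (induction k arbitrary: f)
    case 0
    have "isCont f x" if "x \<in> S" for x
      using 0[OF that] continuous_on_eq_continuous_at by auto
    then show ?case using \<open>open S\<close> continuous_on_eq_continuous_at by auto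
  next
    case (Suc k)
    have "f differentiable (at x)" if "x \<in> S" for x
      using Suc.prems[OF that] by auto
    moreover have "Ck_on k (dd f v) S" for v
      by (rule Suc.IH) (use Suc.prems in fastforce)
    ultimately show ?case by simp
  qed
  then show ?thesis using assms unfolding smooth_on_def by meson
qed

section \<open>Metrics on open subsets of Euclidean spaces\<close>

definition koszul :: "('e::euclidean_space \<Rightarrow> 'e \<Rightarrow> 'e \<Rightarrow> real) \<Rightarrow> 'e \<Rightarrow> 'e \<Rightarrow> 'e \<Rightarrow> 'e \<Rightarrow> real" where
  "koszul G y u v w = dd (\<lambda>x. G x v w) u y + dd (\<lambda>x. G x u w) v y - dd (\<lambda>x. G x u v) w y"

locale local_metric =
  fixes S :: "'e::euclidean_space set" and G :: "'e \<Rightarrow> 'e \<Rightarrow> 'e \<Rightarrow> real"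
  assumes open_S: "open S"
    and bilinear: "y \<in> S \<Longrightarrow> bilinear (G y)"
    and sym: "y \<in> S \<Longrightarrow> G y u v = G y v u"
    and pos: "y \<in> S \<Longrightarrow> u \<noteq> 0 \<Longrightarrow> G y u u > 0"
    and smooth: "smooth_on S (\<lambda>y. G y u v)"
begin

lemma scalar_product: "y \<in> S \<Longrightarrow> scalar_product (G y)"
  by (simp add: scalar_product_def bilinear sym pos)

lemma smooth_field:
  "smooth_on W \<Phi> \<Longrightarrow> \<Phi> ` W \<subseteq> S \<Longrightarrow> smooth_on W V \<Longrightarrow> smooth_on W Z \<Longrightarrow>
    smooth_on W (\<lambda>x. G (\<Phi> x) (V x) (Z x))"
  by (rule smooth_on_bilinear_field[OF bilinear smooth])

text \<open>Gram-Schmidt: subtract from a constant field outside the span of the first \<open>k\<close> fields at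
  \<open>y\<close> its projection, and shrink the neighbourhood to where the difference does not vanish.\<close>

lemma partial_frame:
  assumes y: "y \<in> S" and k: "k \<le> DIM('e)"
  shows "\<exists>U X. y \<in> U \<and> U \<subseteq> S \<and> open U \<and> (\<forall>i<k. smooth_on U (X i)) \<and>
    (\<forall>p\<in>U. scalar_product.orthonormal (G p) k (\<lambda>i. X i p))"
  using k
proof (induction k)
  case 0
  then show ?case
    using y open_S by (auto simp: scalar_product.orthonormal_def[OF scalar_product])
next
  case (Suc k)
  then obtain U X where U: "y \<in> U" "U \<subseteq> S" "open U" and X: "\<And>i. i < k \<Longrightarrow> smooth_on U (X i)"
    and orth: "\<And>p. p \<in> U \<Longrightarrow> scalar_product.orthonormal (G p) k (\<lambda>i. X i p)"
    by force
  \<comment> \<open>Fewer than \<open>DIM('e)\<close> vectors cannot span, which supplies the vector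
    \<open>b\<close> to continue with.\<close>
  have "dim (span ((\<lambda>i. X i y) ` {..<k})) < DIM('e)"
  proof -
    have "dim (span ((\<lambda>i. X i y) ` {..<k})) \<le> card ((\<lambda>i. X i y) ` {..<k})"
      by (simp add: dim_le_card')
    also have "\<dots> \<le> k" using card_image_le[of "{..<k}"] by auto
    finally show ?thesis using Suc.prems by simp
  qed
  then have "span ((\<lambda>i. X i y) ` {..<k}) \<noteq> UNIV"
    by (metis dim_UNIV less_irrefl)
  then obtain b where b: "b \<notin> span ((\<lambda>i. X i y) ` {..<k})" by auto
  define Y where "Y p = b - (\<Sum>i<k. G p b (X i p) *\<^sub>R X i p)" for p
  have ident: "smooth_on U (\<lambda>p. p)" "(\<lambda>p. p) ` U \<subseteq> S"
    using U by (auto intro: smooth_on_bounded_linear bounded_linear_ident)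
  have Y: "smooth_on U Y"
    unfolding Y_def[abs_def]
    using smooth_field[OF ident smooth_on_const[OF U(3)] X]
    by (intro smooth_on_diff smooth_on_const smooth_on_sum smooth_on_scaleR X U(3)) auto
  define N where "N p = G p (Y p) (Y p)" for p
  have N: "smooth_on U N"
    unfolding N_def[abs_def] by (rule smooth_field[OF ident Y Y])
  define U' where "U' = U \<inter> Y -` (- {0})"
  have U': "open U'"
    unfolding U'_def using smooth_on_continuous[OF Y] U(3)
    by (intro continuous_open_preimage) auto
  have "(\<Sum>i<k. G y b (X i y) *\<^sub>R X i y) \<in> span ((\<lambda>i. X i y) ` {..<k})"
    by (intro span_sum span_scale span_base) auto
  then have "Y y \<noteq> 0" using b by (auto simp: Y_def)
  then have yU': "y \<in> U'" using U by (simp add: U'_def)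
  have Npos: "N p > 0" if "p \<in> U'" for p
    using that pos U(2) by (auto simp: N_def U'_def)
  \<comment> \<open>The power \<open>-1/2\<close> is the reciprocal of the length of
    \<open>Y p\<close>; it is smooth because \<open>N\<close> is positive on
    \<open>U'\<close>.\<close>
  define X' where "X' = (\<lambda>i. if i < k then X i else (\<lambda>p. (N p powr (-1/2)) *\<^sub>R Y p))"
  have "smooth_on U' (X' i)" for i
  proof (cases "i < k")
    case True
    then show ?thesis using smooth_on_subset[OF X U'] by (auto simp: X'_def U'_def)
  next
    case False
    have sub: "U' \<subseteq> U" by (auto simp: U'_def)
    show ?thesis using False Npos
      by (auto simp: X'_def intro!: smooth_on_scaleR smooth_on_powr smooth_on_subset[OF N U' sub]
          smooth_on_subset[OF Y U' sub])
  qed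
  moreover have "scalar_product.orthonormal (G p) (Suc k) (\<lambda>i. X' i p)" if p: "p \<in> U'" for p
  proof -
    have pU: "p \<in> U" and pS: "p \<in> S" using p U by (auto simp: U'_def)
    interpret scalar_product "G p" using scalar_product[OF pS] .
    have o: "G p (X i p) (X j p) = (if i = j then 1 else 0)" if "i < k" "j < k" for i j
      using orth[OF pU] that by (simp add: orthonormal_def)
    have YX: "G p (Y p) (X j p) = 0" if "j < k" for j
      using orthonormal_coeff[OF orth[OF pU] that] by (simp add: Y_def bilin_simps)
    have NN: "N p powr (-1/2) * (N p powr (-1/2) * N p) = 1"
    proof -
      have "N p powr (-1/2) * (N p powr (-1/2) * N p)
          = N p powr (-1/2) * (N p powr (-1/2) * N p powr 1)"
        using Npos[OF p] by simp
      then show ?thesis using Npos[OF p] by (simp only: powr_add[symmetric]) simp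
    qed
    show ?thesis
      unfolding orthonormal_def
    proof (intro allI impI)
      fix i j assume ij: "i < Suc k" "j < Suc k"
      consider "i < k" "j < k" | "i < k" "j = k" | "i = k" "j < k" | "i = k" "j = k"
        using ij by linarith
      then show "G p (X' i p) (X' j p) = (if i = j then 1 else 0)"
      proof cases
        case 1 then show ?thesis by (simp add: X'_def o)
      next
        case 2 then show ?thesis by (simp add: X'_def bilin_simps YX sym[of "X i p"])
      next
        case 3 then show ?thesis by (simp add: X'_def bilin_simps YX)
      next
        case 4 then show ?thesis using NN by (simp add: X'_def bilin_simps flip: N_def)
      qed
    qed
  qed
  moreover have "U' \<subseteq> S" using U(2) by (auto simp: U'_def)
  ultimately show ?case
    using yU' U' by (intro exI[of _ U'] exI[of _ X'] conjI allI impI ballI) simp_all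
qed

lemma frame:
  assumes "y \<in> S"
  obtains U X where "y \<in> U" "U \<subseteq> S" "open U" "\<And>i. i < DIM('e) \<Longrightarrow> smooth_on U (X i)"
    "\<And>p. p \<in> U \<Longrightarrow> scalar_product.orthonormal (G p) DIM('e) (\<lambda>i. X i p)"
  using partial_frame[OF assms order.refl] by blast

section \<open>The Koszul formula and Christoffel symbols\<close>

lemma differentiable: "y \<in> S \<Longrightarrow> (\<lambda>x. G x u v) differentiable (at y)"
  using smooth_on_differentiable[OF smooth] .

lemma dd_metric:
  assumes "y \<in> S"
  shows "dd (\<lambda>x. G x (u + u') v) w y = dd (\<lambda>x. G x u v) w y + dd (\<lambda>x. G x u' v) w y"
    and "dd (\<lambda>x. G x u (v + v')) w y = dd (\<lambda>x. G x u v) w y + dd (\<lambda>x. G x u v') w y"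
    and "dd (\<lambda>x. G x (c *\<^sub>R u) v) w y = c * dd (\<lambda>x. G x u v) w y"
    and "dd (\<lambda>x. G x u (c *\<^sub>R v)) w y = c * dd (\<lambda>x. G x u v) w y"
    and "dd (\<lambda>x. G x u v) w y = dd (\<lambda>x. G x v u) w y"
proof -
  note cong = dd_cong_open[OF open_S assms]
  note d = differentiable[OF assms]
  show "dd (\<lambda>x. G x (u + u') v) w y = dd (\<lambda>x. G x u v) w y + dd (\<lambda>x. G x u' v) w y"
    by (subst dd_add[OF d d, symmetric]) (rule cong, simp add: bilinear_ladd[OF bilinear])
  show "dd (\<lambda>x. G x u (v + v')) w y = dd (\<lambda>x. G x u v) w y + dd (\<lambda>x. G x u v') w y"
    by (subst dd_add[OF d d, symmetric]) (rule cong, simp add: bilinear_radd[OF bilinear])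
  show "dd (\<lambda>x. G x (c *\<^sub>R u) v) w y = c * dd (\<lambda>x. G x u v) w y"
    by (subst dd_linear_comp[OF bounded_linear_mult_right d, symmetric])
      (rule cong, simp add: bilinear_lmul[OF bilinear])
  show "dd (\<lambda>x. G x u (c *\<^sub>R v)) w y = c * dd (\<lambda>x. G x u v) w y"
    by (subst dd_linear_comp[OF bounded_linear_mult_right d, symmetric])
      (rule cong, simp add: bilinear_rmul[OF bilinear])
  show "dd (\<lambda>x. G x u v) w y = dd (\<lambda>x. G x v u) w y"
    by (rule cong) (rule sym)
qed

lemma linear_koszul:
  assumes y: "y \<in> S"
  shows "linear (koszul G y u v)"
proof (rule linearI)
  have lin: "linear (\<lambda>w. dd (\<lambda>x. G x u v) w y)" using linear_dd[OF differentiable[OF y]] .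
  fix w w' and c :: real
  show "koszul G y u v (w + w') = koszul G y u v w + koszul G y u v w'"
    by (simp add: koszul_def dd_metric[OF y] linear_add[OF lin])
  show "koszul G y u v (c *\<^sub>R w) = c *\<^sub>R koszul G y u v w"
    by (simp add: koszul_def dd_metric[OF y] linear_cmul[OF lin] algebra_simps)
qed

text \<open>Nondegeneracy makes the vector in the definite description unique, so exhibiting one
  solution identifies it. Bilinearity and symmetry of \<open>christoffel\<close> are obtained in
  this way.\<close>

lemma christoffel_eqI:
  assumes y: "y \<in> S" and z: "\<And>w. 2 * G y z w = koszul G y u v w"
  shows "christoffel G y u v = z"
  unfolding christoffel_def koszul_def[symmetric]
proof (rule the_equality)
  fix z' assume "\<forall>w. 2 * G y z' w = koszul G y u v w"
  then show "z' = z"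
    using z scalar_product.eqI[OF scalar_product[OF y]] by (metis mult_cancel_left zero_neq_numeral)
qed (use z in auto)

text \<open>A linear functional is represented by the vector whose coefficients are its values on an
  orthonormal basis. This settles existence, and in a smooth frame the same formula shows smoothness
  without inverting a matrix.\<close>

lemma koszul_frame:
  assumes y: "y \<in> S" and e: "scalar_product.orthonormal (G y) DIM('e) e"
  shows "2 * G y (\<Sum>k<DIM('e). (koszul G y u v (e k) / 2) *\<^sub>R e k) w = koszul G y u v w"
proof -
  interpret scalar_product "G y" using scalar_product[OF y] .
  note lin = linear_koszul[OF y]
  have "koszul G y u v w = koszul G y u v (\<Sum>k<DIM('e). G y w (e k) *\<^sub>R e k)"
    by (simp only: orthonormal_expand[OF e, symmetric])
  also have "\<dots> = (\<Sum>k<DIM('e). G y w (e k) * koszul G y u v (e k))"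
    by (simp add: linear_sum[OF lin] linear_cmul[OF lin])
  finally show ?thesis
    by (simp add: sum_left bilin_simps sum_distrib_left sym[of w] mult_ac)
qed

lemma christoffel_frame:
  assumes y: "y \<in> S" and e: "scalar_product.orthonormal (G y) DIM('e) e"
  shows "christoffel G y u v = (\<Sum>k<DIM('e). (koszul G y u v (e k) / 2) *\<^sub>R e k)"
  by (rule christoffel_eqI[OF y koszul_frame[OF y e]])

lemma orthonormal_basis:
  assumes "y \<in> S"
  obtains e where "scalar_product.orthonormal (G y) DIM('e) e"
  using frame[OF assms] by metis

lemma christoffel:
  assumes y: "y \<in> S"
  shows "2 * G y (christoffel G y u v) w = koszul G y u v w"
proof -
  obtain e where e: "scalar_product.orthonormal (G y) DIM('e) e" using orthonormal_basis[OF y] .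
  show ?thesis unfolding christoffel_frame[OF y e] by (rule koszul_frame[OF y e])
qed

lemma bilinear_christoffel:
  assumes y: "y \<in> S"
  shows "bilinear (christoffel G y)"
proof -
  interpret scalar_product "G y" using scalar_product[OF y] .
  have lin: "linear (\<lambda>w. dd (\<lambda>x. G x u v) w y)" for u v
    using linear_dd[OF differentiable[OF y]] .
  note simps = koszul_def dd_metric(1-4)[OF y] linear_add[OF lin] linear_cmul[OF lin]
  note [simp] = christoffel[OF y]
  show ?thesis
    unfolding bilinear_def
  proof (intro conjI allI linearI)
    fix u u' v v' and c :: real
    show "christoffel G y u (v + v') = christoffel G y u v + christoffel G y u v'"
      by (rule christoffel_eqI[OF y]) (simp add: bilin_simps distrib_left simps)
    show "christoffel G y u (c *\<^sub>R v) = c *\<^sub>R christoffel G y u v"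
      by (rule christoffel_eqI[OF y])
        (simp add: bilin_simps mult.left_commute[of 2] simps algebra_simps)
    show "christoffel G y (u + u') v = christoffel G y u v + christoffel G y u' v"
      by (rule christoffel_eqI[OF y]) (simp add: bilin_simps distrib_left simps)
    show "christoffel G y (c *\<^sub>R u) v = c *\<^sub>R christoffel G y u v"
      by (rule christoffel_eqI[OF y])
        (simp add: bilin_simps mult.left_commute[of 2] simps algebra_simps)
  qed
qed

lemma christoffel_commute:
  assumes y: "y \<in> S"
  shows "christoffel G y u v = christoffel G y v u"
proof (rule christoffel_eqI[OF y])
  fix w
  show "2 * G y (christoffel G y v u) w = koszul G y u v w"
    unfolding christoffel[OF y] by (simp add: koszul_def dd_metric(5)[OF y, of u v])
qed

lemma smooth_christoffel: "smooth_on S (\<lambda>y. christoffel G y u v)"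
proof (rule smooth_on_local[OF open_S])
  fix y assume "y \<in> S"
  then obtain U X where U: "y \<in> U" "U \<subseteq> S" "open U" "\<And>i. i < DIM('e) \<Longrightarrow> smooth_on U (X i)"
    "\<And>p. p \<in> U \<Longrightarrow> scalar_product.orthonormal (G p) DIM('e) (\<lambda>i. X i p)"
    using frame by metis
  have smooth_koszul: "smooth_on U (\<lambda>p. koszul G p u v i)" for i
    unfolding koszul_def
    using smooth_on_subset[OF smooth_on_dd[OF smooth] U(3,2)]
    by (intro smooth_on_add smooth_on_diff) auto
  \<comment> \<open>The frame vector inside \<open>koszul\<close> moves with the point; its
    expansion in \<open>Basis\<close> leaves constant arguments only.\<close>
  let ?f = "\<lambda>p. \<Sum>k<DIM('e). (1 / 2) *\<^sub>R ((\<Sum>i\<in>Basis. (X k p \<bullet> i) *\<^sub>R koszul G p u v i) *\<^sub>R X k p)"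
  have "smooth_on U (\<lambda>y. christoffel G y u v)"
  proof (rule smooth_on_cong)
    show "smooth_on U ?f"
      using U(3,4) smooth_koszul
      by (intro smooth_on_sum smooth_on_linear_comp[OF bounded_linear_scaleR_right]
          smooth_on_scaleR smooth_on_inner_left) auto
    show "?f p = christoffel G p u v" if "p \<in> U" for p
    proof -
      have pS: "p \<in> S" using that U by auto
      show ?thesis
        unfolding christoffel_frame[OF pS U(5)[OF that]] linear_expand[OF linear_koszul[OF pS], of u v "X _ p"]
        by simp
    qed
  qed
  then show "\<exists>U. y \<in> U \<and> smooth_on U (\<lambda>y. christoffel G y u v)" using U(1) by blast
qed

text \<open>In the sum of the two Koszul expressions all derivatives except those in direction
  \<open>u\<close> cancel.\<close>

lemma metric_compatible:
  assumes y: "y \<in> S"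
  shows "dd (\<lambda>x. G x v w) u y = G y (christoffel G y u v) w + G y v (christoffel G y u w)"
proof -
  have "2 * dd (\<lambda>x. G x v w) u y = koszul G y u v w + koszul G y u w v"
    by (simp add: koszul_def dd_metric(5)[OF y, of w v])
  also have "\<dots> = 2 * (G y (christoffel G y u v) w + G y v (christoffel G y u w))"
    unfolding christoffel[OF y, symmetric] by (simp add: sym[OF y, of v])
  finally show ?thesis by simp
qed

text \<open>By compatibility at \<open>\<Phi> x\<close>, the motion of the base point contributes
  exactly the Christoffel terms that turn \<open>dd V\<close> and \<open>dd Z\<close> into covariant
  derivatives along \<open>\<Phi>\<close>.\<close>

lemma metric_compatible_along:
  assumes \<Phi>: "smooth_on W \<Phi>" "\<Phi> ` W \<subseteq> S" and V: "smooth_on W V" and Z: "smooth_on W Z"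
    and x: "x \<in> W"
  shows "dd (\<lambda>x. G (\<Phi> x) (V x) (Z x)) u x
    = G (\<Phi> x) (cov_deriv_along G \<Phi> u V x) (Z x) + G (\<Phi> x) (V x) (cov_deriv_along G \<Phi> u Z x)"
proof -
  have px: "\<Phi> x \<in> S" using \<Phi>(2) x by auto
  have eq: "dd (\<lambda>x. G (\<Phi> x) (V x) (Z x)) u x = dd (\<lambda>y. G y (V x) (Z x)) (dd \<Phi> u x) (\<Phi> x)
      + G (\<Phi> x) (dd V u x) (Z x) + G (\<Phi> x) (V x) (dd Z u x)"
    by (rule dd_bilinear_field[OF bilinear smooth \<Phi> V Z x])
  interpret scalar_product "G (\<Phi> x)" using scalar_product[OF px] .
  show ?thesis
    unfolding eq metric_compatible[OF px]
    by (simp add: cov_deriv_along_def bilin_simps)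
qed

lemma smooth_christoffel_field:
  "smooth_on W \<Phi> \<Longrightarrow> \<Phi> ` W \<subseteq> S \<Longrightarrow> smooth_on W V \<Longrightarrow> smooth_on W Z \<Longrightarrow>
    smooth_on W (\<lambda>x. christoffel G (\<Phi> x) (V x) (Z x))"
  by (rule smooth_on_bilinear_field[OF bilinear_christoffel smooth_christoffel])

lemma smooth_cov_deriv_along:
  "smooth_on W \<Phi> \<Longrightarrow> \<Phi> ` W \<subseteq> S \<Longrightarrow> smooth_on W V \<Longrightarrow> smooth_on W (cov_deriv_along G \<Phi> u V)"
  unfolding cov_deriv_along_def[abs_def]
  by (intro smooth_on_add smooth_on_dd smooth_christoffel_field) auto

section \<open>Curvature in coordinates\<close>

definition riem :: "'e \<Rightarrow> 'e \<Rightarrow> 'e \<Rightarrow> 'e \<Rightarrow> 'e" where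
  "riem y u v w = curv G (\<lambda>_. u) (\<lambda>_. v) (\<lambda>_. w) y"

lemma riem_eq:
  assumes y: "y \<in> S"
  shows "riem y u v w
    = dd (\<lambda>x. christoffel G x v w) u y + christoffel G y u (christoffel G y v w)
      - dd (\<lambda>x. christoffel G x u w) v y - christoffel G y v (christoffel G y u w)"
proof -
  \<comment> \<open>Constant fields commute, so the bracket term of the curvature drops out.\<close>
  have "cov_deriv G (lie_bracket (\<lambda>_. u) (\<lambda>_. v)) (\<lambda>_. w) y = 0"
    using bilinear_lzero[OF bilinear_christoffel[OF y]] by (simp add: cov_deriv_def lie_bracket_def)
  then show ?thesis
    by (simp add: riem_def curv_def) (simp add: cov_deriv_def[abs_def])
qed

text \<open>Third derivatives and mixed second derivatives of \<open>\<Phi>\<close> commute, and the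
  terms that pair a first derivative with a derivative of \<open>dd \<Phi> w\<close> are symmetric
  in \<open>u\<close> and \<open>v\<close>; what survives of the commutator is the coordinate
  expression of the curvature. It is used for immersions and, with the identity as
  \<open>\<Phi>\<close>, for constant fields.\<close>

lemma riem_along:
  fixes \<Phi> :: "'a::euclidean_space \<Rightarrow> 'e"
  assumes \<Phi>: "smooth_on W \<Phi>" "\<Phi> ` W \<subseteq> S" and x: "x \<in> W"
  shows "cov_deriv_along G \<Phi> u (cov_deriv_along G \<Phi> v (dd \<Phi> w)) x
      - cov_deriv_along G \<Phi> v (cov_deriv_along G \<Phi> u (dd \<Phi> w)) x
    = riem (\<Phi> x) (dd \<Phi> u x) (dd \<Phi> v x) (dd \<Phi> w x)"
proof -
  have px: "\<Phi> x \<in> S" using \<Phi>(2) x by auto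
  note b = bilinear_christoffel[OF px]
  note d\<Phi> = smooth_on_dd[OF \<Phi>(1)]
  have e: "cov_deriv_along G \<Phi> u (cov_deriv_along G \<Phi> v (dd \<Phi> w)) x
    = dd (dd (dd \<Phi> w) v) u x
      + dd (\<lambda>y. christoffel G y (dd \<Phi> v x) (dd \<Phi> w x)) (dd \<Phi> u x) (\<Phi> x)
      + christoffel G (\<Phi> x) (dd (dd \<Phi> v) u x) (dd \<Phi> w x)
      + christoffel G (\<Phi> x) (dd \<Phi> v x) (dd (dd \<Phi> w) u x)
      + christoffel G (\<Phi> x) (dd \<Phi> u x) (dd (dd \<Phi> w) v x)
      + christoffel G (\<Phi> x) (dd \<Phi> u x) (christoffel G (\<Phi> x) (dd \<Phi> v x) (dd \<Phi> w x))" for u v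
  proof -
    have "dd (cov_deriv_along G \<Phi> v (dd \<Phi> w)) u x
      = dd (dd (dd \<Phi> w) v) u x + dd (\<lambda>y. christoffel G (\<Phi> y) (dd \<Phi> v y) (dd \<Phi> w y)) u x"
      unfolding cov_deriv_along_def
      by (intro dd_add smooth_on_differentiable[OF _ x] smooth_on_dd d\<Phi> smooth_christoffel_field \<Phi>)
    also have "dd (\<lambda>y. christoffel G (\<Phi> y) (dd \<Phi> v y) (dd \<Phi> w y)) u x
      = dd (\<lambda>y. christoffel G y (dd \<Phi> v x) (dd \<Phi> w x)) (dd \<Phi> u x) (\<Phi> x)
        + christoffel G (\<Phi> x) (dd (dd \<Phi> v) u x) (dd \<Phi> w x)
        + christoffel G (\<Phi> x) (dd \<Phi> v x) (dd (dd \<Phi> w) u x)"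
      by (rule dd_bilinear_field[OF bilinear_christoffel smooth_christoffel \<Phi> d\<Phi> d\<Phi> x])
    finally show ?thesis
      by (simp add: cov_deriv_along_def[of G \<Phi> _ "cov_deriv_along G \<Phi> _ _"])
        (simp add: cov_deriv_along_def bilinear_radd[OF b])
  qed
  show ?thesis
    unfolding e riem_eq[OF px] dd_commute[OF d\<Phi> x, of w v u] dd_commute[OF \<Phi>(1) x, of v u]
    by simp
qed

lemma bilinear_riem:
  assumes y: "y \<in> S"
  shows "bilinear (\<lambda>u v. riem y u v w)" "linear (riem y u v)"
proof -
  note b = bilinear_christoffel[OF y]
  have d: "(\<lambda>x. christoffel G x u v) differentiable (at y)" for u v
    using smooth_on_differentiable[OF smooth_christoffel y] .
  note cong = dd_cong_open[OF open_S y]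
  have dc: "dd (\<lambda>x. christoffel G x (u + u') v) w y
      = dd (\<lambda>x. christoffel G x u v) w y + dd (\<lambda>x. christoffel G x u' v) w y"
    "dd (\<lambda>x. christoffel G x u (v + v')) w y
      = dd (\<lambda>x. christoffel G x u v) w y + dd (\<lambda>x. christoffel G x u v') w y"
    "dd (\<lambda>x. christoffel G x (c *\<^sub>R u) v) w y = c *\<^sub>R dd (\<lambda>x. christoffel G x u v) w y"
    "dd (\<lambda>x. christoffel G x u (c *\<^sub>R v)) w y = c *\<^sub>R dd (\<lambda>x. christoffel G x u v) w y"
    for u u' v v' w and c :: real
    subgoal by (subst dd_add[OF d d, symmetric])
        (rule cong, simp add: bilinear_ladd[OF bilinear_christoffel])
    subgoal by (subst dd_add[OF d d, symmetric])
        (rule cong, simp add: bilinear_radd[OF bilinear_christoffel])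
    subgoal by (subst dd_linear_comp[OF bounded_linear_scaleR_right d, symmetric])
        (rule cong, simp add: bilinear_lmul[OF bilinear_christoffel])
    subgoal by (subst dd_linear_comp[OF bounded_linear_scaleR_right d, symmetric])
        (rule cong, simp add: bilinear_rmul[OF bilinear_christoffel])
    done
  have lin: "linear (\<lambda>w. dd (\<lambda>x. christoffel G x u v) w y)" for u v using linear_dd[OF d] .
  note simps = riem_eq[OF y] dc linear_add[OF lin] linear_cmul[OF lin] bilinear_ladd[OF b]
    bilinear_radd[OF b] bilinear_lmul[OF b] bilinear_rmul[OF b]
  show "bilinear (\<lambda>u v. riem y u v w)" "linear (riem y u v)"
    unfolding bilinear_def by (auto intro!: linearI simp: simps scaleR_diff_right scaleR_add_right)
qed

lemma riem_antisym: "riem y v u w = - riem y u v w" if "y \<in> S"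
  by (simp add: riem_eq that)

text \<open>The second derivatives of the function \<open>G x w z\<close> commute. When both orders
  are expanded by metric compatibility, the products of first covariant derivatives cancel, so the
  two curvature terms must add up to zero.\<close>

lemma riem_antisym_metric:
  assumes y: "y \<in> S"
  shows "G y (riem y u v w) z = - G y (riem y u v z) w"
proof -
  interpret scalar_product "G y" using scalar_product[OF y] .
  let ?I = "\<lambda>x::'e. x"
  have I: "smooth_on S ?I" "?I ` S \<subseteq> S"
    using smooth_on_bounded_linear[OF bounded_linear_ident open_S] by auto
  have c: "smooth_on S (\<lambda>_. w)" for w :: 'e using smooth_on_const[OF open_S] .
  let ?D = "\<lambda>u V. cov_deriv_along G ?I u V"
  have sD: "smooth_on S (?D u (\<lambda>_. w))" for u w
    using smooth_cov_deriv_along[OF I c] .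
  have dI: "dd ?I w = (\<lambda>_. w)" for w by simp
  have e: "dd (dd (\<lambda>x. G x w z) v) u y = G y (?D u (?D v (\<lambda>_. w)) y) z
      + G y (?D v (\<lambda>_. w) y) (?D u (\<lambda>_. z) y) + G y (?D u (\<lambda>_. w) y) (?D v (\<lambda>_. z) y)
      + G y w (?D u (?D v (\<lambda>_. z)) y)" for u v
  proof -
    have "dd (dd (\<lambda>x. G x w z) v) u y
      = dd (\<lambda>x. G x (?D v (\<lambda>_. w) x) z + G x w (?D v (\<lambda>_. z) x)) u y"
      by (rule dd_cong_open[OF open_S y]) (rule metric_compatible_along[OF I c c])
    also have "\<dots> = dd (\<lambda>x. G x (?D v (\<lambda>_. w) x) z) u y + dd (\<lambda>x. G x w (?D v (\<lambda>_. z) x)) u y"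
      by (intro dd_add smooth_on_differentiable[OF _ y] smooth_field I sD c)
    finally show ?thesis
      unfolding metric_compatible_along[OF I sD c y] metric_compatible_along[OF I c sD y] by simp
  qed
  have "dd (dd (\<lambda>x. G x w z) v) u y = dd (dd (\<lambda>x. G x w z) u) v y"
    using dd_commute[OF smooth y] .
  moreover have "riem y u v w = ?D u (?D v (\<lambda>_. w)) y - ?D v (?D u (\<lambda>_. w)) y" for w
    using riem_along[OF I y, of u v w] unfolding dI by simp
  ultimately show ?thesis unfolding e by (simp add: bilin_simps sym[of _ w])
qed

end

section \<open>The algebraic inequality\<close>

context scalar_product
begin

text \<open>Cauchy-Schwarz against the vector of ones, obtained by summing the nonnegative squares
  of all pairwise differences.\<close>

lemma square_sum_le:
  fixes a :: "nat \<Rightarrow> 'e"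
  shows "B (\<Sum>i\<in>I. a i) (\<Sum>i\<in>I. a i) \<le> real (card I) * (\<Sum>i\<in>I. B (a i) (a i))"
proof -
  have "0 \<le> (\<Sum>i\<in>I. \<Sum>j\<in>I. B (a i - a j) (a i - a j))"
    by (intro sum_nonneg nonneg)
  also have "\<dots> = (\<Sum>i\<in>I. \<Sum>j\<in>I. B (a i) (a i) + B (a j) (a j) - 2 * B (a i) (a j))"
  proof (intro sum.cong refl)
    show "B (a i - a j) (a i - a j) = B (a i) (a i) + B (a j) (a j) - 2 * B (a i) (a j)" for i j
      using sym[of "a j" "a i"] by (simp add: bilin_simps)
  qed
  also have "\<dots> = 2 * (real (card I) * (\<Sum>i\<in>I. B (a i) (a i)))
      - 2 * B (\<Sum>i\<in>I. a i) (\<Sum>i\<in>I. a i)"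
    by (simp add: sum_left sum_right sum_subtractf sum.distrib sum_distrib_left) (rule sum.swap)
  finally show ?thesis by simp
qed

lemma chen_inequality:
  fixes H :: "nat \<Rightarrow> nat \<Rightarrow> 'e"
  assumes js: "j < n" "s < n" "j \<noteq> s" and H: "\<And>i k. H i k = H k i"
  defines "T \<equiv> \<Sum>i<n. H i i"
  shows "B T T / (real n - 1) / 2 - (\<Sum>i<n. \<Sum>k<n. B (H i k) (H i k)) / 2
    \<le> B (H j j) (H s s) - B (H j s) (H j s)"
proof -
  define I where "I = {..<n} - {s}"
  define J where "J = I - {j}"
  \<comment> \<open>Index \<open>s\<close> is removed from \<open>I\<close>; its vector is carried
    by index \<open>j\<close> instead.\<close>
  define a where "a i = (if i = j then H j j + H s s else H i i)" for i
  have fin: "finite I" "finite J" by (auto simp: I_def J_def)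
  have jI: "j \<in> I" using js by (simp add: I_def)
  have n1: "real n - 1 > 0" using js by auto
  have sum_split: "(\<Sum>i<n. f i) = f s + (f j + (\<Sum>i\<in>J. f i))" for f :: "nat \<Rightarrow> 'b::comm_monoid_add"
    using js unfolding J_def sum.remove[OF fin(1) jI, symmetric]
    unfolding I_def by (intro sum.remove) auto
  have sum_I: "(\<Sum>i\<in>I. f i) = f j + (\<Sum>i\<in>J. f i)" for f :: "nat \<Rightarrow> 'b::comm_monoid_add"
    unfolding J_def by (rule sum.remove[OF fin(1) jI])
  have aJ: "(\<Sum>i\<in>J. f (a i)) = (\<Sum>i\<in>J. f (H i i))" for f :: "'e \<Rightarrow> 'b::comm_monoid_add"
    by (intro sum.cong refl) (auto simp: a_def J_def)
  have T: "T = (\<Sum>i\<in>I. a i)"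
    unfolding T_def sum_split sum_I aJ[of "\<lambda>x. x"] by (simp add: a_def algebra_simps)
  have "card I = n - 1" using js by (simp add: I_def)
  then have "B T T \<le> (real n - 1) * (\<Sum>i\<in>I. B (a i) (a i))"
    using square_sum_le[of a I] js by (simp add: T of_nat_diff)
  then have 1: "B T T / (real n - 1) \<le> (\<Sum>i\<in>I. B (a i) (a i))"
    using n1 by (simp add: field_simps)
  have 2: "(\<Sum>i\<in>I. B (a i) (a i)) = 2 * B (H j j) (H s s) + (\<Sum>i<n. B (H i i) (H i i))"
  proof -
    have "(\<Sum>i\<in>I. B (a i) (a i)) = B (H j j + H s s) (H j j + H s s) + (\<Sum>i\<in>J. B (H i i) (H i i))"
      using sum_I[of "\<lambda>i. B (a i) (a i)"] aJ[of "\<lambda>x. B x x"] by (simp add: a_def)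
    moreover have "(\<Sum>i<n. B (H i i) (H i i))
        = B (H s s) (H s s) + (B (H j j) (H j j) + (\<Sum>i\<in>J. B (H i i) (H i i)))"
      by (rule sum_split)
    moreover have "B (H j j + H s s) (H j j + H s s)
        = B (H j j) (H j j) + 2 * B (H j j) (H s s) + B (H s s) (H s s)"
      using sym[of "H s s" "H j j"] by (simp add: bilin_simps)
    ultimately show ?thesis by linarith
  qed
  let ?f = "\<lambda>(i, k). B (H i k) (H i k)"
  \<comment> \<open>The diagonal entries and those at (j, s) and (s, j) are distinct nonnegative
    summands of the full sum of squares; symmetry of \<open>H\<close> gives the factor 2.\<close>
  have "(\<Sum>i<n. B (H i i) (H i i)) + 2 * B (H j s) (H j s)
      = sum ?f ((\<lambda>i. (i, i)) ` {..<n}) + sum ?f {(j, s), (s, j)}"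
    using js H[of s j] by (simp add: sum.reindex inj_on_def)
  also have "\<dots> = sum ?f ((\<lambda>i. (i, i)) ` {..<n} \<union> {(j, s), (s, j)})"
    using js by (intro sum.union_disjoint[symmetric]) auto
  also have "\<dots> \<le> sum ?f ({..<n} \<times> {..<n})"
    using js by (intro sum_mono2) (auto simp: nonneg)
  also have "\<dots> = (\<Sum>i<n. \<Sum>k<n. B (H i k) (H i k))"
    by (simp add: sum.cartesian_product)
  finally have 3: "(\<Sum>i<n. B (H i i) (H i i)) + 2 * B (H j s) (H j s)
      \<le> (\<Sum>i<n. \<Sum>k<n. B (H i k) (H i k))" .
  \<comment> \<open>Naming the quotient lets linear arithmetic treat it as an atom.\<close>
  define X where "X = B T T / (real n - 1)"
  show ?thesis using 1 2 3 unfolding X_def[symmetric] by linarith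
qed

end


section \<open>Sectional curvature\<close>

lemma span_pair:
  assumes "x \<in> span {u, v}"
  obtains a b where "x = a *\<^sub>R u + b *\<^sub>R v"
proof -
  obtain a where "x - a *\<^sub>R u \<in> span {v}" using assms by (auto simp: span_insert[of u])
  then obtain b where "x - a *\<^sub>R u = b *\<^sub>R v" by (auto simp: span_singleton)
  then show ?thesis using that[of a b] by (simp add: algebra_simps)
qed

lemma independent_pair:
  assumes "independent {u, v}" "u \<noteq> v" "a *\<^sub>R u + b *\<^sub>R v = 0"
  shows "a = 0 \<and> b = 0"
proof -
  have "(\<lambda>x. if x = u then a else b) x = 0" if "x \<in> {u, v}" for x
  proof (rule independentD[OF assms(1) _ order.refl _ that])
    show "(\<Sum>x\<in>{u, v}. (if x = u then a else b) *\<^sub>R x) = 0"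
      using assms by simp
  qed simp
  then show ?thesis using assms(2) by force
qed

context local_metric
begin

definition sect :: "'e \<Rightarrow> 'e \<Rightarrow> 'e \<Rightarrow> real" where
  "sect y u v = G y (riem y u v v) u / (G y u u * G y v v - (G y u v)\<^sup>2)"

text \<open>The numerator, by the two antisymmetries of the curvature, and the denominator, a Gram
  determinant, both pick up the squared determinant of the change of basis.\<close>

lemma sect_change_basis:
  assumes y: "y \<in> S" and det: "a * d - b * c \<noteq> 0"
  shows "sect y (a *\<^sub>R u + b *\<^sub>R v) (c *\<^sub>R u + d *\<^sub>R v) = sect y u v"
proof -
  note br = bilinear_riem(1)[OF y] and anti = riem_antisym[OF y] and antim = riem_antisym_metric[OF y]
  note lr = bilinear_riem(2)[OF y]
  interpret scalar_product "G y" using scalar_product[OF y] .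
  have rr: "riem y w w z = 0" for w z by (simp add: riem_eq[OF y])
  have r: "riem y (a *\<^sub>R u + b *\<^sub>R v) (c *\<^sub>R u + d *\<^sub>R v) w = (a * d - b * c) *\<^sub>R riem y u v w" for w
    using anti[of u v w]
    by (simp add: bilinear_ladd[OF br] bilinear_radd[OF br] bilinear_lmul[OF br] bilinear_rmul[OF br]
        rr algebra_simps)
  have gg: "G y (riem y u v w) w = 0" for w using antim[of u v w w] by simp
  have num: "G y (riem y (a *\<^sub>R u + b *\<^sub>R v) (c *\<^sub>R u + d *\<^sub>R v) (c *\<^sub>R u + d *\<^sub>R v)) (a *\<^sub>R u + b *\<^sub>R v)
      = (a * d - b * c)\<^sup>2 * G y (riem y u v v) u"
    unfolding r using antim[of u v u v]
    by (simp add: linear_add[OF lr] linear_cmul[OF lr] bilin_simps gg power2_eq_square algebra_simps)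
  have den: "G y (a *\<^sub>R u + b *\<^sub>R v) (a *\<^sub>R u + b *\<^sub>R v) * G y (c *\<^sub>R u + d *\<^sub>R v) (c *\<^sub>R u + d *\<^sub>R v)
        - (G y (a *\<^sub>R u + b *\<^sub>R v) (c *\<^sub>R u + d *\<^sub>R v))\<^sup>2
      = (a * d - b * c)\<^sup>2 * (G y u u * G y v v - (G y u v)\<^sup>2)"
    by (simp add: bilin_simps sym[of v u] power2_eq_square algebra_simps)
  show ?thesis unfolding sect_def num den using det by simp
qed

text \<open>This removes the arbitrary choice of a basis from
  \<open>sectional_curvature\<close>.\<close>

lemma sect_span_eq:
  assumes y: "y \<in> S" and uv: "independent {u, v}" "u \<noteq> v"
    and uv': "independent {u', v'}" "u' \<noteq> v'" and span: "span {u', v'} = span {u, v}"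
  shows "sect y u' v' = sect y u v"
proof -
  have "u' \<in> span {u', v'}" "v' \<in> span {u', v'}" by (simp_all add: span_base)
  then have in_span: "u' \<in> span {u, v}" "v' \<in> span {u, v}" by (simp_all only: span)
  obtain a b where u': "u' = a *\<^sub>R u + b *\<^sub>R v" using span_pair[OF in_span(1)] .
  obtain c d where v': "v' = c *\<^sub>R u + d *\<^sub>R v" using span_pair[OF in_span(2)] .
  \<comment> \<open>If the determinant vanished, the rows of the adjugate matrix would give linear
    relations between \<open>u'\<close> and \<open>v'\<close>, and their independence would force
    all four coefficients to be zero.\<close>
  have "a * d - b * c \<noteq> 0"
  proof
    assume 0: "a * d - b * c = 0"
    have "d *\<^sub>R u' + (- b) *\<^sub>R v' = (a * d - b * c) *\<^sub>R u" by (simp add: u' v' algebra_simps)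
    then have "d = 0 \<and> b = 0" using 0 independent_pair[OF uv', of d "- b"] by simp
    moreover have "c *\<^sub>R u' + (- a) *\<^sub>R v' = - (a * d - b * c) *\<^sub>R v" by (simp add: u' v' algebra_simps)
    then have "c = 0 \<and> a = 0" using 0 independent_pair[OF uv', of c "- a"] by simp
    ultimately have "u' = 0" by (simp add: u')
    then show False using uv' dependent_zero[of "{u', v'}"] by simp
  qed
  then show ?thesis using sect_change_basis[OF y] u' v' by blast
qed

text \<open>Compares the metric at a point with the Euclidean norm: by Parseval, the coefficients of
  a unit vector in an orthonormal basis are at most 1 in absolute value.\<close>

lemma unit_vectors_bounded:
  assumes y: "y \<in> S"
  shows "\<exists>M. \<forall>u. G y u u = 1 \<longrightarrow> norm u \<le> M"
proof -
  interpret scalar_product "G y" using scalar_product[OF y] .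
  obtain e where e: "orthonormal DIM('e) e" using orthonormal_basis[OF y] .
  have "norm u \<le> (\<Sum>k<DIM('e). norm (e k))" if u: "G y u u = 1" for u
  proof -
    have "\<bar>G y u (e k)\<bar> \<le> 1" if "k < DIM('e)" for k
    proof -
      have "(G y u (e k))\<^sup>2 \<le> (\<Sum>k<DIM('e). (G y u (e k))\<^sup>2)"
        using that by (intro member_le_sum) auto
      also have "\<dots> = 1" using parseval[OF e, of u u] u by (simp add: power2_eq_square)
      finally show ?thesis by (simp add: abs_square_le_1)
    qed
    then have "norm (\<Sum>k<DIM('e). G y u (e k) *\<^sub>R e k) \<le> (\<Sum>k<DIM('e). norm (e k))"
      by (intro sum_norm_le) (simp add: mult_left_le_one_le)
    then show ?thesis by (simp only: orthonormal_expand[OF e, symmetric])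
  qed
  then show ?thesis by blast
qed

text \<open>Supplies the lower bound without which a real \<open>Inf\<close> says nothing about its
  set. Once the basis of the plane is orthonormalised, the quotient is a curvature value at unit
  vectors, and these values are bounded.\<close>

lemma sect_bounded_below:
  assumes y: "y \<in> S"
  shows "\<exists>K. \<forall>u v. independent {u, v} \<longrightarrow> u \<noteq> v \<longrightarrow> K \<le> sect y u v"
proof -
  note br = bilinear_riem(1)[OF y] and lr = bilinear_riem(2)[OF y]
  interpret scalar_product "G y" using scalar_product[OF y] .
  obtain M where M: "\<And>u. G y u u = 1 \<Longrightarrow> norm u \<le> M" using unit_vectors_bounded[OF y] by blast
  obtain C where C: "\<And>u v. norm (G y u v) \<le> C * norm u * norm v"
    using bilinear_bounded[OF bilinear] by blast
  \<comment> \<open>Boundedness is available for bilinear maps, so the third slot is fixed here and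
    expanded in \<open>Basis\<close> afterwards; \<open>R\<close> collects the resulting
    bounds.\<close>
  have "\<exists>D. \<forall>u v. norm (riem y u v w) \<le> D * norm u * norm v" for w
    using bilinear_bounded[OF br] by blast
  then obtain D where D: "\<And>u v w. norm (riem y u v w) \<le> D w * norm u * norm v" by metis
  define R where "R = (\<Sum>i\<in>Basis. M * (\<bar>D i\<bar> * M * M))"
  have K: "\<bar>G y (riem y u v v) u\<bar> \<le> \<bar>C\<bar> * R * M" if "G y u u = 1" "G y v v = 1" for u v
  proof -
    have Mu: "norm u \<le> M" "norm v \<le> M" using M that by auto
    then have M0: "0 \<le> M" using norm_ge_zero order_trans by blast
    have ri: "norm (riem y u v i) \<le> \<bar>D i\<bar> * M * M" for i
    proof -
      have "norm (riem y u v i) \<le> \<bar>D i\<bar> * norm u * norm v"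
        by (rule order_trans[OF D]) (intro mult_right_mono, auto)
      also have "\<dots> \<le> \<bar>D i\<bar> * M * M" using Mu M0 by (intro mult_mono) auto
      finally show ?thesis .
    qed
    have "norm (riem y u v v) = norm (\<Sum>i\<in>Basis. (v \<bullet> i) *\<^sub>R riem y u v i)"
      using linear_expand[OF lr, of u v v] by simp
    also have "\<dots> \<le> R"
      unfolding R_def
    proof (rule sum_norm_le)
      fix i :: 'e assume "i \<in> Basis"
      then have "\<bar>v \<bullet> i\<bar> \<le> M" using Basis_le_norm Mu by (meson order_trans)
      then show "norm ((v \<bullet> i) *\<^sub>R riem y u v i) \<le> M * (\<bar>D i\<bar> * M * M)"
        using ri M0 by (simp add: mult_mono)
    qed
    finally have rR: "norm (riem y u v v) \<le> R" .
    have "\<bar>G y (riem y u v v) u\<bar> \<le> \<bar>C\<bar> * norm (riem y u v v) * norm u"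
      using order_trans[OF C, of "riem y u v v" u "\<bar>C\<bar> * norm (riem y u v v) * norm u"]
      by (simp add: mult_right_mono)
    also have "\<dots> \<le> \<bar>C\<bar> * R * M"
    proof -
      have "0 \<le> R" using rR norm_ge_zero order_trans by blast
      then show ?thesis using rR Mu M0 by (intro mult_mono mult_nonneg_nonneg) auto
    qed
    finally show ?thesis .
  qed
  have "- (\<bar>C\<bar> * R * M) \<le> sect y u v" if uv: "independent {u, v}" "u \<noteq> v" for u v
  proof -
    have u0: "u \<noteq> 0" using uv dependent_zero[of "{u, v}"] by auto
    define a where "a = 1 / sqrt (G y u u)"
    have a: "a > 0" "a * a * G y u u = 1" using pos[OF u0] by (auto simp: a_def)
    \<comment> \<open>Gram-Schmidt: \<open>k\<close> is the coefficient of \<open>u\<close> in the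
      projection of \<open>v\<close> onto \<open>u\<close>. The normalised vectors \<open>u'\<close>
      and \<open>v'\<close> are written in terms of \<open>u\<close> and \<open>v\<close> to fit the
      rule for a change of basis.\<close>
    define k where "k = G y v (a *\<^sub>R u) * a"
    define w where "w = (- k) *\<^sub>R u + 1 *\<^sub>R v"
    have w0: "w \<noteq> 0" using independent_pair[OF uv, of "- k" 1] by (auto simp: w_def)
    define d where "d = 1 / sqrt (G y w w)"
    have d: "d > 0" "d * d * G y w w = 1" using pos[OF w0] by (auto simp: d_def)
    define u' where "u' = a *\<^sub>R u + 0 *\<^sub>R v"
    define v' where "v' = (d * (- k)) *\<^sub>R u + d *\<^sub>R v"
    have v': "v' = d *\<^sub>R w" by (simp add: v'_def w_def algebra_simps)
    have uu: "G y u' u' = 1" using a by (simp add: u'_def bilin_simps mult_ac)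
    have vv: "G y v' v' = 1" using d by (simp add: v' bilin_simps mult_ac)
    have "G y u w = 0"
    proof -
      have "G y u w = G y v u - a * a * G y u u * G y v u"
        by (simp add: w_def k_def bilin_simps sym[of u v] mult_ac)
      then show ?thesis using a by simp
    qed
    then have uv': "G y u' v' = 0" by (simp add: u'_def v' bilin_simps)
    have "sect y u v = sect y u' v'"
      unfolding u'_def v'_def using a d by (intro sect_change_basis[OF y, symmetric]) auto
    also have "\<dots> = G y (riem y u' v' v') u'" by (simp add: sect_def uu vv uv')
    finally show ?thesis using K[OF uu vv] by simp
  qed
  then show ?thesis by blast
qed

end


section \<open>The Gauss equation\<close>

locale local_isometry = M: local_metric W g + N: local_metric S G
  for W :: "'e::euclidean_space set" and g and S :: "'d::euclidean_space set" and G +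
  fixes \<Phi> :: "'e \<Rightarrow> 'd"
  assumes smooth: "smooth_on W \<Phi>" and image: "\<Phi> ` W \<subseteq> S"
    and isometric: "x \<in> W \<Longrightarrow> g x u v = G (\<Phi> x) (dd \<Phi> u x) (dd \<Phi> v x)"
begin

abbreviation Nabla :: "'e \<Rightarrow> ('e \<Rightarrow> 'd) \<Rightarrow> 'e \<Rightarrow> 'd" where
  "Nabla \<equiv> cov_deriv_along G \<Phi>"

text \<open>The Gauss formula read in one chart on each side. Normality is not built in; it is
  proved in \<open>sff_normal\<close>.\<close>

definition sff :: "'e \<Rightarrow> 'e \<Rightarrow> 'e \<Rightarrow> 'd" where
  "sff x u v = Nabla u (dd \<Phi> v) x - dd \<Phi> (christoffel g x u v) x"

lemma image_in: "x \<in> W \<Longrightarrow> \<Phi> x \<in> S"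
  using image by auto

lemma linear_dd_\<Phi>: "x \<in> W \<Longrightarrow> linear (\<lambda>v. dd \<Phi> v x)"
  using linear_dd[OF smooth_on_differentiable[OF smooth]] .

text \<open>Torsion-freeness along \<open>\<Phi>\<close>: second derivatives commute and the
  Christoffel symbols are symmetric.\<close>

lemma Nabla_commute:
  assumes "x \<in> W"
  shows "Nabla u (dd \<Phi> v) x = Nabla v (dd \<Phi> u) x"
  using dd_commute[OF smooth assms, of u v]
    N.christoffel_commute[OF image_in[OF assms], of "dd \<Phi> u x" "dd \<Phi> v x"]
  by (simp add: cov_deriv_along_def)

lemma sff_commute: "x \<in> W \<Longrightarrow> sff x u v = sff x v u"
  using M.christoffel_commute[of x u v] by (simp add: sff_def Nabla_commute[of x u v])

text \<open>The first slot enters as a direction of differentiation and through Christoffel symbols,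
  so linearity there is immediate; symmetry carries it to the second slot.\<close>

lemma bilinear_sff:
  assumes x: "x \<in> W"
  shows "bilinear (sff x)"
proof -
  note b = N.bilinear_christoffel[OF image_in[OF x]] and b' = M.bilinear_christoffel[OF x]
  note l = linear_dd_\<Phi>[OF x] and l2 = linear_dd[OF smooth_on_differentiable[OF smooth_on_dd[OF smooth] x]]
  have "linear (\<lambda>u. sff x u v)" for v
    by (rule linearI)
      (simp_all add: sff_def cov_deriv_along_def linear_add[OF l] linear_add[OF l2] linear_cmul[OF l]
        linear_cmul[OF l2] bilinear_ladd[OF b] bilinear_ladd[OF b'] bilinear_lmul[OF b]
        bilinear_lmul[OF b'] algebra_simps)
  then show ?thesis
    unfolding bilinear_def using sff_commute[OF x] by simp
qed

text \<open>Differentiating the isometry condition shows that the products of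
  \<open>Nabla u (dd \<Phi> v)\<close> with tangent vectors satisfy the Koszul formula of
  \<open>g\<close>. Hence the tangential part of the ambient derivative is the intrinsic
  one.\<close>

lemma tangential:
  assumes x: "x \<in> W"
  shows "G (\<Phi> x) (Nabla u (dd \<Phi> v) x) (dd \<Phi> w x) = g x (christoffel g x u v) w"
proof -
  interpret scalar_product "G (\<Phi> x)" using N.scalar_product[OF image_in[OF x]] .
  have "dd (\<lambda>x. g x v w) u x
      = G (\<Phi> x) (Nabla u (dd \<Phi> v) x) (dd \<Phi> w x) + G (\<Phi> x) (dd \<Phi> v x) (Nabla u (dd \<Phi> w) x)" for u v w
  proof -
    have "dd (\<lambda>x. g x v w) u x = dd (\<lambda>x. G (\<Phi> x) (dd \<Phi> v x) (dd \<Phi> w x)) u x"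
      by (rule dd_cong_open[OF M.open_S x]) (rule isometric)
    also have "\<dots> = G (\<Phi> x) (Nabla u (dd \<Phi> v) x) (dd \<Phi> w x) + G (\<Phi> x) (dd \<Phi> v x) (Nabla u (dd \<Phi> w) x)"
      by (rule N.metric_compatible_along[OF smooth image smooth_on_dd[OF smooth] smooth_on_dd[OF smooth] x])
    finally show ?thesis .
  qed
  then have "koszul g x u v w = 2 * G (\<Phi> x) (Nabla u (dd \<Phi> v) x) (dd \<Phi> w x)"
    by (simp add: koszul_def Nabla_commute[OF x, of v u] Nabla_commute[OF x, of w] sym[of "dd \<Phi> _ x"])
  then show ?thesis using M.christoffel[OF x, of u v w] by simp
qed

lemma sff_normal:
  assumes x: "x \<in> W"
  shows "G (\<Phi> x) (sff x u v) (dd \<Phi> w x) = 0"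
proof -
  interpret scalar_product "G (\<Phi> x)" using N.scalar_product[OF image_in[OF x]] .
  show ?thesis
    by (simp add: sff_def bilin_simps tangential[OF x] isometric[OF x])
qed

text \<open>Differentiate the identity \<open>tangential\<close> in direction \<open>u\<close>,
  using metric compatibility on both sides, and antisymmetrise in \<open>u\<close> and
  \<open>v\<close>. Products of first derivatives split orthogonally into tangential and normal
  parts, and the normal parts are the \<open>sff\<close> terms.\<close>

lemma gauss_equation:
  assumes x: "x \<in> W"
  shows "G (\<Phi> x) (N.riem (\<Phi> x) (dd \<Phi> u x) (dd \<Phi> v x) (dd \<Phi> w x)) (dd \<Phi> z x)
    = g x (M.riem x u v w) z - G (\<Phi> x) (sff x v w) (sff x u z) + G (\<Phi> x) (sff x u w) (sff x v z)"
proof -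
  interpret SP: scalar_product "G (\<Phi> x)" using N.scalar_product[OF image_in[OF x]] .
  interpret sp: scalar_product "g x" using M.scalar_product[OF x] .
  have e: "G (\<Phi> x) (Nabla u (Nabla v (dd \<Phi> w)) x) (dd \<Phi> z x)
    = g x (dd (\<lambda>x. christoffel g x v w) u x + christoffel g x u (christoffel g x v w)) z
      - G (\<Phi> x) (sff x v w) (sff x u z)" for u v
  proof -
    have split: "Nabla u (dd \<Phi> v) x = dd \<Phi> (christoffel g x u v) x + sff x u v" for u v
      by (simp add: sff_def)
    have "G (\<Phi> x) (Nabla u (Nabla v (dd \<Phi> w)) x) (dd \<Phi> z x)
        + G (\<Phi> x) (Nabla v (dd \<Phi> w) x) (Nabla u (dd \<Phi> z) x)
      = dd (\<lambda>x. G (\<Phi> x) (Nabla v (dd \<Phi> w) x) (dd \<Phi> z x)) u x"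
      by (rule N.metric_compatible_along[OF smooth image _ smooth_on_dd[OF smooth] x, symmetric])
        (rule N.smooth_cov_deriv_along[OF smooth image smooth_on_dd[OF smooth]])
    also have "\<dots> = dd (\<lambda>x. g x (christoffel g x v w) z) u x"
      by (rule dd_cong_open[OF M.open_S x]) (rule tangential)
    also have "\<dots> = g x (cov_deriv_along g (\<lambda>x. x) u (\<lambda>x. christoffel g x v w) x) z
        + g x (christoffel g x v w) (cov_deriv_along g (\<lambda>x. x) u (\<lambda>_. z) x)"
      by (rule M.metric_compatible_along[OF smooth_on_bounded_linear[OF bounded_linear_ident M.open_S]
            _ M.smooth_christoffel smooth_on_const[OF M.open_S] x]) simp
    also have "\<dots> = g x (dd (\<lambda>x. christoffel g x v w) u x + christoffel g x u (christoffel g x v w)) z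
        + g x (christoffel g x v w) (christoffel g x u z)"
      by (simp add: cov_deriv_along_def)
    also have "g x (christoffel g x v w) (christoffel g x u z)
        = G (\<Phi> x) (Nabla v (dd \<Phi> w) x) (Nabla u (dd \<Phi> z) x) - G (\<Phi> x) (sff x v w) (sff x u z)"
      unfolding split
      by (simp add: SP.bilin_simps isometric[OF x] sff_normal[OF x] SP.sym[of "dd \<Phi> _ x" "sff x _ _"])
    finally show ?thesis by simp
  qed
  show ?thesis
    unfolding N.riem_along[OF smooth image x, symmetric] M.riem_eq[OF x]
    by (simp add: SP.bilin_simps sp.bilin_simps e)
qed

lemma gauss_sectional:
  assumes x: "x \<in> W"
  shows "g x (M.riem x u v v) u
    = G (\<Phi> x) (N.riem (\<Phi> x) (dd \<Phi> u x) (dd \<Phi> v x) (dd \<Phi> v x)) (dd \<Phi> u x)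
      + G (\<Phi> x) (sff x u u) (sff x v v) - G (\<Phi> x) (sff x u v) (sff x u v)"
  using gauss_equation[OF x, of u v v u] N.sym[OF image_in[OF x], of "sff x v v"]
  by (simp add: sff_commute[OF x, of v u])

end

section \<open>Charts\<close>

lemma chart_inv_left: "is_chart c \<Longrightarrow> p \<in> fst c \<Longrightarrow> chart_inv c (snd c p) = p"
  by (auto simp: is_chart_def homeomorphism_def)

lemma chart_inv_right: "is_chart c \<Longrightarrow> y \<in> chart_image c \<Longrightarrow> snd c (chart_inv c y) = y"
  by (auto simp: is_chart_def homeomorphism_def)

lemma chart_inv_in: "is_chart c \<Longrightarrow> y \<in> chart_image c \<Longrightarrow> chart_inv c y \<in> fst c"
  by (auto simp: is_chart_def homeomorphism_def)

lemma chart_image_in: "p \<in> fst c \<Longrightarrow> snd c p \<in> chart_image c"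
  by (simp add: chart_image_def)

lemma image_chart_Int:
  "is_chart c \<Longrightarrow> snd c ` (fst c \<inter> U) = {y \<in> chart_image c. chart_inv c y \<in> U}"
  by (auto simp: chart_inv_left chart_image_in)
    (metis IntI chart_inv_in chart_inv_right imageI)

lemma open_image_chart_Int:
  assumes c: "is_chart c" and U: "open U"
  shows "open (snd c ` (fst c \<inter> U))"
proof -
  have "continuous_on (chart_image c) (chart_inv c)" "open (chart_image c)"
    using c by (auto simp: is_chart_def homeomorphism_def)
  then have "open (chart_image c \<inter> chart_inv c -` U)" using U by (rule continuous_open_preimage)
  then show ?thesis unfolding image_chart_Int[OF c] by (simp add: vimage_def Int_def)
qed

definition transition :: "('m, 'e) chart \<Rightarrow> ('m, 'e) chart \<Rightarrow> 'e \<Rightarrow> 'e" where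
  "transition c d y = snd d (chart_inv c y)"

lemma chart_change_eq: "chart_change c d y u = dd (transition c d) u y"
  by (simp add: chart_change_def transition_def[abs_def] o_def)

locale manifold =
  fixes A :: "('m::{t2_space, second_countable_topology}, 'e::euclidean_space) atlas"
  assumes smooth_manifold: "smooth_manifold A"
begin

lemma is_chart: "c \<in> A \<Longrightarrow> is_chart c"
  using smooth_manifold by (simp add: smooth_manifold_def)

lemmas inv_left = chart_inv_left[OF is_chart]
lemmas inv_right = chart_inv_right[OF is_chart]
lemmas inv_in = chart_inv_in[OF is_chart]

lemma chart_at: "chart_at A p \<in> A" "p \<in> fst (chart_at A p)"
proof -
  have "p \<in> (\<Union>c\<in>A. fst c)" using smooth_manifold by (simp add: smooth_manifold_def)
  then have "\<exists>c. c \<in> A \<and> p \<in> fst c" by auto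
  from someI_ex[OF this] show "chart_at A p \<in> A" "p \<in> fst (chart_at A p)"
    by (auto simp: chart_at_def)
qed

lemma open_dom: "c \<in> A \<Longrightarrow> open (fst c)"
  using is_chart by (auto simp: is_chart_def)

lemma open_image: "c \<in> A \<Longrightarrow> open (chart_image c)"
  using is_chart by (auto simp: is_chart_def)

lemma continuous_chart: "c \<in> A \<Longrightarrow> continuous_on (fst c) (snd c)"
  using is_chart by (auto simp: is_chart_def homeomorphism_def)

lemma smooth_transition:
  "c \<in> A \<Longrightarrow> d \<in> A \<Longrightarrow> smooth_on (snd c ` (fst c \<inter> fst d)) (transition c d)"
  using smooth_manifold by (auto simp: smooth_manifold_def transition_def[abs_def] o_def)

lemma differentiable_transition:
  "c \<in> A \<Longrightarrow> d \<in> A \<Longrightarrow> p \<in> fst c \<Longrightarrow> p \<in> fst d \<Longrightarrow> transition c d differentiable (at (snd c p))"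
  using smooth_on_differentiable[OF smooth_transition] by auto

lemma transition_apply: "c \<in> A \<Longrightarrow> p \<in> fst c \<Longrightarrow> transition c d (snd c p) = snd d p"
  by (simp add: transition_def inv_left)

lemma chart_change_linear:
  "c \<in> A \<Longrightarrow> d \<in> A \<Longrightarrow> p \<in> fst c \<Longrightarrow> p \<in> fst d \<Longrightarrow> linear (chart_change c d (snd c p))"
  using linear_dd[OF differentiable_transition] by (simp add: chart_change_eq[abs_def])

text \<open>The chain rule across two charts, with values of \<open>F\<close> in any normed space:
  it is applied to real functions, to chart maps (which yields the cocycle rule
  \<open>chart_change_trans\<close>) and to coordinate expressions of maps between
  manifolds.\<close>

lemma dd_chart_change:
  fixes F :: "'m \<Rightarrow> 'b::real_normed_vector"
  assumes cd: "c \<in> A" "d \<in> A" "p \<in> fst c" "p \<in> fst d"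
    and F: "(\<lambda>y. F (chart_inv d y)) differentiable (at (snd d p))"
  shows "dd (\<lambda>y. F (chart_inv d y)) (chart_change c d (snd c p) u) (snd d p)
    = dd (\<lambda>y. F (chart_inv c y)) u (snd c p)"
    and "(\<lambda>y. F (chart_inv c y)) differentiable (at (snd c p))"
proof -
  let ?U = "snd c ` (fst c \<inter> fst d)"
  have U: "open ?U" "snd c p \<in> ?U"
    using smooth_on_open[OF smooth_transition] cd by auto
  have F': "(\<lambda>y. F (chart_inv d y)) differentiable (at (transition c d (snd c p)))"
    using F cd by (simp add: transition_apply)
  have eq: "F (chart_inv d (transition c d y)) = F (chart_inv c y)" if "y \<in> ?U" for y
    using that cd by (auto simp: transition_apply inv_left)
  have "dd (\<lambda>y. F (chart_inv d (transition c d y))) u (snd c p) = dd (\<lambda>y. F (chart_inv c y)) u (snd c p)"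
    using U eq by (rule dd_cong_open)
  then show "dd (\<lambda>y. F (chart_inv d y)) (chart_change c d (snd c p) u) (snd d p)
    = dd (\<lambda>y. F (chart_inv c y)) u (snd c p)"
    using dd_compose[OF differentiable_transition[OF cd] F'] cd by (simp add: transition_apply chart_change_eq)
  show "(\<lambda>y. F (chart_inv c y)) differentiable (at (snd c p))"
    using differentiable_cong_open[OF U eq differentiable_chain_at[OF differentiable_transition[OF cd] F', unfolded o_def]] .
qed

lemma chart_change_trans:
  assumes "c \<in> A" "d \<in> A" "k \<in> A" "p \<in> fst c" "p \<in> fst d" "p \<in> fst k"
  shows "chart_change d k (snd d p) (chart_change c d (snd c p) u) = chart_change c k (snd c p) u"
  using dd_chart_change(1)[of c d p "snd k" u] differentiable_transition[of d k p] assms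
  by (simp add: chart_change_eq[of d k] chart_change_eq[of c k] transition_def[abs_def])

lemma chart_change_refl:
  assumes "c \<in> A" "p \<in> fst c"
  shows "chart_change c c (snd c p) u = u"
proof -
  have "dd (transition c c) u (snd c p) = dd (\<lambda>y. y) u (snd c p)"
    by (rule dd_cong_open[OF open_image[OF assms(1)] chart_image_in[OF assms(2)]])
      (simp add: transition_def inv_right[OF assms(1)])
  then show ?thesis by (simp add: chart_change_eq)
qed

text \<open>Differentiating \<open>vf_apply\<close> once more requires its values in one fixed
  chart, while its definition jumps between preferred charts.\<close>

lemma vf_apply_chart:
  assumes "c \<in> A" "p \<in> fst c" and "(\<lambda>y. \<psi> (chart_inv c y)) differentiable (at (snd c p))"
  shows "vf_apply A X \<psi> p = dd (\<lambda>y. \<psi> (chart_inv c y)) (field_in A c X (snd c p)) (snd c p)"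
  using dd_chart_change(1)[OF chart_at(1) assms(1) chart_at(2) assms(2,3), of "X p"] assms
  by (simp add: vf_apply_def Let_def o_def field_in_def inv_left)

end


section \<open>Riemannian manifolds\<close>

lemma linear_comp_bilinear:
  "bilinear B \<Longrightarrow> linear L \<Longrightarrow> bilinear (\<lambda>u v. B (L u) (L v))"
  by (auto simp: bilinear_def intro: linear_compose[of L, unfolded o_def])

locale riemannian =
  fixes A :: "('m::{t2_space, second_countable_topology}, 'e::euclidean_space) atlas"
    and g :: "'m \<Rightarrow> 'e \<Rightarrow> 'e \<Rightarrow> real"
  assumes riemannian: "riemannian_manifold A g"
begin

sublocale manifold A
  using riemannian by unfold_locales (simp add: riemannian_manifold_def)

lemma scalar_product: "scalar_product (g p)"
  using riemannian by (simp add: riemannian_manifold_def scalar_product_def)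

lemma metric_in_eq:
  "c \<in> A \<Longrightarrow> p \<in> fst c \<Longrightarrow> metric_in A g c (snd c p) u v
    = g p (chart_change c (chart_at A p) (snd c p) u) (chart_change c (chart_at A p) (snd c p) v)"
  by (simp add: metric_in_def Let_def inv_left)

lemma metric_in_chart_at: "metric_in A g (chart_at A p) (snd (chart_at A p) p) = g p"
  by (simp add: fun_eq_iff metric_in_eq[OF chart_at] chart_change_refl[OF chart_at])

lemma local_metric:
  assumes c: "c \<in> A"
  shows "local_metric (chart_image c) (metric_in A g c)"
proof
  show "open (chart_image c)" using open_image[OF c] .
  show "smooth_on (chart_image c) (\<lambda>y. metric_in A g c y u v)" for u v
    using riemannian c by (simp add: riemannian_manifold_def)
  fix y assume y: "y \<in> chart_image c"
  then obtain p where p: "p \<in> fst c" "y = snd c p" by (auto simp: chart_image_def)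
  interpret scalar_product "g p" using scalar_product .
  let ?L = "chart_change c (chart_at A p) y"
  have L: "linear ?L" unfolding p(2) using chart_change_linear[OF c chart_at(1) p(1) chart_at(2)] .
  have eq: "metric_in A g c y u v = g p (?L u) (?L v)" for u v
    using metric_in_eq[OF c p(1)] p by simp
  then have "metric_in A g c y = (\<lambda>u v. g p (?L u) (?L v))" by (simp add: fun_eq_iff)
  then show "bilinear (metric_in A g c y)"
    using linear_comp_bilinear[OF bilinear L] by simp
  show "metric_in A g c y u v = metric_in A g c y v u" for u v
    unfolding eq by (rule sym)
  show "metric_in A g c y u u > 0" if "u \<noteq> 0" for u
  proof -
    \<comment> \<open>The change back to \<open>c\<close> inverts \<open>?L\<close>, so
      \<open>?L u\<close> is nonzero and positivity carries over.\<close>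
    have "chart_change (chart_at A p) c (snd (chart_at A p) p) (?L u) = u"
      using chart_change_trans[OF c chart_at(1) c p(1) chart_at(2) p(1)] chart_change_refl[OF c p(1)] p
      by simp
    then have "?L u \<noteq> 0"
      using that linear_0[OF chart_change_linear[OF chart_at(1) c chart_at(2) p(1)]] by metis
    then show ?thesis unfolding eq by (rule pos)
  qed
qed

text \<open>An orthonormal frame found in one chart \<open>c\<close> is translated at each point
  into the preferred chart of that point. The resulting components may jump, but read in any chart
  \<open>k\<close> they are \<open>X i\<close> transported by the derivative of
  \<open>transition c k\<close>, which is smooth.\<close>

lemma frame_exists: "\<exists>U e. p \<in> U \<and> orthonormal_frame_on A g U e"
proof -
  define c where "c = chart_at A p"
  have c: "c \<in> A" "p \<in> fst c" using chart_at by (auto simp: c_def)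
  interpret L: local_metric "chart_image c" "metric_in A g c" using local_metric[OF c(1)] .
  obtain U X where U: "snd c p \<in> U" "U \<subseteq> chart_image c" "open U"
    and X: "\<And>i. i < DIM('e) \<Longrightarrow> smooth_on U (X i)"
    and orth: "\<And>y. y \<in> U \<Longrightarrow> scalar_product.orthonormal (metric_in A g c y) DIM('e) (\<lambda>i. X i y)"
    by (rule L.frame[OF chart_image_in[OF c(2)]]) blast
  define e where "e i q = chart_change c (chart_at A q) (snd c q) (X i (snd c q))" for i q
  define U' where "U' = fst c \<inter> snd c -` U"
  have U': "open U'"
    unfolding U'_def by (rule continuous_open_preimage[OF continuous_chart[OF c(1)] open_dom[OF c(1)] U(3)])
  have "smooth_on (snd k ` (fst k \<inter> U')) (field_in A k (e i))" if i: "i < DIM('e)" and k: "k \<in> A" for i k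
  proof (rule smooth_on_cong)
    let ?W = "snd k ` (fst k \<inter> U')"
    let ?V = "U \<inter> snd c ` (fst c \<inter> fst k)"
    have W: "open ?W" using open_image_chart_Int[OF is_chart[OF k] U'] .
    have transition: "smooth_on ?W (transition k c)"
      by (rule smooth_on_subset[OF smooth_transition[OF k c(1)] W]) (auto simp: U'_def)
    have im: "transition k c ` ?W \<subseteq> ?V"
      using c(1) k by (auto simp: U'_def transition_apply)
    have V: "open ?V" using U(3) open_image_chart_Int[OF is_chart[OF c(1)] open_dom[OF k]] by auto
    have "smooth_on ?V (\<lambda>z. dd (transition c k) (X i z) z)"
      by (rule smooth_on_dd_field[OF smooth_on_subset[OF smooth_transition[OF c(1) k] V]
            smooth_on_subset[OF X[OF i] V]]) auto
    from smooth_on_compose[OF this transition im]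
    show "smooth_on ?W (\<lambda>y. dd (transition c k) (X i (transition k c y)) (transition k c y))" .
    fix y assume "y \<in> ?W"
    then obtain q where q: "q \<in> fst k" "q \<in> fst c" "y = snd k q" by (auto simp: U'_def)
    show "dd (transition c k) (X i (transition k c y)) (transition k c y) = field_in A k (e i) y"
      using chart_change_trans[OF c(1) chart_at(1) k q(2) chart_at(2) q(1)]
      by (simp add: q field_in_def Let_def inv_left[OF k] transition_apply[OF k] e_def chart_change_eq[of c k])
  qed
  moreover have "g q (e i q) (e j q) = (if i = j then 1 else 0)"
    if q: "q \<in> U'" and ij: "i < DIM('e)" "j < DIM('e)" for q i j
  proof -
    have q': "q \<in> fst c" "snd c q \<in> U" using q by (auto simp: U'_def)
    then have "snd c q \<in> chart_image c" using U by auto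
    then interpret scalar_product "metric_in A g c (snd c q)" by (rule L.scalar_product)
    show ?thesis
      using orth[OF q'(2)] ij by (simp add: orthonormal_def e_def metric_in_eq[OF c(1) q'(1), symmetric])
  qed
  ultimately have "orthonormal_frame_on A g U' e"
    using U' by (simp add: orthonormal_frame_on_def)
  then show ?thesis using c U by (intro exI[of _ U'] exI[of _ e]) (auto simp: U'_def)
qed

text \<open>Frames exist, so the choice operator in \<open>local_frame\<close> picks a genuine
  one.\<close>

lemma local_frame: "\<exists>U. p \<in> U \<and> orthonormal_frame_on A g U (local_frame A g p)"
proof -
  have "\<exists>e U. p \<in> U \<and> orthonormal_frame_on A g U e" using frame_exists by blast
  from someI_ex[OF this] show ?thesis by (simp only: local_frame_def)
qed

lemma orthonormal_local_frame:
  "scalar_product.orthonormal (g p) DIM('e) (\<lambda>i. local_frame A g p i p)"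
  using local_frame[of p]
  by (auto simp: orthonormal_frame_on_def scalar_product.orthonormal_def[OF scalar_product])

text \<open>Whatever basis of the plane the choice operator picks, \<open>sect_span_eq\<close> moves
  the value to the given one.\<close>

lemma sectional_curvature_eq:
  assumes uv: "u \<noteq> v" "independent {u, v}"
  shows "sectional_curvature A g p (span {u, v})
    = local_metric.sect (metric_in A g (chart_at A p)) (snd (chart_at A p) p) u v"
proof -
  define c where "c = chart_at A p"
  have c: "c \<in> A" "p \<in> fst c" using chart_at by (auto simp: c_def)
  interpret L: local_metric "chart_image c" "metric_in A g c" using local_metric[OF c(1)] .
  define b where "b = (SOME (u', v'). u' \<noteq> v' \<and> independent {u', v'} \<and> span {u', v'} = span {u, v})"
  have "(\<lambda>(u', v'). u' \<noteq> v' \<and> independent {u', v'} \<and> span {u', v'} = span {u, v}) b"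
    unfolding b_def by (rule someI[of _ "(u, v)"]) (use uv in simp)
  then obtain u' v' where b: "b = (u', v')" and
    uv': "u' \<noteq> v'" "independent {u', v'}" "span {u', v'} = span {u, v}" by (cases b) auto
  have "sectional_curvature A g p (span {u, v}) = L.sect (snd c p) u' v'"
    unfolding sectional_curvature_def b_def[symmetric] b L.sect_def
    using metric_in_chart_at[of p]
    by (simp add: curvature_tensor_def L.riem_def c_def[symmetric])
  also have "\<dots> = L.sect (snd c p) u v"
    by (rule L.sect_span_eq[OF chart_image_in[OF c(2)] uv(2,1) uv'(2,1,3)])
  finally show ?thesis by (simp add: c_def)
qed

end


section \<open>Isometric immersions\<close>

locale isometry = M: riemannian A g + N: riemannian A' g'
  for A :: "('m::{t2_space, second_countable_topology}, 'e::euclidean_space) atlas" and g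
    and A' :: "('n::{t2_space, second_countable_topology}, 'd::euclidean_space) atlas" and g' +
  fixes \<phi> :: "'m \<Rightarrow> 'n"
  assumes immersion: "isometric_immersion A g A' g' \<phi>"
begin

lemma smooth_map:
  assumes "c \<in> A" "d \<in> A'"
  shows "smooth_on (snd c ` (fst c \<inter> \<phi> -` fst d)) (\<lambda>y. snd d (\<phi> (chart_inv c y)))"
  using immersion assms by (auto simp: isometric_immersion_def smooth_map_def o_def)

lemma isometric:
  "g' (\<phi> p) (differential A A' \<phi> p u) (differential A A' \<phi> p v) = g p u v"
  using immersion by (simp add: isometric_immersion_def)

text \<open>Moves \<open>differential\<close> from the preferred charts on both sides to arbitrary
  ones, where the smoothness of \<open>\<phi>\<close> is available.\<close>

lemma differential_eq:
  assumes c: "c \<in> A" "p \<in> fst c" and d: "d \<in> A'" "\<phi> p \<in> fst d"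
  shows "chart_change (chart_at A' (\<phi> p)) d (snd (chart_at A' (\<phi> p)) (\<phi> p))
      (differential A A' \<phi> p (chart_change c (chart_at A p) (snd c p) u))
    = dd (\<lambda>y. snd d (\<phi> (chart_inv c y))) u (snd c p)"
proof -
  define c' where "c' = chart_at A p"
  define d' where "d' = chart_at A' (\<phi> p)"
  have c': "c' \<in> A" "p \<in> fst c'" using M.chart_at by (auto simp: c'_def)
  have d': "d' \<in> A'" "\<phi> p \<in> fst d'" using N.chart_at by (auto simp: d'_def)
  let ?F = "\<lambda>q. snd d' (\<phi> q)"
  have diff: "(\<lambda>y. snd k (\<phi> (chart_inv b y))) differentiable (at (snd b p))"
    if "b \<in> A" "p \<in> fst b" "k \<in> A'" "\<phi> p \<in> fst k" for b k
    using smooth_on_differentiable[OF smooth_map[OF that(1,3)], of "snd b p"] that by auto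
  have "differential A A' \<phi> p (chart_change c c' (snd c p) u) = dd (\<lambda>y. ?F (chart_inv c y)) u (snd c p)"
    using M.dd_chart_change(1)[OF c(1) c'(1) c(2) c'(2) diff[OF c' d'], of u]
    by (simp add: differential_def Let_def c'_def[symmetric] d'_def[symmetric] o_def)
  moreover have "chart_change d' d (snd d' (\<phi> p)) (dd (\<lambda>y. ?F (chart_inv c y)) u (snd c p))
      = dd (\<lambda>y. snd d (\<phi> (chart_inv c y))) u (snd c p)"
  proof -
    let ?U = "snd c ` (fst c \<inter> \<phi> -` fst d')"
    have "dd (\<lambda>y. transition d' d (?F (chart_inv c y))) u (snd c p) = dd (\<lambda>y. snd d (\<phi> (chart_inv c y))) u (snd c p)"
    proof (rule dd_cong_open)
      show "open ?U" using smooth_on_open[OF smooth_map[OF c(1) d'(1)]] .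
      show "snd c p \<in> ?U" using c d' by auto
      show "transition d' d (?F (chart_inv c y)) = snd d (\<phi> (chart_inv c y))" if "y \<in> ?U" for y
        using that by (auto simp: M.inv_left[OF c(1)] N.transition_apply[OF d'(1)])
    qed
    moreover have "transition d' d differentiable (at (snd d' (\<phi> (chart_inv c (snd c p)))))"
      using N.differentiable_transition[OF d'(1) d(1) d'(2) d(2)] by (simp add: M.inv_left[OF c])
    note dd_compose[OF diff[OF c d'] this, of u]
    ultimately show ?thesis by (simp add: chart_change_eq M.inv_left[OF c])
  qed
  ultimately show ?thesis by (simp add: c'_def d'_def)
qed

text \<open>Makes the coordinate results, in particular the Gauss equation, available for every pair
  of charts.\<close>

lemma local_isometry:
  assumes c: "c \<in> A" and d: "d \<in> A'"
  shows "local_isometry (snd c ` (fst c \<inter> \<phi> -` fst d)) (metric_in A g c)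
    (chart_image d) (metric_in A' g' d) (\<lambda>y. snd d (\<phi> (chart_inv c y)))"
proof -
  let ?W = "snd c ` (fst c \<inter> \<phi> -` fst d)"
  have W: "open ?W" using smooth_on_open[OF smooth_map[OF c d]] .
  have sub: "?W \<subseteq> chart_image c" by (auto simp: chart_image_def)
  interpret L: local_metric "chart_image c" "metric_in A g c" using M.local_metric[OF c] .
  interpret N': local_metric "chart_image d" "metric_in A' g' d" using N.local_metric[OF d] .
  show ?thesis
  proof
    show "open ?W" by (rule W)
    show "smooth_on ?W (\<lambda>y. metric_in A g c y u v)" for u v
      by (rule smooth_on_subset[OF L.smooth W sub])
    show "smooth_on ?W (\<lambda>y. snd d (\<phi> (chart_inv c y)))" by (rule smooth_map[OF c d])
    show "(\<lambda>y. snd d (\<phi> (chart_inv c y))) ` ?W \<subseteq> chart_image d"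
      by (auto simp: M.inv_left[OF c] chart_image_def)
  next
    fix y u v assume "y \<in> ?W"
    then obtain p where p: "p \<in> fst c" "\<phi> p \<in> fst d" "y = snd c p" by auto
    let ?c = "chart_at A p" and ?d = "chart_at A' (\<phi> p)"
    let ?D = "\<lambda>u. differential A A' \<phi> p (chart_change c ?c (snd c p) u)"
    have inverse: "chart_change d ?d (snd d (\<phi> p)) (chart_change ?d d (snd ?d (\<phi> p)) w) = w" for w
      using N.chart_change_trans[OF N.chart_at(1) d N.chart_at(1) N.chart_at(2) p(2) N.chart_at(2)]
        N.chart_change_refl[OF N.chart_at] by simp
    have "metric_in A' g' d (snd d (\<phi> p)) (chart_change ?d d (snd ?d (\<phi> p)) (?D u))
        (chart_change ?d d (snd ?d (\<phi> p)) (?D v)) = g' (\<phi> p) (?D u) (?D v)"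
      by (simp add: N.metric_in_eq[OF d p(2)] inverse)
    also have "\<dots> = metric_in A g c (snd c p) u v"
      by (simp add: isometric M.metric_in_eq[OF c p(1)])
    finally show "metric_in A g c y u v = metric_in A' g' d (snd d (\<phi> (chart_inv c y)))
        (dd (\<lambda>y. snd d (\<phi> (chart_inv c y))) u y) (dd (\<lambda>y. snd d (\<phi> (chart_inv c y))) v y)"
      by (simp add: p(3) M.inv_left[OF c p(1)] differential_eq[OF c p(1) d p(2)])
  qed (use sub L.bilinear L.sym L.pos in \<open>simp_all add: subset_iff\<close>)
qed

text \<open>The bound from \<open>sect_bounded_below\<close> covers all planes of the ambient
  tangent space at \<open>\<phi> p\<close>, hence those in the image of the differential.\<close>

lemma inf_sectional_le:
  assumes P: "subspace P" "dim P = 2" "P \<subseteq> range (differential A A' \<phi> p)"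
  shows "inf_sectional A A' g' \<phi> p \<le> sectional_curvature A' g' (\<phi> p) P"
  unfolding inf_sectional_def
proof (rule cInf_lower)
  define d where "d = chart_at A' (\<phi> p)"
  have d: "d \<in> A'" "\<phi> p \<in> fst d" using N.chart_at by (auto simp: d_def)
  interpret N': local_metric "chart_image d" "metric_in A' g' d" using N.local_metric[OF d(1)] .
  obtain K where K: "\<And>u v. independent {u, v} \<Longrightarrow> u \<noteq> v \<Longrightarrow> K \<le> N'.sect (snd d (\<phi> p)) u v"
    using N'.sect_bounded_below[OF chart_image_in[OF d(2)]] by blast
  show "bdd_below {sectional_curvature A' g' (\<phi> p) P | P.
      subspace P \<and> dim P = 2 \<and> P \<subseteq> range (differential A A' \<phi> p)}"
  proof (rule bdd_belowI)
    fix x assume "x \<in> {sectional_curvature A' g' (\<phi> p) P | P.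
      subspace P \<and> dim P = 2 \<and> P \<subseteq> range (differential A A' \<phi> p)}"
    then obtain P where P: "x = sectional_curvature A' g' (\<phi> p) P" "subspace P" "dim P = 2" by auto
    obtain B where B: "B \<subseteq> P" "independent B" "P \<subseteq> span B" "card B = dim P"
      using basis_exists by blast
    then obtain u v where uv: "B = {u, v}" "u \<noteq> v" using P by (auto simp: card_2_iff)
    have "span B = P" using B P(2) span_minimal by blast
    then show "K \<le> x"
      using N.sectional_curvature_eq[OF uv(2), of "\<phi> p"] K[of u v] uv B P by (simp add: d_def)
  qed
qed (use P in blast)

text \<open>The right-hand side is the sectional curvature of the plane spanned by \<open>e j\<close> and \<open>e s\<close>.\<close>

lemma chen_curvature:
  fixes e :: "nat \<Rightarrow> 'e"
  assumes e: "scalar_product.orthonormal (g p) DIM('e) e"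
    and js: "j < DIM('e)" "s < DIM('e)" "j \<noteq> s"
  shows "(real DIM('e))\<^sup>2 / (2 * (real DIM('e) - 1)) * squared_mean_curvature A g A' g' \<phi> p
      - squared_norm_sff A g A' g' \<phi> p / 2 + inf_sectional A A' g' \<phi> p
    \<le> g p (curvature_tensor A g p (e j) (e s) (e s)) (e j)"
proof -
  let ?n = "DIM('e)"
  define c where "c = chart_at A p"
  define d where "d = chart_at A' (\<phi> p)"
  define y where "y = snd c p"
  define \<Phi> where "\<Phi> = (\<lambda>y. snd d (\<phi> (chart_inv c y)))"
  define W where "W = snd c ` (fst c \<inter> \<phi> -` fst d)"
  have c: "c \<in> A" "p \<in> fst c" using M.chart_at by (auto simp: c_def)
  have d: "d \<in> A'" "\<phi> p \<in> fst d" using N.chart_at by (auto simp: d_def)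
  interpret I: local_isometry W "metric_in A g c" "chart_image d" "metric_in A' g' d" \<Phi>
    using local_isometry[OF c(1) d(1)] by (simp add: W_def \<Phi>_def)
  interpret g: scalar_product "g p" using M.scalar_product .
  interpret g': scalar_product "g' (\<phi> p)" using N.scalar_product .
  have yW: "y \<in> W" using c d by (auto simp: y_def W_def)
  have \<Phi>y: "\<Phi> y = snd d (\<phi> p)" by (simp add: \<Phi>_def y_def M.inv_left[OF c])
  have gM: "metric_in A g c y = g p" using M.metric_in_chart_at by (simp add: c_def y_def)
  have gN: "metric_in A' g' d (\<Phi> y) = g' (\<phi> p)" using N.metric_in_chart_at \<Phi>y by (simp add: d_def)
  define h where "h = second_fundamental_form A g A' g' \<phi> p"
  have \<Phi>: "snd d \<circ> \<phi> \<circ> chart_inv c = \<Phi>" by (simp add: fun_eq_iff \<Phi>_def)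
  have h: "h = I.sff y"
    by (simp add: fun_eq_iff h_def second_fundamental_form_def Let_def I.sff_def cov_deriv_def
        c_def[symmetric] d_def[symmetric] y_def[symmetric] \<Phi>)
  have bh: "bilinear h" unfolding h by (rule I.bilinear_sff[OF yW])
  have sh: "h u v = h v u" for u v unfolding h by (rule I.sff_commute[OF yW])
  have D: "differential A A' \<phi> p = (\<lambda>u. dd \<Phi> u y)"
    by (simp add: fun_eq_iff differential_def Let_def c_def[symmetric] d_def[symmetric] y_def \<Phi>_def o_def)
  \<comment> \<open>\<open>e'\<close> is the frame in the definitions of the mean curvature and of
    the norm of h; both quantities are now transferred to the given basis \<open>e\<close>.\<close>
  define e' where "e' k = local_frame A g p k p" for k
  have e': "g.orthonormal ?n e'"
    using M.orthonormal_local_frame[of p] by (simp add: e'_def[abs_def])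
  define T where "T = (\<Sum>k<?n. h (e k) (e k))"
  have H: "mean_curvature_vector A g A' g' \<phi> p = (1 / real ?n) *\<^sub>R T"
    using g.trace_frame_independent[OF e e' bh]
    by (simp add: mean_curvature_vector_def Let_def h_def[symmetric] e'_def T_def)
  have n0: "real ?n > 0" by simp
  have H2: "(real ?n)\<^sup>2 * squared_mean_curvature A g A' g' \<phi> p = g' (\<phi> p) T T"
    using n0 by (simp add: squared_mean_curvature_def H g'.bilin_simps power2_eq_square)
  have lh: "linear (h u)" "linear (\<lambda>u. h u v)" for u v using bh by (auto simp: bilinear_def)
  have bq1: "bilinear (\<lambda>u v. g' (\<phi> p) (h u w) (h v w))" for w
    by (rule linear_comp_bilinear[OF g'.bilinear lh(2)])
  have bq2: "bilinear (\<lambda>u v. g' (\<phi> p) (h w u) (h w v))" for w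
    by (rule linear_comp_bilinear[OF g'.bilinear lh(1)])
  \<comment> \<open>A double trace: one index passes from \<open>e'\<close> to \<open>e\<close>
    while the other is held fixed, then the roles are exchanged.\<close>
  have "squared_norm_sff A g A' g' \<phi> p = (\<Sum>i<?n. \<Sum>k<?n. g' (\<phi> p) (h (e' i) (e' k)) (h (e' i) (e' k)))"
    by (simp add: squared_norm_sff_def Let_def h_def e'_def)
  also have "\<dots> = (\<Sum>i<?n. \<Sum>k<?n. g' (\<phi> p) (h (e' i) (e k)) (h (e' i) (e k)))"
    by (intro sum.cong refl g.trace_frame_independent[OF e' e bq2])
  also have "\<dots> = (\<Sum>k<?n. \<Sum>i<?n. g' (\<phi> p) (h (e' i) (e k)) (h (e' i) (e k)))"
    by (rule sum.swap)
  also have "\<dots> = (\<Sum>k<?n. \<Sum>i<?n. g' (\<phi> p) (h (e i) (e k)) (h (e i) (e k)))"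
    by (intro sum.cong refl g.trace_frame_independent[OF e' e bq1])
  also have "\<dots> = (\<Sum>i<?n. \<Sum>k<?n. g' (\<phi> p) (h (e i) (e k)) (h (e i) (e k)))"
    by (rule sum.swap)
  finally have h2: "squared_norm_sff A g A' g' \<phi> p
      = (\<Sum>i<?n. \<Sum>k<?n. g' (\<phi> p) (h (e i) (e k)) (h (e i) (e k)))" .
  have chen: "g' (\<phi> p) T T / (real ?n - 1) / 2 - squared_norm_sff A g A' g' \<phi> p / 2
    \<le> g' (\<phi> p) (h (e j) (e j)) (h (e s) (e s)) - g' (\<phi> p) (h (e j) (e s)) (h (e j) (e s))"
    unfolding h2 T_def by (rule g'.chen_inequality[OF js]) (rule sh)
  let ?D = "differential A A' \<phi> p"
  have o: "g p (e j) (e j) = 1" "g p (e s) (e s) = 1" "g p (e j) (e s) = 0"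
    using e js by (auto simp: g.orthonormal_def)
  have Do: "g' (\<phi> p) (?D (e j)) (?D (e j)) = 1" "g' (\<phi> p) (?D (e s)) (?D (e s)) = 1"
    "g' (\<phi> p) (?D (e j)) (?D (e s)) = 0"
    using o by (auto simp: isometric)
  \<comment> \<open>Indexing the pair by 0 and 1 makes the independence of orthonormal families
    applicable.\<close>
  have orth2: "g'.orthonormal 2 (\<lambda>i. if i = 0 then ?D (e j) else ?D (e s))"
    using Do g'.sym[of "?D (e s)" "?D (e j)"] by (auto simp: g'.orthonormal_def)
  have lt2: "{..<2::nat} = {0, 1}" by auto
  have indep: "independent {?D (e j), ?D (e s)}"
    using g'.orthonormal_independent[OF orth2] by (simp add: lt2 insert_commute)
  have ne: "?D (e j) \<noteq> ?D (e s)" using Do by auto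
  let ?P = "span {?D (e j), ?D (e s)}"
  have lD: "linear ?D" unfolding D by (rule I.linear_dd_\<Phi>[OF yW])
  have "?P \<subseteq> range ?D"
    by (rule span_minimal) (auto intro: linear_subspace_image[OF lD subspace_UNIV])
  moreover have "dim ?P = 2" using indep ne by (simp add: dim_eq_card_independent)
  ultimately have "inf_sectional A A' g' \<phi> p \<le> sectional_curvature A' g' (\<phi> p) ?P"
    by (intro inf_sectional_le) auto
  also have "\<dots> = I.N.sect (\<Phi> y) (?D (e j)) (?D (e s))"
    using N.sectional_curvature_eq[OF ne indep, of "\<phi> p"] \<Phi>y by (simp add: d_def)
  \<comment> \<open>For orthonormal vectors the denominator of \<open>sect\<close> is 1.\<close>
  also have "\<dots> = g' (\<phi> p) (I.N.riem (\<Phi> y) (?D (e j)) (?D (e s)) (?D (e s))) (?D (e j))"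
    by (simp add: I.N.sect_def gN Do)
  finally have inf: "inf_sectional A A' g' \<phi> p
    \<le> g' (\<phi> p) (I.N.riem (\<Phi> y) (?D (e j)) (?D (e s)) (?D (e s))) (?D (e j))" .
  have "g p (curvature_tensor A g p (e j) (e s) (e s)) (e j)
      = metric_in A g c y (I.M.riem y (e j) (e s) (e s)) (e j)"
    by (simp add: curvature_tensor_def Let_def I.M.riem_def gM c_def[symmetric] y_def[symmetric])
  also have "\<dots> = g' (\<phi> p) (I.N.riem (\<Phi> y) (?D (e j)) (?D (e s)) (?D (e s))) (?D (e j))
      + g' (\<phi> p) (h (e j) (e j)) (h (e s) (e s)) - g' (\<phi> p) (h (e j) (e s)) (h (e j) (e s))"
    unfolding I.gauss_sectional[OF yW] h D gN ..
  finally have K: "g p (curvature_tensor A g p (e j) (e s) (e s)) (e j)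
    = g' (\<phi> p) (I.N.riem (\<Phi> y) (?D (e j)) (?D (e s)) (?D (e s))) (?D (e j))
      + g' (\<phi> p) (h (e j) (e j)) (h (e s) (e s)) - g' (\<phi> p) (h (e j) (e s)) (h (e j) (e s))" .
  have "(real ?n)\<^sup>2 / (2 * (real ?n - 1)) * squared_mean_curvature A g A' g' \<phi> p
      = g' (\<phi> p) T T / (real ?n - 1) / 2"
    unfolding H2[symmetric] by (simp add: field_simps)
  then show ?thesis using chen inf K by linarith
qed

end

section \<open>Warped metrics in coordinates\<close>

lemma dd_Pair:
  assumes "f differentiable (at x)" "g differentiable (at x)"
  shows "dd (\<lambda>x. (f x, g x)) v x = (dd f v x, dd g v x)"
  using has_derivative_Pair[OF assms[THEN has_derivative_dd]] by (rule dd_eq)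

lemma dd_fst:
  assumes "f differentiable (at (fst y))"
  shows "dd (\<lambda>y. f (fst y)) v y = dd f (fst v) (fst y)" "(\<lambda>y. f (fst y)) differentiable (at y)"
proof -
  have "((\<lambda>y. f (fst y)) has_derivative (\<lambda>v. dd f (fst v) (fst y))) (at y)"
    by (rule has_derivative_compose[OF has_derivative_fst[OF has_derivative_ident] has_derivative_dd[OF assms]])
  then show "dd (\<lambda>y. f (fst y)) v y = dd f (fst v) (fst y)" "(\<lambda>y. f (fst y)) differentiable (at y)"
    by (auto simp: differentiable_def intro: dd_eq)
qed

lemma dd_snd:
  assumes "f differentiable (at (snd y))"
  shows "dd (\<lambda>y. f (snd y)) v y = dd f (snd v) (snd y)" "(\<lambda>y. f (snd y)) differentiable (at y)"
proof -
  have "((\<lambda>y. f (snd y)) has_derivative (\<lambda>v. dd f (snd v) (snd y))) (at y)"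
    by (rule has_derivative_compose[OF has_derivative_snd[OF has_derivative_ident] has_derivative_dd[OF assms]])
  then show "dd (\<lambda>y. f (snd y)) v y = dd f (snd v) (snd y)" "(\<lambda>y. f (snd y)) differentiable (at y)"
    by (auto simp: differentiable_def intro: dd_eq)
qed

lemma smooth_on_fst: "smooth_on S f \<Longrightarrow> open T \<Longrightarrow> smooth_on (S \<times> T) (\<lambda>y. f (fst y))"
  by (rule smooth_on_compose[OF _ smooth_on_bounded_linear[OF bounded_linear_fst]])
    (auto simp: open_Times dest: smooth_on_open)

lemma smooth_on_snd: "smooth_on T f \<Longrightarrow> open S \<Longrightarrow> smooth_on (S \<times> T) (\<lambda>y. f (snd y))"
  by (rule smooth_on_compose[OF _ smooth_on_bounded_linear[OF bounded_linear_snd]])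
    (auto simp: open_Times dest: smooth_on_open)

text \<open>The second derivative along a field splits into the one with the field frozen and a
  first-order term; the latter is what cancels in the Laplacian.\<close>

lemma dd_dd_field:
  fixes f :: "'a::euclidean_space \<Rightarrow> real"
  assumes f: "smooth_on S f" and X: "smooth_on S X" and x: "x \<in> S"
  shows "dd (\<lambda>x. dd f (X x) x) u x = dd (dd f (X x)) u x + dd f (dd X u x) x"
proof -
  have S: "open S" using smooth_on_open[OF f] .
  \<comment> \<open>A dummy scalar argument, set to 1, makes the derivative bilinear so that
    \<open>dd_bilinear_field\<close> applies.\<close>
  let ?T = "\<lambda>y u (c::real). c * dd f u y"
  have T: "bilinear (?T y)" if "y \<in> S" for y
  proof -
    have "linear (\<lambda>u. dd f u y)" using linear_dd[OF smooth_on_differentiable[OF f that]] .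
    then show ?thesis
      by (auto simp: bilinear_def linear_iff algebra_simps)
  qed
  have sT: "smooth_on S (\<lambda>y. ?T y u c)" for u c
    by (intro smooth_on_mult smooth_on_const S smooth_on_dd f)
  have "dd (\<lambda>x. ?T x (X x) 1) u x
    = dd (\<lambda>y. ?T y (X x) 1) (dd (\<lambda>x. x) u x) x + ?T x (dd X u x) 1 + ?T x (X x) (dd (\<lambda>_. 1) u x)"
    by (rule dd_bilinear_field[where T="?T" and \<Phi>="\<lambda>x. x" and Z="\<lambda>_. 1",
          OF T sT smooth_on_bounded_linear[OF bounded_linear_ident S] _ X smooth_on_const[OF S] x]) simp_all
  then show ?thesis by simp
qed

locale warped_coordinates = L1: local_metric S1 G1 + L2: local_metric S2 G2 + L: local_metric "S1 \<times> S2" G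
  for S1 :: "'a::euclidean_space set" and G1 and S2 :: "'b::euclidean_space set" and G2
    and G :: "'a \<times> 'b \<Rightarrow> 'a \<times> 'b \<Rightarrow> 'a \<times> 'b \<Rightarrow> real" +
  fixes q :: "'a \<Rightarrow> real"
  assumes smooth_q: "smooth_on S1 q" and q_pos: "a \<in> S1 \<Longrightarrow> q a > 0"
    and warped: "y \<in> S1 \<times> S2 \<Longrightarrow> G y u v
      = G1 (fst y) (fst u) (fst v) + (q (fst y))\<^sup>2 * G2 (snd y) (snd u) (snd v)"
begin

lemma dd_warped:
  assumes y: "y \<in> S1 \<times> S2"
  shows "dd (\<lambda>y. G y u v) w y = dd (\<lambda>a. G1 a (fst u) (fst v)) (fst w) (fst y)
    + 2 * q (fst y) * dd q (fst w) (fst y) * G2 (snd y) (snd u) (snd v)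
    + (q (fst y))\<^sup>2 * dd (\<lambda>z. G2 z (snd u) (snd v)) (snd w) (snd y)"
proof -
  have ab: "fst y \<in> S1" "snd y \<in> S2" using y by auto
  note d1 = has_derivative_compose[OF has_derivative_fst[OF has_derivative_ident]
      has_derivative_dd[OF L1.differentiable[OF ab(1)]], of "fst u" "fst v"]
  note dq = has_derivative_compose[OF has_derivative_fst[OF has_derivative_ident]
      has_derivative_dd[OF smooth_on_differentiable[OF smooth_q ab(1)]]]
  note d2 = has_derivative_compose[OF has_derivative_snd[OF has_derivative_ident]
      has_derivative_dd[OF L2.differentiable[OF ab(2)]], of "snd u" "snd v"]
  have "dd (\<lambda>y. G y u v) w y
      = dd (\<lambda>y. G1 (fst y) (fst u) (fst v) + (q (fst y))\<^sup>2 * G2 (snd y) (snd u) (snd v)) w y"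
    by (rule dd_cong_open[OF L.open_S y]) (rule warped)
  also have "\<dots> = dd (\<lambda>a. G1 a (fst u) (fst v)) (fst w) (fst y)
    + ((q (fst y))\<^sup>2 * dd (\<lambda>z. G2 z (snd u) (snd v)) (snd w) (snd y)
      + of_nat 2 * dd q (fst w) (fst y) * q (fst y) ^ (2 - 1) * G2 (snd y) (snd u) (snd v))"
    by (rule dd_eq) (intro has_derivative_add has_derivative_mult has_derivative_power d1 d2 dq)
  finally show ?thesis by simp
qed

text \<open>The leaves of the base are totally geodesic: fibre directions see the base block as
  constant, so the Koszul formula reduces to that of \<open>G1\<close>.\<close>

lemma christoffel_base:
  assumes y: "y \<in> S1 \<times> S2"
  shows "christoffel G y (x, 0) (x', 0) = (christoffel G1 (fst y) x x', 0)"
proof (rule L.christoffel_eqI[OF y])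
  have ab: "fst y \<in> S1" "snd y \<in> S2" using y by auto
  interpret s2: scalar_product "G2 (snd y)" using L2.scalar_product[OF ab(2)] .
  \<comment> \<open>Homogeneity with factor 0 turns the zero argument into a zero
    derivative.\<close>
  have 0: "dd (\<lambda>z. G2 z 0 v) w (snd y) = 0" "dd (\<lambda>z. G2 z v 0) w (snd y) = 0" for v w
    using L2.dd_metric(3,4)[OF ab(2), where c=0] by auto
  fix w
  show "2 * G y (christoffel G1 (fst y) x x', 0) w = koszul G y (x, 0) (x', 0) w"
    using L1.christoffel[OF ab(1), of x x' "fst w"]
    by (simp add: warped[OF y] koszul_def dd_warped[OF y] 0 s2.bilin_simps ab)
qed

text \<open>The only derivative that survives in the Koszul formula is that of the squared warping
  function along \<open>x\<close>; divided by twice that square it is the logarithmic derivative of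
  \<open>q\<close>.\<close>

lemma christoffel_mixed:
  assumes y: "y \<in> S1 \<times> S2"
  shows "christoffel G y (x, 0) (0, v) = (0, (dd q x (fst y) / q (fst y)) *\<^sub>R v)"
proof (rule L.christoffel_eqI[OF y])
  have ab: "fst y \<in> S1" "snd y \<in> S2" using y by auto
  interpret s1: scalar_product "G1 (fst y)" using L1.scalar_product[OF ab(1)] .
  interpret s2: scalar_product "G2 (snd y)" using L2.scalar_product[OF ab(2)] .
  have 0: "dd (\<lambda>z. G2 z 0 v) w (snd y) = 0" "dd (\<lambda>z. G2 z v 0) w (snd y) = 0" for v w
    using L2.dd_metric(3,4)[OF ab(2), where c=0] by auto
  have zero: "dd (\<lambda>a. G1 a 0 v) w (fst y) = 0" "dd (\<lambda>a. G1 a v 0) w (fst y) = 0" for v w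
    using L1.dd_metric(3,4)[OF ab(1), where c=0] by auto
  have d0: "dd q 0 (fst y) = 0"
    using linear_0[OF linear_dd[OF smooth_on_differentiable[OF smooth_q ab(1)]]] .
  have d0': "dd (\<lambda>a. G1 a u u') 0 (fst y) = 0" for u u'
    using linear_0[OF linear_dd[OF L1.differentiable[OF ab(1)]]] .
  have d0'': "dd (\<lambda>a. G2 a u u') 0 (snd y) = 0" for u u'
    using linear_0[OF linear_dd[OF L2.differentiable[OF ab(2)]]] .
  fix w
  show "2 * G y (0, (dd q x (fst y) / q (fst y)) *\<^sub>R v) w = koszul G y (x, 0) (0, v) w"
    using q_pos[OF ab(1)]
    by (simp add: warped[OF y] koszul_def dd_warped[OF y] 0 zero d0 d0' d0'' s1.bilin_simps s2.bilin_simps ab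
        power2_eq_square)
qed

text \<open>The coefficient is minus the Hessian of \<open>q\<close> at (x, x), divided by
  \<open>q\<close>: the squared logarithmic derivative from the quotient rule cancels against the
  product of two mixed Christoffel symbols.\<close>

lemma riem_mixed:
  assumes y: "y \<in> S1 \<times> S2"
  shows "L.riem y (0, v) (x, 0) (x, 0)
    = (0, ((dd q (christoffel G1 (fst y) x x) (fst y) - dd (dd q x) x (fst y)) / q (fst y)) *\<^sub>R v)"
proof -
  have ab: "fst y \<in> S1" "snd y \<in> S2" using y by auto
  define a where "a = fst y"
  have a: "a \<in> S1" "q a > 0" using ab q_pos by (auto simp: a_def)
  \<comment> \<open>The base symbols do not depend on the fibre coordinate, so they are constant in
    fibre directions.\<close>
  have "dd (\<lambda>y. christoffel G y (x, 0) (x, 0)) (0, v) y = dd (\<lambda>y. (christoffel G1 (fst y) x x, 0)) (0, v) y"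
    by (rule dd_cong_open[OF L.open_S y]) (rule christoffel_base)
  also have "\<dots> = 0"
  proof -
    have d: "(\<lambda>a. christoffel G1 a x x) differentiable (at (fst y))"
      using smooth_on_differentiable[OF L1.smooth_christoffel ab(1)] .
    have "((\<lambda>y. (christoffel G1 (fst y) x x, 0 :: 'b)) has_derivative
        (\<lambda>w. (dd (\<lambda>a. christoffel G1 a x x) (fst w) (fst y), 0))) (at y)"
      by (intro has_derivative_Pair has_derivative_const
          has_derivative_compose[OF has_derivative_fst[OF has_derivative_ident] has_derivative_dd[OF d]])
    from dd_eq[OF this, of "(0, v)"] show ?thesis
      using linear_0[OF linear_dd[OF d]] by (simp add: zero_prod_def)
  qed
  finally have 1: "dd (\<lambda>y. christoffel G y (x, 0) (x, 0)) (0, v) y = 0" .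
  have comm: "christoffel G y (0, v) (x, 0) = christoffel G y (x, 0) (0, v)" if "y \<in> S1 \<times> S2" for y x v
    using L.christoffel_commute[OF that] .
  \<comment> \<open>\<open>r\<close> is the factor in the mixed Christoffel symbol, the logarithmic
    derivative of \<open>q\<close> along \<open>x\<close>.\<close>
  define r where "r = (\<lambda>a. dd q x a / q a)"
  have dr: "(r has_derivative (\<lambda>w. (dd (dd q x) w a * q a - dd q x a * dd q w a) / (q a * q a))) (at a)"
    unfolding r_def
    by (rule has_derivative_divide'[OF has_derivative_dd has_derivative_dd])
      (use a smooth_on_differentiable[OF smooth_q] smooth_on_differentiable[OF smooth_on_dd[OF smooth_q]] in auto)
  have "dd (\<lambda>y. christoffel G y (0, v) (x, 0)) (x, 0) y = dd (\<lambda>y. (0, r (fst y) *\<^sub>R v)) (x, 0) y"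
    by (rule dd_cong_open[OF L.open_S y]) (simp add: comm christoffel_mixed r_def)
  also have "\<dots> = (0, dd r x a *\<^sub>R v)"
  proof -
    have d: "r differentiable (at (fst y))" using dr by (auto simp: differentiable_def a_def)
    have "((\<lambda>y. (0 :: 'a, r (fst y) *\<^sub>R v)) has_derivative (\<lambda>w. (0, dd r (fst w) (fst y) *\<^sub>R v))) (at y)"
      by (intro has_derivative_Pair has_derivative_const has_derivative_scaleR_left
          has_derivative_compose[OF has_derivative_fst[OF has_derivative_ident] has_derivative_dd[OF d]])
    from dd_eq[OF this] show ?thesis by (simp add: a_def)
  qed
  also have "dd r x a = (dd (dd q x) x a * q a - dd q x a * dd q x a) / (q a * q a)"
    by (rule dd_eq[OF dr])
  finally have 2: "dd (\<lambda>y. christoffel G y (0, v) (x, 0)) (x, 0) y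
      = (0, ((dd (dd q x) x a * q a - dd q x a * dd q x a) / (q a * q a)) *\<^sub>R v)" .
  have eq: "L.riem y (0, v) (x, 0) (x, 0)
    = (0, (dd q (christoffel G1 a x x) a / q a) *\<^sub>R v
      - (((dd (dd q x) x a * q a - dd q x a * dd q x a) / (q a * q a)) *\<^sub>R v
        + (dd q x a / q a) *\<^sub>R (dd q x a / q a) *\<^sub>R v))"
    unfolding L.riem_eq[OF y] 1 2 christoffel_base[OF y] comm[OF y] christoffel_mixed[OF y]
    by (simp add: a_def)
  show ?thesis
    unfolding eq scaleR_scaleR scaleR_add_left[symmetric] scaleR_diff_left[symmetric] a_def[symmetric]
    using a by (simp add: field_simps)
qed

end

section \<open>Product charts\<close>

definition prod_chart :: "('b, 'e) chart \<Rightarrow> ('f, 'd) chart \<Rightarrow> ('b \<times> 'f, 'e \<times> 'd) chart" where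
  "prod_chart c d = (fst c \<times> fst d, map_prod (snd c) (snd d))"

lemma fst_prod_chart: "fst (prod_chart c d) = fst c \<times> fst d"
  by (simp add: prod_chart_def)

lemma snd_prod_chart: "snd (prod_chart c d) p = (snd c (fst p), snd d (snd p))"
  by (simp add: prod_chart_def map_prod_def split_beta)

lemma product_atlas_eq: "product_atlas A\<^sub>B A\<^sub>F = {prod_chart c d | c d. c \<in> A\<^sub>B \<and> d \<in> A\<^sub>F}"
  by (simp add: product_atlas_def prod_chart_def)

lemma image_prod_chart:
  "snd (prod_chart c d) ` (U \<times> V) = (snd c ` U) \<times> (snd d ` V)"
  by (force simp: snd_prod_chart image_iff)

lemma chart_image_prod: "chart_image (prod_chart c d) = chart_image c \<times> chart_image d"
  unfolding chart_image_def fst_prod_chart by (rule image_prod_chart)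

lemma chart_inv_prod:
  assumes "is_chart c" "is_chart d" "y \<in> chart_image c \<times> chart_image d"
  shows "chart_inv (prod_chart c d) y = (chart_inv c (fst y), chart_inv d (snd y))"
  unfolding chart_inv_def[of "prod_chart c d"]
proof (rule inv_into_f_eq)
  show "inj_on (snd (prod_chart c d)) (fst (prod_chart c d))"
    unfolding inj_on_def fst_prod_chart snd_prod_chart
    using chart_inv_left[OF assms(1)] chart_inv_left[OF assms(2)]
    by (metis mem_Times_iff prod.expand prod.inject)
  show "(chart_inv c (fst y), chart_inv d (snd y)) \<in> fst (prod_chart c d)"
    using assms by (auto simp: fst_prod_chart chart_inv_in)
  show "snd (prod_chart c d) (chart_inv c (fst y), chart_inv d (snd y)) = y"
    using assms by (auto simp: snd_prod_chart chart_inv_right)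
qed

lemma is_chart_prod:
  assumes c: "is_chart c" and d: "is_chart d"
  shows "is_chart (prod_chart c d)"
proof -
  note cont = c[unfolded is_chart_def homeomorphism_def] d[unfolded is_chart_def homeomorphism_def]
  let ?k = "prod_chart c d"
  have o: "open (fst ?k)" "open (chart_image ?k)"
    using cont by (auto simp: fst_prod_chart chart_image_prod open_Times)
  have left: "chart_inv ?k (snd ?k p) = p" if "p \<in> fst ?k" for p
    using that chart_inv_prod[OF c d, of "snd ?k p"]
    by (auto simp: fst_prod_chart snd_prod_chart chart_inv_left[OF c] chart_inv_left[OF d] chart_image_in)
  have right: "snd ?k (chart_inv ?k y) = y" "chart_inv ?k y \<in> fst ?k" if "y \<in> chart_image ?k" for y
    using that chart_inv_prod[OF c d, of y]
    by (auto simp: chart_image_prod fst_prod_chart snd_prod_chart chart_inv_right[OF c] chart_inv_right[OF d]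
        chart_inv_in[OF c] chart_inv_in[OF d])
  have "continuous_on (fst ?k) (\<lambda>p. (snd c (fst p), snd d (snd p)))"
    unfolding fst_prod_chart
    by (intro continuous_on_Pair continuous_on_compose2[OF _ continuous_on_fst[OF continuous_on_id]]
        continuous_on_compose2[OF _ continuous_on_snd[OF continuous_on_id]])
      (use cont in auto)
  then have c1: "continuous_on (fst ?k) (snd ?k)"
    by (rule continuous_on_eq) (simp add: snd_prod_chart)
  have "continuous_on (chart_image ?k) (\<lambda>y. (chart_inv c (fst y), chart_inv d (snd y)))"
    unfolding chart_image_prod
    by (intro continuous_on_Pair continuous_on_compose2[OF _ continuous_on_fst[OF continuous_on_id]]
        continuous_on_compose2[OF _ continuous_on_snd[OF continuous_on_id]])
      (use cont in auto)
  then have c2: "continuous_on (chart_image ?k) (chart_inv ?k)"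
    by (rule continuous_on_eq) (simp add: chart_inv_prod[OF c d] chart_image_prod)
  have "homeomorphism (fst ?k) (chart_image ?k) (snd ?k) (chart_inv ?k)"
    unfolding homeomorphism_def
  proof (intro conjI ballI)
    show "snd ?k ` fst ?k = chart_image ?k" by (simp add: chart_image_def)
    show "chart_inv ?k ` chart_image ?k = fst ?k"
    proof (intro equalityI subsetI)
      fix p assume "p \<in> fst ?k"
      then have "p = chart_inv ?k (snd ?k p)" "snd ?k p \<in> chart_image ?k"
        by (simp_all add: left chart_image_in)
      then show "p \<in> chart_inv ?k ` chart_image ?k" by (rule image_eqI)
    qed (use right(2) in blast)
  qed (use left right c1 c2 in blast)+
  then show ?thesis using o by (simp add: is_chart_def)
qed


section \<open>Warped products\<close>

locale product_manifold = B: manifold A\<^sub>B + F: manifold A\<^sub>F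
  for A\<^sub>B :: "('b::{t2_space, second_countable_topology}, 'e1::euclidean_space) atlas"
    and A\<^sub>F :: "('f::{t2_space, second_countable_topology}, 'e2::euclidean_space) atlas"
begin

abbreviation A :: "('b \<times> 'f, 'e1 \<times> 'e2) atlas" where
  "A \<equiv> product_atlas A\<^sub>B A\<^sub>F"

lemma product_chartE:
  assumes "c \<in> A"
  obtains c1 c2 where "c = prod_chart c1 c2" "c1 \<in> A\<^sub>B" "c2 \<in> A\<^sub>F"
  using assms by (auto simp: product_atlas_eq)

lemma chart_inv_product:
  "c1 \<in> A\<^sub>B \<Longrightarrow> c2 \<in> A\<^sub>F \<Longrightarrow> y \<in> chart_image c1 \<times> chart_image c2 \<Longrightarrow>
    chart_inv (prod_chart c1 c2) y = (chart_inv c1 (fst y), chart_inv c2 (snd y))"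
  by (rule chart_inv_prod[OF B.is_chart F.is_chart])

lemma transition_prod:
  assumes "c1 \<in> A\<^sub>B" "c2 \<in> A\<^sub>F" "y \<in> chart_image c1 \<times> chart_image c2"
  shows "transition (prod_chart c1 c2) (prod_chart d1 d2) y = (transition c1 d1 (fst y), transition c2 d2 (snd y))"
  using chart_inv_product[OF assms] by (simp add: transition_def snd_prod_chart)

sublocale manifold A
proof
  have cover: "(\<Union>c\<in>A. fst c) = UNIV"
  proof -
    have "p \<in> fst (prod_chart (chart_at A\<^sub>B (fst p)) (chart_at A\<^sub>F (snd p)))" for p
      using B.chart_at(2) F.chart_at(2) by (simp add: fst_prod_chart mem_Times_iff)
    then show ?thesis
      unfolding product_atlas_eq using B.chart_at(1) F.chart_at(1) by blast
  qed
  have "smooth_on (snd c ` (fst c \<inter> fst d)) (snd d \<circ> chart_inv c)" if cd: "c \<in> A" "d \<in> A" for c d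
  proof -
    obtain c1 c2 where c: "c = prod_chart c1 c2" "c1 \<in> A\<^sub>B" "c2 \<in> A\<^sub>F"
      using product_chartE[OF cd(1)] .
    obtain d1 d2 where d: "d = prod_chart d1 d2" "d1 \<in> A\<^sub>B" "d2 \<in> A\<^sub>F"
      using product_chartE[OF cd(2)] .
    note s1 = B.smooth_transition[OF c(2) d(2)] and s2 = F.smooth_transition[OF c(3) d(3)]
    let ?U = "snd c1 ` (fst c1 \<inter> fst d1)" and ?V = "snd c2 ` (fst c2 \<inter> fst d2)"
    have im: "snd c ` (fst c \<inter> fst d) = ?U \<times> ?V"
      unfolding c d fst_prod_chart Times_Int_Times by (rule image_prod_chart)
    have "smooth_on (?U \<times> ?V) (\<lambda>y. (transition c1 d1 (fst y), transition c2 d2 (snd y)))"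
      by (intro smooth_on_Pair smooth_on_fst smooth_on_snd s1 s2 smooth_on_open[OF s1]
          smooth_on_open[OF s2])
    moreover have "(transition c1 d1 (fst y), transition c2 d2 (snd y)) = (snd d \<circ> chart_inv c) y" if "y \<in> ?U \<times> ?V" for y
    proof -
      have "y \<in> chart_image c1 \<times> chart_image c2" using that by (auto simp: chart_image_def)
      then show ?thesis using transition_prod[OF c(2,3)] by (simp add: c(1) d(1) transition_def)
    qed
    ultimately show ?thesis unfolding im by (rule smooth_on_cong)
  qed
  moreover have "is_chart c" if "c \<in> A" for c
    using that is_chart_prod[OF B.is_chart F.is_chart] by (auto elim!: product_chartE)
  ultimately show "smooth_manifold A"
    using cover by (simp add: smooth_manifold_def)
qed

lemma prod_chart_in: "c1 \<in> A\<^sub>B \<Longrightarrow> c2 \<in> A\<^sub>F \<Longrightarrow> prod_chart c1 c2 \<in> A"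
  unfolding product_atlas_eq by blast

lemma chart_change_prod:
  assumes c: "c1 \<in> A\<^sub>B" "c2 \<in> A\<^sub>F" "fst p \<in> fst c1" "snd p \<in> fst c2"
    and d: "d1 \<in> A\<^sub>B" "d2 \<in> A\<^sub>F" "fst p \<in> fst d1" "snd p \<in> fst d2"
  shows "chart_change (prod_chart c1 c2) (prod_chart d1 d2) (snd c1 (fst p), snd c2 (snd p)) u
    = (chart_change c1 d1 (snd c1 (fst p)) (fst u), chart_change c2 d2 (snd c2 (snd p)) (snd u))"
proof -
  let ?y = "(snd c1 (fst p), snd c2 (snd p))"
  have y: "?y \<in> chart_image c1 \<times> chart_image c2" using c by (simp add: chart_image_in)
  have o: "open (chart_image c1 \<times> chart_image c2)"
    using B.open_image[OF c(1)] F.open_image[OF c(2)] by (rule open_Times)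
  have d1: "transition c1 d1 differentiable (at (fst ?y))" "transition c2 d2 differentiable (at (snd ?y))"
    using B.differentiable_transition[OF c(1) d(1) c(3) d(3)] F.differentiable_transition[OF c(2) d(2) c(4) d(4)] by auto
  have "dd (transition (prod_chart c1 c2) (prod_chart d1 d2)) u ?y = dd (\<lambda>y. (transition c1 d1 (fst y), transition c2 d2 (snd y))) u ?y"
    by (rule dd_cong_open[OF o y]) (rule transition_prod[OF c(1,2)])
  also have "\<dots> = (dd (transition c1 d1) (fst u) (fst ?y), dd (transition c2 d2) (snd u) (snd ?y))"
    using dd_Pair[OF dd_fst(2)[OF d1(1)] dd_snd(2)[OF d1(2)]] dd_fst(1)[OF d1(1)] dd_snd(1)[OF d1(2)] by simp
  finally show ?thesis by (simp add: chart_change_eq)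
qed

text \<open>On the product, \<open>chart_at\<close> is chosen independently of the factors, so it is
  known only to be a product of some two charts around the components. Hence the changes of chart in
  the lemmas on projections and lifts.\<close>

lemma chart_at_product:
  obtains c1 c2 where "chart_at A p = prod_chart c1 c2" "c1 \<in> A\<^sub>B" "c2 \<in> A\<^sub>F" "fst p \<in> fst c1" "snd p \<in> fst c2"
proof -
  obtain c1 c2 where c: "chart_at A p = prod_chart c1 c2" "c1 \<in> A\<^sub>B" "c2 \<in> A\<^sub>F"
    using product_chartE[OF chart_at(1)] .
  then have "p \<in> fst c1 \<times> fst c2" using chart_at(2)[of p] by (simp add: fst_prod_chart)
  then show ?thesis using that c by (auto simp: mem_Times_iff)
qed

text \<open>In product coordinates the projection is \<open>fst\<close>, so its differential passes
  on the first block; composing chart changes leads from the preferred chart to the given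
  one.\<close>

lemma differential_fst:
  assumes c: "c1 \<in> A\<^sub>B" "c2 \<in> A\<^sub>F" "fst p \<in> fst c1" "snd p \<in> fst c2"
  shows "differential A A\<^sub>B fst p (chart_change (prod_chart c1 c2) (chart_at A p) (snd c1 (fst p), snd c2 (snd p)) u)
    = chart_change c1 (chart_at A\<^sub>B (fst p)) (snd c1 (fst p)) (fst u)"
proof -
  obtain k1 k2 where k: "chart_at A p = prod_chart k1 k2" "k1 \<in> A\<^sub>B" "k2 \<in> A\<^sub>F" "fst p \<in> fst k1" "snd p \<in> fst k2"
    using chart_at_product .
  let ?d = "chart_at A\<^sub>B (fst p)" and ?y = "(snd k1 (fst p), snd k2 (snd p))"
  have y: "?y \<in> chart_image k1 \<times> chart_image k2" using k by (simp add: chart_image_in)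
  have o: "open (chart_image k1 \<times> chart_image k2)"
    using B.open_image[OF k(2)] F.open_image[OF k(3)] by (rule open_Times)
  have d: "transition k1 ?d differentiable (at (fst ?y))"
    using B.differentiable_transition[OF k(2) B.chart_at(1) k(4) B.chart_at(2)] by simp
  have "differential A A\<^sub>B fst p v = chart_change k1 ?d (snd k1 (fst p)) (fst v)" for v
  proof -
    have "dd (snd ?d \<circ> fst \<circ> chart_inv (prod_chart k1 k2)) v ?y = dd (\<lambda>y. transition k1 ?d (fst y)) v ?y"
      by (rule dd_cong_open[OF o y]) (simp add: chart_inv_product[OF k(2,3)] transition_def)
    then show ?thesis
      using dd_fst(1)[OF d, of v] by (simp add: differential_def Let_def k(1) snd_prod_chart chart_change_eq)
  qed
  then show ?thesis
    unfolding k(1) chart_change_prod[OF c k(2-)]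
    using B.chart_change_trans[OF c(1) k(2) B.chart_at(1) c(3) k(4) B.chart_at(2)] by simp
qed

lemma differential_snd:
  assumes c: "c1 \<in> A\<^sub>B" "c2 \<in> A\<^sub>F" "fst p \<in> fst c1" "snd p \<in> fst c2"
  shows "differential A A\<^sub>F snd p (chart_change (prod_chart c1 c2) (chart_at A p) (snd c1 (fst p), snd c2 (snd p)) u)
    = chart_change c2 (chart_at A\<^sub>F (snd p)) (snd c2 (snd p)) (snd u)"
proof -
  obtain k1 k2 where k: "chart_at A p = prod_chart k1 k2" "k1 \<in> A\<^sub>B" "k2 \<in> A\<^sub>F" "fst p \<in> fst k1" "snd p \<in> fst k2"
    using chart_at_product .
  let ?d = "chart_at A\<^sub>F (snd p)" and ?y = "(snd k1 (fst p), snd k2 (snd p))"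
  have y: "?y \<in> chart_image k1 \<times> chart_image k2" using k by (simp add: chart_image_in)
  have o: "open (chart_image k1 \<times> chart_image k2)"
    using B.open_image[OF k(2)] F.open_image[OF k(3)] by (rule open_Times)
  have d: "transition k2 ?d differentiable (at (snd ?y))"
    using F.differentiable_transition[OF k(3) F.chart_at(1) k(5) F.chart_at(2)] by simp
  have "differential A A\<^sub>F snd p v = chart_change k2 ?d (snd k2 (snd p)) (snd v)" for v
  proof -
    have "dd (snd ?d \<circ> snd \<circ> chart_inv (prod_chart k1 k2)) v ?y = dd (\<lambda>y. transition k2 ?d (snd y)) v ?y"
      by (rule dd_cong_open[OF o y]) (simp add: chart_inv_product[OF k(2,3)] transition_def)
    then show ?thesis
      using dd_snd(1)[OF d, of v] by (simp add: differential_def Let_def k(1) snd_prod_chart chart_change_eq)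
  qed
  then show ?thesis
    unfolding k(1) chart_change_prod[OF c k(2-)]
    using F.chart_change_trans[OF c(2) k(3) F.chart_at(1) c(4) k(5) F.chart_at(2)] by simp
qed

text \<open>The inclusion of a leaf is constant in the fibre coordinate, so in every product chart
  the fibre block of a lift is zero and its base block is that of \<open>X\<close>.\<close>

lemma field_in_lift:
  assumes c: "c1 \<in> A\<^sub>B" "c2 \<in> A\<^sub>F" and y: "y \<in> chart_image c1 \<times> chart_image c2"
  shows "field_in A (prod_chart c1 c2) (lift_field A\<^sub>B A\<^sub>F X) y = (field_in A\<^sub>B c1 X (fst y), 0)"
proof -
  define p where "p = chart_inv (prod_chart c1 c2) y"
  have p: "p = (chart_inv c1 (fst y), chart_inv c2 (snd y))"
    using chart_inv_product[OF c y] by (simp add: p_def)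
  have pc: "fst p \<in> fst c1" "snd p \<in> fst c2"
    using y B.inv_in[OF c(1)] F.inv_in[OF c(2)] by (auto simp: p)
  obtain k1 k2 where k: "chart_at A p = prod_chart k1 k2" "k1 \<in> A\<^sub>B" "k2 \<in> A\<^sub>F" "fst p \<in> fst k1" "snd p \<in> fst k2"
    using chart_at_product .
  let ?d = "chart_at A\<^sub>B (fst p)"
  have d: "?d \<in> A\<^sub>B" "fst p \<in> fst ?d" using B.chart_at by auto
  have "dd (snd (prod_chart k1 k2) \<circ> (\<lambda>b. (b, snd p)) \<circ> chart_inv ?d) v (snd ?d (fst p))
    = (chart_change ?d k1 (snd ?d (fst p)) v, 0)" for v
  proof -
    have "snd (prod_chart k1 k2) \<circ> (\<lambda>b. (b, snd p)) \<circ> chart_inv ?d = (\<lambda>a. (transition ?d k1 a, snd k2 (snd p)))"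
      by (simp add: fun_eq_iff snd_prod_chart transition_def)
    then show ?thesis
      using dd_Pair[OF B.differentiable_transition[OF d(1) k(2) d(2) k(4)] differentiable_const, of "snd k2 (snd p)" v]
      by (simp add: chart_change_eq)
  qed
  then have "lift_field A\<^sub>B A\<^sub>F X p = (chart_change ?d k1 (snd ?d (fst p)) (X (fst p)), 0)"
    by (simp add: lift_field_def differential_def Let_def k(1))
  moreover have "chart_change k2 c2 (snd k2 (snd p)) 0 = 0"
    by (rule linear_0[OF F.chart_change_linear[OF k(3) c(2) k(5) pc(2)]])
  ultimately have "field_in A (prod_chart c1 c2) (lift_field A\<^sub>B A\<^sub>F X) y
      = (chart_change k1 c1 (snd k1 (fst p)) (chart_change ?d k1 (snd ?d (fst p)) (X (fst p))), 0)"
    using chart_change_prod[OF k(2-) c pc]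
    by (simp add: field_in_def Let_def p_def[symmetric] k(1) snd_prod_chart)
  also have "\<dots> = (field_in A\<^sub>B c1 X (fst y), 0)"
    using B.chart_change_trans[OF d(1) k(2) c(1) d(2) k(4) pc(1)]
    by (simp add: field_in_def Let_def p)
  finally show ?thesis .
qed

end

section \<open>The warped product manifold and its Laplacian\<close>

locale warped_product = B: riemannian A\<^sub>B g\<^sub>B + F: riemannian A\<^sub>F g\<^sub>F
  for A\<^sub>B :: "('b::{t2_space, second_countable_topology}, 'e1::euclidean_space) atlas" and g\<^sub>B
    and A\<^sub>F :: "('f::{t2_space, second_countable_topology}, 'e2::euclidean_space) atlas" and g\<^sub>F +
  fixes f :: "'b \<Rightarrow> real"
  assumes smooth_f: "smooth_fun A\<^sub>B f" and f_pos: "f b > 0"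
begin

sublocale product_manifold A\<^sub>B A\<^sub>F ..

abbreviation g :: "'b \<times> 'f \<Rightarrow> 'e1 \<times> 'e2 \<Rightarrow> 'e1 \<times> 'e2 \<Rightarrow> real" where
  "g \<equiv> warped_metric A\<^sub>B g\<^sub>B f A\<^sub>F g\<^sub>F"

abbreviation (input) "q c \<equiv> (\<lambda>a. f (chart_inv c a))"

lemma smooth_q: "c \<in> A\<^sub>B \<Longrightarrow> smooth_on (chart_image c) (q c)"
  using smooth_f by (simp add: smooth_fun_def o_def)

lemma metric_in_warped:
  assumes c: "c1 \<in> A\<^sub>B" "c2 \<in> A\<^sub>F" and y: "y \<in> chart_image c1 \<times> chart_image c2"
  shows "metric_in A g (prod_chart c1 c2) y u v = metric_in A\<^sub>B g\<^sub>B c1 (fst y) (fst u) (fst v)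
    + (q c1 (fst y))\<^sup>2 * metric_in A\<^sub>F g\<^sub>F c2 (snd y) (snd u) (snd v)"
proof -
  obtain p where p: "fst p \<in> fst c1" "snd p \<in> fst c2" and y_eq: "y = (snd c1 (fst p), snd c2 (snd p))"
  proof -
    obtain p1 p2 where "p1 \<in> fst c1" "p2 \<in> fst c2" "y = (snd c1 p1, snd c2 p2)"
      using y by (auto simp: chart_image_def)
    then show ?thesis using that[of "(p1, p2)"] by simp
  qed
  have inv: "chart_inv (prod_chart c1 c2) y = p"
    unfolding chart_inv_product[OF c y] by (simp add: y_eq B.inv_left[OF c(1) p(1)] F.inv_left[OF c(2) p(2)])
  show ?thesis
    unfolding metric_in_def[of A] inv Let_def warped_metric_def
    unfolding y_eq differential_fst[OF c p] differential_snd[OF c p]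
    by (simp add: B.metric_in_eq[OF c(1) p(1)] F.metric_in_eq[OF c(2) p(2)] B.inv_left[OF c(1) p(1)])
qed

lemma riemannian_manifold: "riemannian_manifold A g"
  unfolding riemannian_manifold_def
proof (intro conjI allI ballI)
  show "smooth_manifold A" by (rule smooth_manifold)
next
  fix p
  obtain c1 c2 where c: "chart_at A p = prod_chart c1 c2" "c1 \<in> A\<^sub>B" "c2 \<in> A\<^sub>F" "fst p \<in> fst c1" "snd p \<in> fst c2"
    using chart_at_product .
  let ?y = "(snd c1 (fst p), snd c2 (snd p))"
  have y: "?y \<in> chart_image c1 \<times> chart_image c2" using c by (simp add: chart_image_in)
  \<comment> \<open>At the point itself the preferred chart represents the metric unchanged, so its
    algebraic properties can be read off from the block form.\<close>
  have "g p u v = metric_in A g (prod_chart c1 c2) ?y u v" for u v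
    using chart_change_refl[OF chart_at, of p] inv_left[OF chart_at, of p]
    by (simp add: metric_in_def Let_def c(1) snd_prod_chart)
  then have eq: "g p u v = metric_in A\<^sub>B g\<^sub>B c1 (fst ?y) (fst u) (fst v)
    + (q c1 (fst ?y))\<^sup>2 * metric_in A\<^sub>F g\<^sub>F c2 (snd ?y) (snd u) (snd v)" for u v
    unfolding metric_in_warped[OF c(2,3) y] .
  interpret s1: scalar_product "metric_in A\<^sub>B g\<^sub>B c1 (fst ?y)"
    using local_metric.scalar_product[OF B.local_metric[OF c(2)]] y by auto
  interpret s2: scalar_product "metric_in A\<^sub>F g\<^sub>F c2 (snd ?y)"
    using local_metric.scalar_product[OF F.local_metric[OF c(3)]] y by auto
  have qpos: "(q c1 (fst ?y))\<^sup>2 > 0" using f_pos by (simp add: less_imp_neq[symmetric])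
  show "bilinear (g p)"
    unfolding bilinear_def linear_iff eq
    by (simp only: fst_add snd_add fst_scaleR snd_scaleR s1.bilin_simps s2.bilin_simps real_scaleR_def)
      (simp add: algebra_simps)
  show "g p u v = g p v u" for u v
    unfolding eq by (simp only: s1.sym[of "fst u"] s2.sym[of "snd u"])
  show "u \<noteq> 0 \<longrightarrow> 0 < g p u u" for u
  proof
    assume "u \<noteq> 0"
    then consider "fst u \<noteq> 0" | "snd u \<noteq> 0" by (auto simp: prod_eq_iff)
    then show "0 < g p u u"
    proof cases
      case 1
      then show ?thesis unfolding eq
        using s1.pos[OF 1] s2.nonneg[of "snd u"] qpos by (intro add_pos_nonneg mult_nonneg_nonneg) auto
    next
      case 2
      then show ?thesis unfolding eq
        using s2.pos[OF 2] s1.nonneg[of "fst u"] qpos by (intro add_nonneg_pos mult_pos_pos) auto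
    qed
  qed
next
  fix c u v assume "c \<in> A"
  then obtain c1 c2 where c: "c = prod_chart c1 c2" "c1 \<in> A\<^sub>B" "c2 \<in> A\<^sub>F" by (rule product_chartE)
  interpret L1: local_metric "chart_image c1" "metric_in A\<^sub>B g\<^sub>B c1" using B.local_metric[OF c(2)] .
  interpret L2: local_metric "chart_image c2" "metric_in A\<^sub>F g\<^sub>F c2" using F.local_metric[OF c(3)] .
  show "smooth_on (chart_image c) (\<lambda>y. metric_in A g c y u v)"
    unfolding c(1) chart_image_prod
  proof (rule smooth_on_cong)
    show "smooth_on (chart_image c1 \<times> chart_image c2) (\<lambda>y. metric_in A\<^sub>B g\<^sub>B c1 (fst y) (fst u) (fst v)
      + (q c1 (fst y) * q c1 (fst y)) * metric_in A\<^sub>F g\<^sub>F c2 (snd y) (snd u) (snd v))"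
      by (intro smooth_on_add smooth_on_mult smooth_on_fst[OF L1.smooth L2.open_S]
          smooth_on_snd[OF L2.smooth L1.open_S] smooth_on_fst[OF smooth_q[OF c(2)] L2.open_S])
  qed (simp add: metric_in_warped[OF c(2,3)] power2_eq_square)
qed

sublocale M: riemannian A g
  by unfold_locales (rule riemannian_manifold)

lemma warped_coordinates:
  assumes c: "c1 \<in> A\<^sub>B" "c2 \<in> A\<^sub>F"
  shows "warped_coordinates (chart_image c1) (metric_in A\<^sub>B g\<^sub>B c1) (chart_image c2) (metric_in A\<^sub>F g\<^sub>F c2)
    (metric_in A g (prod_chart c1 c2)) (q c1)"
proof -
  interpret L1: local_metric "chart_image c1" "metric_in A\<^sub>B g\<^sub>B c1" using B.local_metric[OF c(1)] .
  interpret L2: local_metric "chart_image c2" "metric_in A\<^sub>F g\<^sub>F c2" using F.local_metric[OF c(2)] .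
  interpret L: local_metric "chart_image c1 \<times> chart_image c2" "metric_in A g (prod_chart c1 c2)"
    using M.local_metric[OF prod_chart_in[OF c]] by (simp add: chart_image_prod)
  show ?thesis
    by unfold_locales (use smooth_q[OF c(1)] f_pos metric_in_warped[OF c] in auto)
qed

text \<open>The derivative of \<open>X i\<close> along itself enters through the connection and
  through the double derivative, and cancels. What is left is minus the Hessian of
  \<open>q c1\<close> on \<open>X i a\<close>.\<close>

lemma warped_laplacian_eq:
  assumes x: "chart_at A x = prod_chart c1 c2" and c: "c1 \<in> A\<^sub>B" "c2 \<in> A\<^sub>F" "fst x \<in> fst c1" "snd x \<in> fst c2"
  defines "a \<equiv> snd c1 (fst x)"
    and "X \<equiv> \<lambda>i. field_in A\<^sub>B c1 (local_frame A\<^sub>B g\<^sub>B (fst x) i)"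
  shows "warped_laplacian A\<^sub>B g\<^sub>B f A\<^sub>F g\<^sub>F f x = (\<Sum>i<DIM('e1).
    dd (q c1) (christoffel (metric_in A\<^sub>B g\<^sub>B c1) a (X i a) (X i a)) a - dd (dd (q c1) (X i a)) (X i a) a)"
proof -
  let ?c = "prod_chart c1 c2" and ?f = "f \<circ> fst"
  let ?I = "chart_image c1 \<times> chart_image c2"
  let ?E = "\<lambda>i. lift_field A\<^sub>B A\<^sub>F (local_frame A\<^sub>B g\<^sub>B (fst x) i)"
  interpret W: warped_coordinates "chart_image c1" "metric_in A\<^sub>B g\<^sub>B c1" "chart_image c2" "metric_in A\<^sub>F g\<^sub>F c2"
    "metric_in A g ?c" "q c1" using warped_coordinates[OF c(1,2)] .
  define y where "y = snd ?c x"
  have y: "y = (a, snd c2 (snd x))" by (simp add: y_def a_def snd_prod_chart)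
  have yI: "y \<in> ?I" using c by (simp add: y a_def chart_image_in)
  have cA: "?c \<in> A" "x \<in> fst ?c" using x chart_at by metis+
  have aI: "a \<in> chart_image c1" using yI by (simp add: y)
  have dq: "(q c1) differentiable (at a')" if "a' \<in> chart_image c1" for a'
    using smooth_on_differentiable[OF smooth_q[OF c(1)] that] .
  have fc: "?f (chart_inv ?c y) = q c1 (fst y)" if "y \<in> ?I" for y
    using chart_inv_product[OF c(1,2) that] by simp
  have diff_f: "(\<lambda>y. ?f (chart_inv ?c y)) differentiable (at y)"
    and dd_f: "dd (\<lambda>y. ?f (chart_inv ?c y)) v y = dd (q c1) (fst v) (fst y)" if "y \<in> ?I" for y v
  proof -
    have y1: "fst y \<in> chart_image c1" using that by auto
    show "(\<lambda>y. ?f (chart_inv ?c y)) differentiable (at y)"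
      by (rule differentiable_cong_open[OF W.L.open_S that fc[symmetric] dd_fst(2)[OF dq[OF y1]]])
    have "dd (\<lambda>y. ?f (chart_inv ?c y)) v y = dd (\<lambda>y. q c1 (fst y)) v y"
      by (rule dd_cong_open[OF W.L.open_S that fc])
    then show "dd (\<lambda>y. ?f (chart_inv ?c y)) v y = dd (q c1) (fst v) (fst y)"
      using dd_fst(1)[OF dq[OF y1]] by simp
  qed
  have vf: "vf_apply A Y ?f p = dd (q c1) (fst (field_in A ?c Y (snd ?c p))) (fst (snd ?c p))"
    if p: "p \<in> fst ?c" for Y p
  proof -
    have "snd ?c p \<in> ?I" using chart_image_in[OF p] by (simp add: chart_image_prod)
    then show ?thesis using vf_apply_chart[OF cA(1) p diff_f] dd_f by (simp add: o_def)
  qed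
  have "vf_apply A (nabla A g (?E i) (?E i)) ?f x - vf_apply A (?E i) (vf_apply A (?E i) ?f) x
    = dd (q c1) (christoffel (metric_in A\<^sub>B g\<^sub>B c1) a (X i a) (X i a)) a - dd (dd (q c1) (X i a)) (X i a) a"
    if i: "i < DIM('e1)" for i
  proof -
    have E: "field_in A ?c (?E i) y = (X i (fst y), 0)" if "y \<in> ?I" for y
      unfolding X_def by (rule field_in_lift[OF c(1,2) that])
    obtain U where U: "fst x \<in> U" "orthonormal_frame_on A\<^sub>B g\<^sub>B U (local_frame A\<^sub>B g\<^sub>B (fst x))"
      using B.local_frame by blast
    \<comment> \<open>The frame of the base is smooth only near the point, so derivatives of
      \<open>X i\<close> are taken on \<open>V\<close>.\<close>
    define V where "V = snd c1 ` (fst c1 \<inter> U)"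
    have X: "smooth_on V (X i)"
      using U(2) i c(1) by (simp add: orthonormal_frame_on_def X_def V_def)
    have aV: "a \<in> V" using U(1) c by (simp add: a_def V_def)
    have VI: "V \<subseteq> chart_image c1" by (auto simp: V_def chart_image_def)
    have qV: "smooth_on V (q c1)"
      by (rule smooth_on_subset[OF smooth_q[OF c(1)] smooth_on_open[OF X] VI])
    have dX: "X i differentiable (at (fst y))"
      using smooth_on_differentiable[OF X aV] by (simp add: y)
    have dqX: "(\<lambda>a. dd (q c1) (X i a) a) differentiable (at (fst y))"
      using smooth_on_differentiable[OF smooth_on_dd_field[OF qV X] aV] by (simp add: y)
    have vf_c: "vf_apply A (?E i) ?f (chart_inv ?c y) = dd (q c1) (X i (fst y)) (fst y)" if "y \<in> ?I" for y
    proof -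
      have "y \<in> chart_image ?c" using that by (simp add: chart_image_prod)
      then show ?thesis
        using vf[OF inv_in[OF cA(1)], of y "?E i"] E[OF that] inv_right[OF cA(1)] by simp
    qed
    have diff_vf: "(\<lambda>y. vf_apply A (?E i) ?f (chart_inv ?c y)) differentiable (at y)"
      using W.L.open_S yI vf_c[symmetric] dd_fst(2)[OF dqX] by (rule differentiable_cong_open)
    have "vf_apply A (?E i) (vf_apply A (?E i) ?f) x
        = dd (\<lambda>y. vf_apply A (?E i) ?f (chart_inv ?c y)) (field_in A ?c (?E i) y) y"
      unfolding y_def by (rule vf_apply_chart[OF cA diff_vf[unfolded y_def]])
    also have "\<dots> = dd (\<lambda>y. dd (q c1) (X i (fst y)) (fst y)) (X i a, 0) y"
      unfolding E[OF yI] using dd_cong_open[OF W.L.open_S yI vf_c] by (simp add: y)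
    also have "\<dots> = dd (\<lambda>a. dd (q c1) (X i a) a) (X i a) a"
      using dd_fst(1)[OF dqX] by (simp add: y)
    also have "\<dots> = dd (dd (q c1) (X i a)) (X i a) a + dd (q c1) (dd (X i) (X i a) a) a"
      by (rule dd_dd_field[OF qV X aV])
    finally have 1: "vf_apply A (?E i) (vf_apply A (?E i) ?f) x
      = dd (dd (q c1) (X i a)) (X i a) a + dd (q c1) (dd (X i) (X i a) a) a" .
    have "field_in A ?c (nabla A g (?E i) (?E i)) y = nabla A g (?E i) (?E i) x"
      using chart_change_refl[OF cA] inv_left[OF cA] by (simp add: field_in_def Let_def y_def x)
    also have "\<dots> = dd (field_in A ?c (?E i)) (X i a, 0) y
        + (christoffel (metric_in A\<^sub>B g\<^sub>B c1) a (X i a) (X i a), 0)"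
      using W.christoffel_base[OF yI] E[OF yI]
      by (simp add: nabla_def Let_def x y_def[symmetric] cov_deriv_def) (simp add: y)
    also have "dd (field_in A ?c (?E i)) (X i a, 0) y = dd (\<lambda>y. (X i (fst y), 0)) (X i a, 0) y"
      by (rule dd_cong_open[OF W.L.open_S yI E])
    also have "\<dots> = (dd (X i) (X i a) a, 0)"
      using dd_Pair[OF dd_fst(2)[OF dX] differentiable_const, of 0 "(X i a, 0)"] dd_fst(1)[OF dX, of "(X i a, 0)"]
      by (simp add: y)
    finally have 2: "fst (field_in A ?c (nabla A g (?E i) (?E i)) y)
      = dd (X i) (X i a) a + christoffel (metric_in A\<^sub>B g\<^sub>B c1) a (X i a) (X i a)" by simp
    have "vf_apply A (nabla A g (?E i) (?E i)) ?f x
      = dd (q c1) (dd (X i) (X i a) a + christoffel (metric_in A\<^sub>B g\<^sub>B c1) a (X i a) (X i a)) a"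
      using vf[OF cA(2), folded y_def] 2 by (simp add: y)
    then show ?thesis
      using 1 linear_add[OF linear_dd[OF dq[OF aI]]] by simp
  qed
  then show ?thesis
    unfolding warped_laplacian_def Let_def by (intro sum.cong refl) simp
qed

end

section \<open>Mixed curvatures, an adapted basis and the inequality at a point\<close>

lemma (in riemannian) metric_in_field_in:
  assumes c: "c \<in> A" "p \<in> fst c"
  shows "metric_in A g c (snd c p) (field_in A c X (snd c p)) (field_in A c Y (snd c p)) = g p (X p) (Y p)"
  using chart_change_trans[OF chart_at(1) c(1) chart_at(1) chart_at(2) c(2) chart_at(2)]
    chart_change_refl[OF chart_at]
  by (simp add: metric_in_eq[OF c] field_in_def Let_def inv_left[OF c])

text \<open>By \<open>riem_mixed\<close> the curvature sends \<open>(0, v)\<close> to a multiple of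
  itself with a factor that does not involve \<open>v\<close>; pairing with the unit vector leaves
  this factor.\<close>

lemma (in warped_product) mixed_curvature:
  assumes x: "chart_at A x = prod_chart c1 c2" and c: "c1 \<in> A\<^sub>B" "c2 \<in> A\<^sub>F" "fst x \<in> fst c1" "snd x \<in> fst c2"
    and v: "g x (0, v) (0, v) = 1"
  defines "a \<equiv> snd c1 (fst x)"
  shows "g x (curvature_tensor A g x (0, v) (u, 0) (u, 0)) (0, v)
    = (dd (q c1) (christoffel (metric_in A\<^sub>B g\<^sub>B c1) a u u) a - dd (dd (q c1) u) u a) / f (fst x)"
proof -
  let ?c = "prod_chart c1 c2"
  interpret W: warped_coordinates "chart_image c1" "metric_in A\<^sub>B g\<^sub>B c1" "chart_image c2" "metric_in A\<^sub>F g\<^sub>F c2"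
    "metric_in A g ?c" "q c1" using warped_coordinates[OF c(1,2)] .
  interpret s: scalar_product "g x" using M.scalar_product .
  define y where "y = snd ?c x"
  have y: "fst y = a" by (simp add: y_def a_def snd_prod_chart)
  have yI: "y \<in> chart_image c1 \<times> chart_image c2"
    using c by (simp add: y_def snd_prod_chart chart_image_in)
  let ?r = "(dd (q c1) (christoffel (metric_in A\<^sub>B g\<^sub>B c1) a u u) a - dd (dd (q c1) u) u a) / f (fst x)"
  have qa: "q c1 a = f (fst x)" by (simp add: a_def B.inv_left[OF c(1,3)])
  have "curvature_tensor A g x (0, v) (u, 0) (u, 0) = W.L.riem y (0, v) (u, 0) (u, 0)"
    by (simp add: curvature_tensor_def Let_def x y_def W.L.riem_def)
  also have "\<dots> = ?r *\<^sub>R (0, v)"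
    unfolding W.riem_mixed[OF yI] y qa by simp
  finally show ?thesis using v by (simp only: s.bilin_simps real_scaleR_def)
qed

text \<open>The fibre vectors are divided by \<open>f\<close> because the metric multiplies the
  fibre block by its square. The base vectors come from the very frame in the definition of the
  Laplacian, so the sum of curvatures over them can be matched with it.\<close>

lemma (in warped_product) adapted_frame:
  assumes x: "chart_at A x = prod_chart c1 c2" and c: "c1 \<in> A\<^sub>B" "c2 \<in> A\<^sub>F" "fst x \<in> fst c1" "snd x \<in> fst c2"
  defines "X \<equiv> \<lambda>i. field_in A\<^sub>B c1 (local_frame A\<^sub>B g\<^sub>B (fst x) i) (snd c1 (fst x))"
    and "V \<equiv> \<lambda>i. (1 / f (fst x)) *\<^sub>R field_in A\<^sub>F c2 (local_frame A\<^sub>F g\<^sub>F (snd x) i) (snd c2 (snd x))"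
  shows "scalar_product.orthonormal (g x) DIM('e1 \<times> 'e2)
    (\<lambda>k. if k < DIM('e1) then (X k, 0) else (0, V (k - DIM('e1))))"
proof -
  let ?c = "prod_chart c1 c2" and ?a = "snd c1 (fst x)" and ?z = "snd c2 (snd x)"
  have I: "?a \<in> chart_image c1" "?z \<in> chart_image c2" using c by (auto simp: chart_image_in)
  interpret s: scalar_product "g x" using M.scalar_product .
  interpret s1: scalar_product "metric_in A\<^sub>B g\<^sub>B c1 ?a"
    using local_metric.scalar_product[OF B.local_metric[OF c(1)] I(1)] .
  interpret s2: scalar_product "metric_in A\<^sub>F g\<^sub>F c2 ?z"
    using local_metric.scalar_product[OF F.local_metric[OF c(2)] I(2)] .
  have f0: "f (fst x) \<noteq> 0" using f_pos[of "fst x"] by simp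
  have gx: "g x u v = metric_in A\<^sub>B g\<^sub>B c1 ?a (fst u) (fst v)
      + (f (fst x))\<^sup>2 * metric_in A\<^sub>F g\<^sub>F c2 ?z (snd u) (snd v)" for u v
    using metric_in_warped[OF c(1,2), of "(?a, ?z)" u v] M.metric_in_chart_at[of x] I
    by (simp add: x snd_prod_chart B.inv_left[OF c(1,3)])
  have X: "metric_in A\<^sub>B g\<^sub>B c1 ?a (X i) (X j) = (if i = j then 1 else 0)"
    if "i < DIM('e1)" "j < DIM('e1)" for i j
    using B.orthonormal_local_frame[of "fst x"] that
    by (simp add: X_def B.metric_in_field_in[OF c(1,3)] scalar_product.orthonormal_def[OF B.scalar_product])
  have V: "metric_in A\<^sub>F g\<^sub>F c2 ?z (V i) (V j) = (if i = j then 1 / (f (fst x))\<^sup>2 else 0)"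
    if "i < DIM('e2)" "j < DIM('e2)" for i j
    using F.orthonormal_local_frame[of "snd x"] that
    by (simp add: V_def s2.bilin_simps F.metric_in_field_in[OF c(2,4)] power2_eq_square
        scalar_product.orthonormal_def[OF F.scalar_product])
  show ?thesis
    unfolding s.orthonormal_def
    using f0 by (auto simp: gx X V s1.bilin_simps s2.bilin_simps)
qed

theorem theorem3p4:
  fixes A\<^sub>B :: "('b::{t2_space, second_countable_topology}, 'e1::euclidean_space) atlas"
    and g\<^sub>B :: "'b \<Rightarrow> 'e1 \<Rightarrow> 'e1 \<Rightarrow> real"
    and A\<^sub>F :: "('f::{t2_space, second_countable_topology}, 'e2::euclidean_space) atlas"
    and g\<^sub>F :: "'f \<Rightarrow> 'e2 \<Rightarrow> 'e2 \<Rightarrow> real"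
    and A' :: "('n::{t2_space, second_countable_topology}, 'd::euclidean_space) atlas"
    and g' :: "'n \<Rightarrow> 'd \<Rightarrow> 'd \<Rightarrow> real"
    and f :: "'b \<Rightarrow> real"
    and \<phi> :: "'b \<times> 'f \<Rightarrow> 'n"
    and A :: "('b \<times> 'f, 'e1 \<times> 'e2) atlas"
    and g :: "'b \<times> 'f \<Rightarrow> 'e1 \<times> 'e2 \<Rightarrow> 'e1 \<times> 'e2 \<Rightarrow> real"
    and n1 n2 n :: nat
  assumes "riemannian_manifold A\<^sub>B g\<^sub>B" and "riemannian_manifold A\<^sub>F g\<^sub>F"
    and "n1 = DIM('e1)" and "n2 = DIM('e2)" and "n = n1 + n2"
    and "smooth_fun A\<^sub>B f" and "\<And>b. f b > 0"
    and "A = product_atlas A\<^sub>B A\<^sub>F" and "g = warped_metric A\<^sub>B g\<^sub>B f A\<^sub>F g\<^sub>F"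
    and "riemannian_manifold A' g'"
    and "isometric_immersion A g A' g' \<phi>"
  shows "\<forall>x. warped_laplacian A\<^sub>B g\<^sub>B f A\<^sub>F g\<^sub>F f x / f (fst x)
       \<ge> real n1 * (real n)\<^sup>2 / (2 * (real n - 1)) * squared_mean_curvature A g A' g' \<phi> x
         - real n1 / 2 * squared_norm_sff A g A' g' \<phi> x
         + real n1 * inf_sectional A A' g' \<phi> x"
proof
  fix x :: "'b \<times> 'f"
  note A = assms(8) and g = assms(9)
  interpret warped_product A\<^sub>B g\<^sub>B A\<^sub>F g\<^sub>F f
    using assms(1,2,6,7) by unfold_locales
  interpret Iso: isometry "product_atlas A\<^sub>B A\<^sub>F" "warped_metric A\<^sub>B g\<^sub>B f A\<^sub>F g\<^sub>F" A' g' \<phi>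
    using assms(10,11) unfolding A g by unfold_locales
  obtain c1 c2 where c: "chart_at A x = prod_chart c1 c2" "c1 \<in> A\<^sub>B" "c2 \<in> A\<^sub>F"
    "fst x \<in> fst c1" "snd x \<in> fst c2"
    using chart_at_product unfolding A .
  define a where "a = snd c1 (fst x)"
  define X where "X i = field_in A\<^sub>B c1 (local_frame A\<^sub>B g\<^sub>B (fst x) i) a" for i
  define V where "V i = (1 / f (fst x)) *\<^sub>R field_in A\<^sub>F c2 (local_frame A\<^sub>F g\<^sub>F (snd x) i) (snd c2 (snd x))" for i
  define e where "e k = (if k < DIM('e1) then (X k, 0) else (0, V (k - DIM('e1))))" for k
  define bound where "bound = (real n)\<^sup>2 / (2 * (real n - 1)) * squared_mean_curvature A g A' g' \<phi> x
      - squared_norm_sff A g A' g' \<phi> x / 2 + inf_sectional A A' g' \<phi> x"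
  have n: "DIM('e1 \<times> 'e2) = n" "DIM('e1) = n1" "DIM('e2) = n2" "n1 < n"
    using assms(3-5) by auto
  interpret s: scalar_product "g x" unfolding g using M.scalar_product .
  have e: "s.orthonormal DIM('e1 \<times> 'e2) e"
    using adapted_frame[OF c[unfolded A]] unfolding g e_def[abs_def] X_def V_def a_def .
  \<comment> \<open>Index \<open>n1\<close> is the first fibre vector; \<open>n1 < n\<close> holds
    since the fibre has positive dimension.\<close>
  have v: "g x (0, V 0) (0, V 0) = 1"
    using e n by (auto simp: s.orthonormal_def e_def dest!: spec[of _ n1])
  have "bound \<le> (dd (\<lambda>a. f (chart_inv c1 a)) (christoffel (metric_in A\<^sub>B g\<^sub>B c1) a (X i) (X i)) a
      - dd (dd (\<lambda>a. f (chart_inv c1 a)) (X i)) (X i) a) / f (fst x)" if i: "i < n1" for i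
  proof -
    \<comment> \<open>The same fibre vector \<open>e n1\<close> is used for every \<open>i\<close>;
      it takes the first slot and the base vector the second, as in
      \<open>mixed_curvature\<close>.\<close>
    have "bound \<le> g x (curvature_tensor A g x (e n1) (e i) (e i)) (e n1)"
      unfolding bound_def A g
      by (rule Iso.chen_curvature[OF e[unfolded g], unfolded n(1)]) (use i n in auto)
    also have "e n1 = (0, V 0)" using n by (simp add: e_def)
    also have "e i = (X i, 0)" using n i by (simp add: e_def)
    finally show ?thesis
      using mixed_curvature[OF c[unfolded A], of "V 0" "X i"] v unfolding A g a_def by simp
  qed
  \<comment> \<open>The bound does not depend on \<open>i\<close>, so summing over the base vectors
    multiplies it by \<open>n1\<close>.\<close>
  then have "(\<Sum>i<n1. bound) \<le> (\<Sum>i<n1. (dd (\<lambda>a. f (chart_inv c1 a)) (christoffel (metric_in A\<^sub>B g\<^sub>B c1) a (X i) (X i)) a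
      - dd (dd (\<lambda>a. f (chart_inv c1 a)) (X i)) (X i) a) / f (fst x))"
    by (intro sum_mono) simp
  also have "\<dots> = warped_laplacian A\<^sub>B g\<^sub>B f A\<^sub>F g\<^sub>F f x / f (fst x)"
    unfolding warped_laplacian_eq[OF c[unfolded A]] n sum_divide_distrib X_def a_def ..
  finally have "real n1 * bound \<le> warped_laplacian A\<^sub>B g\<^sub>B f A\<^sub>F g\<^sub>F f x / f (fst x)" by simp
  then show "warped_laplacian A\<^sub>B g\<^sub>B f A\<^sub>F g\<^sub>F f x / f (fst x)
       \<ge> real n1 * (real n)\<^sup>2 / (2 * (real n - 1)) * squared_mean_curvature A g A' g' \<phi> x
         - real n1 / 2 * squared_norm_sff A g A' g' \<phi> x
         + real n1 * inf_sectional A A' g' \<phi> x"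
    by (simp add: bound_def algebra_simps)
qed

end
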